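(* Let $1\leq p_1,\dots,p_m<\infty$, and let $\frac1p=\frac1{p_1}+\dots+\frac1{p_m}$. Let $w_1,\dots,w_m$ be weights on $\mathbb R^n$ with $w_i\in A_{p_i}^{\mathcal R}$ for $i=1,\dots,m$, and write $\nu_{\vec w}=w_1^{p/p_1}\cdots w_m^{p/p_m}$. Then there exists a constant $C>0$ such that the inequality $$\Vert M^\otimes(\vec f)\Vert_{L^{p,\infty}(\nu_{\vec w})}\leq C\prod_{i=1}^m\Vert f_i\Vert_{L^{p_i,1}(w_i)}$$ holds for every vector of measurable functions $\vec f=(f_1,\dots,f_m)$ on $\mathbb R^n$.
   Context: A weight is a positive, locally integrable function on $\mathbb R^n$. Cubes have sides parallel to the axes. For a weight $w$ and a measurable set $E$, $w(E)=\int_E w(x)\,dx$, and $\frac1q+\frac1{q'}=1$. The Hardy-Littlewood maximal operator is $Mf(x)=\sup_{Q\ni x}\frac1{|Q|}\int_Q|f|$ (supremum over all cubes $Q$ containing $x$), and its $m$-fold product is $M^\otimes(\vec f)(x)=\prod_{i=1}^m Mf_i(x)$. For a weight $w$ (identified with the measure $w(x)\,dx$), put $\lambda_f^w(y)=w(\{x:|f(x)|>y\})$. For $q>0$: $\Vert f\Vert_{L^{q,1}(w)}=q\int_0^\infty \lambda_f^w(y)^{1/q}\,dy$ and $\Vert f\Vert_{L^{q,\infty}(w)}=\sup_{y>0} y\,\lambda_f^w(y)^{1/q}$; $L^{\infty,\infty}(w)$ means $L^\infty(w)$. For $1\le q<\infty$, $w\in A_q^{\mathcal R}$ means $[w]_{A_q^{\mathcal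 R}}=\sup_Q w(Q)^{1/q}\,\frac{\Vert \chi_Q w^{-1}\Vert_{L^{q',\infty}(w)}}{|Q|}<\infty$ (supremum over all cubes), so $A_1^{\mathcal R}=A_1$. *)

theory Defs
  imports "HOL-Analysis.Analysis" "HOL-Probability.Essential_Supremum"
begin

text \<open>
  All norms and operators below depend on a function only through its modulus. They are therefore
  stated for functions with values in \<open>[0, \<infinity>]\<close>, standing for \<open>|f|\<close>; this also accommodates
  maximal functions, which may be infinite. Products use the convention \<open>0 * \<infinity> = 0\<close> of
  \<^typ>\<open>ennreal\<close>.
\<close>

text \<open>Nondegenerate closed cubes. The suprema below are the same for open cubes.\<close>

definition cubes :: "(real ^ 'n) set set" where
  "cubes = {cbox a (\<chi> i. a $ i + l) | a l. 0 < l}"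

text \<open>
  Positivity is required almost everywhere only, so that for instance powers of \<open>|x|\<close> are weights
  although they vanish at the origin (as real-valued HOL functions).
\<close>

definition weight :: "(real ^ 'n \<Rightarrow> real) \<Rightarrow> bool" where
  "weight w \<longleftrightarrow> w \<in> borel_measurable lebesgue \<and> (AE x in lebesgue. 0 < w x) \<and>
     (\<forall>K. compact K \<longrightarrow> w absolutely_integrable_on K)"

definition wmeasure :: "(real ^ 'n \<Rightarrow> real) \<Rightarrow> (real ^ 'n) measure" where
  "wmeasure w = density lebesgue (\<lambda>x. ennreal (w x))"

text \<open>Real powers on \<open>[0, \<infinity>]\<close>, for exponents \<open>s > 0\<close>.\<close>

definition epowr :: "ennreal \<Rightarrow> real \<Rightarrow> ennreal" where
  "epowr a s = (if a = \<infinity> then \<infinity> else ennreal (enn2real a powr s))"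

definition distr_fun :: "(real ^ 'n \<Rightarrow> real) \<Rightarrow> (real ^ 'n \<Rightarrow> ennreal) \<Rightarrow> real \<Rightarrow> ennreal" where
  "distr_fun w g y = emeasure (wmeasure w) {x. g x > ennreal y}"

text \<open>The \<open>L\<^bsup>q,1\<^esup>(w)\<close> norm, for \<open>0 < q < \<infinity>\<close>.\<close>

definition norm_Lq1 :: "real \<Rightarrow> (real ^ 'n \<Rightarrow> real) \<Rightarrow> (real ^ 'n \<Rightarrow> ennreal) \<Rightarrow> ennreal" where
  "norm_Lq1 q w g = ennreal q * (\<integral>\<^sup>+y\<in>{0<..}. epowr (distr_fun w g y) (1 / q) \<partial>lborel)"

text \<open>The \<open>L\<^bsup>q,\<infinity>\<^esup>(w)\<close> norm, for \<open>0 < q \<le> \<infinity>\<close>.\<close>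

definition norm_Lqinf :: "ereal \<Rightarrow> (real ^ 'n \<Rightarrow> real) \<Rightarrow> (real ^ 'n \<Rightarrow> ennreal) \<Rightarrow> ennreal" where
  "norm_Lqinf q w g =
     (if q = \<infinity> then esssup (wmeasure w) g
      else SUP y\<in>{0<..}. ennreal y * epowr (distr_fun w g y) (1 / real_of_ereal q))"

definition conj_exponent :: "real \<Rightarrow> ereal" where
  "conj_exponent q = (if q = 1 then \<infinity> else ereal (q / (q - 1)))"

definition AR_const :: "real \<Rightarrow> (real ^ 'n \<Rightarrow> real) \<Rightarrow> ennreal" where
  "AR_const q w =
     (SUP Q\<in>cubes. epowr (emeasure (wmeasure w) Q) (1 / q)
        * norm_Lqinf (conj_exponent q) w (\<lambda>x. ennreal (indicator Q x * inverse (w x)))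
        / emeasure lebesgue Q)"

definition AR_class :: "real \<Rightarrow> (real ^ 'n \<Rightarrow> real) set" where
  "AR_class q = {w. weight w \<and> AR_const q w < \<infinity>}"

definition HL_maximal :: "(real ^ 'n \<Rightarrow> ennreal) \<Rightarrow> real ^ 'n \<Rightarrow> ennreal" where
  "HL_maximal g x =
     (SUP Q\<in>{Q \<in> cubes. x \<in> Q}. (\<integral>\<^sup>+t\<in>Q. g t \<partial>lebesgue) / emeasure lebesgue Q)"

abbreviation modulus :: "(real ^ 'n \<Rightarrow> complex) \<Rightarrow> real ^ 'n \<Rightarrow> ennreal" where
  "modulus f \<equiv> (\<lambda>x. ennreal (norm (f x)))"

definition HL_maximal_prod :: "nat \<Rightarrow> (nat \<Rightarrow> real ^ 'n \<Rightarrow> complex) \<Rightarrow> real ^ 'n \<Rightarrow> ennreal" where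
  "HL_maximal_prod m f x = (\<Prod>i=1..m. HL_maximal (modulus (f i)) x)"

end

theory Submission
  imports Defs
begin

text \<open>
  Weak type bounds for the single operators \<open>M f_i\<close> do not combine into the claim, because there is
  no Hoelder inequality for weak Lebesgue spaces over different weights. The way out is to work on
  a slice \<open>E = {l < \<Prod> M f_i \<le> 2 l}\<close> of the product. On \<open>E\<close> one has
  \<open>l powr P * \<nu> \<le> \<Prod> (w_i (M f_i)^{p_i})^{P / p_i}\<close>, so that ordinary Hoelder
  (\<open>product_weight_slice\<close>) bounds \<open>\<nu>(E)\<close> by the integrals over \<open>E\<close> of \<open>(M f_i)^{p_i} w_i\<close>, and the
  slices \<open>l = 2^s y\<close> add up to the level set \<open>{\<Prod> M f_i > y}\<close> with a geometric series. What remains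
  is a strong type estimate for one factor over a slice (\<open>maximal_product_estimate\<close>):
  with \<open>G = \<Prod>_{j \<noteq> i} M f_j\<close>, \<open>q = p_i\<close> and \<open>u = w_i\<close>,
  the integral of \<open>(M f)^q u\<close> over \<open>{l < M f * G \<le> 2 l}\<close> is at most \<open>C ||f||^q\<close> in \<open>L^{q,1}(u)\<close>.
  This is a mixed weak type inequality of Sawyer type, for the weight \<open>1 / G\<close>.

  The class \<open>A_q^R\<close> enters through the inequality
  \<open>|E| / |Q| \<le> K (u(E) / u(Q))^{1/q}\<close> for \<open>E \<subseteq> Q\<close>, which is the assumption of the locale
  \<open>restricted_weight\<close>. It makes \<open>u\<close> doubling, and through the layer cake formula it gives the
  packing estimate \<open>\<Sum>_j (avg_{Q_j} f)^q u(Q_j) \<le> C ||f||^q\<close> for disjoint cubes (\<open>packing\<close>).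

  For the one factor estimate, let \<open>Q\<close> be a cube around \<open>x\<close> whose average nearly attains \<open>M f(x)\<close>,
  and let \<open>G_Q\<close> be the product over \<open>j\<close> of the infima of \<open>M f_j\<close> over \<open>Q\<close>. The points are sorted
  into classes \<open>k = 0, 1, ...\<close> according to the ratio \<open>l / (G_Q M f(x)) \<approx> B^k\<close>.
  Within one class, a Vitali selection leaves disjoint cubes \<open>R\<close>, and on the part of the class that
  \<open>R\<close> accounts for, \<open>M f\<close> is at most a constant times the average of \<open>f\<close> over \<open>R\<close>. This works
  because \<open>G_Q\<close> is monotone in \<open>Q\<close> and comparable on \<open>R\<close> and on its dilate \<open>3 R\<close>
  (\<open>inf_maximal_dilate\<close>). Moreover, in class \<open>k\<close> the function \<open>G\<close> exceeds its typical size
  \<open>G_{3R}\<close> by a factor \<open>B^{k-1}\<close>, and the set where this happens has exponentially small \<open>u\<close>-measure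
  in \<open>3 R\<close> (\<open>maximal_decay\<close>). Packing then bounds each class by \<open>||f||^q\<close> times a term of a
  convergent series.

  The exponential decay comes from an iteration that needs no dyadic cubes (\<open>level_set_decay\<close>):
  cover the level set \<open>{M h > l}\<close> by nearly maximal cubes \<open>R\<close> with average above \<open>l\<close>. They lie inside
  the level set, while by maximality and the weak (1,1) inequality the higher level set
  \<open>{M h > A l}\<close> fills at most half of each \<open>R\<close>. Hence a fixed proportion of the \<open>u\<close>-measure is lost
  from one level to the next.
\<close>

section \<open>Cubes and averages\<close>

text \<open>
  The default rule would replace Lebesgue measure by Borel measure of main parts, which hides the
  measures of cubes.
\<close>

declare emeasure_completion [simp del]

text \<open>
  A cube is given by the pair of its center and half its side length: dilation, rational
  approximation and the comparison of sizes that drives the Vitali selection are then operations on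
  the pair.
\<close>

definition cube :: "(real ^ 'n) \<times> real \<Rightarrow> (real ^ 'n) set" where
  "cube Q = {x. \<forall>i. \<bar>x $ i - fst Q $ i\<bar> \<le> snd Q}"

definition vol :: "(real ^ 'n) \<times> real \<Rightarrow> real" where
  "vol Q = (2 * snd Q) ^ CARD('n)"

definition dilate :: "real \<Rightarrow> (real ^ 'n) \<times> real \<Rightarrow> (real ^ 'n) \<times> real" where
  "dilate k Q = (fst Q, k * snd Q)"

definition avg :: "(real ^ 'n \<Rightarrow> ennreal) \<Rightarrow> (real ^ 'n) \<times> real \<Rightarrow> ennreal" where
  "avg g Q = (\<integral>\<^sup>+t\<in>cube Q. g t \<partial>lebesgue) / ennreal (vol Q)"

lemma snd_dilate [simp]: "snd (dilate k Q) = k * snd Q"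
  by (simp add: dilate_def)

lemma fst_dilate [simp]: "fst (dilate k Q) = fst Q"
  by (simp add: dilate_def)

lemma cube_eq_cbox: "cube Q = cbox (\<chi> i. fst Q $ i - snd Q) (\<chi> i. fst Q $ i + snd Q)"
  by (auto simp: cube_def mem_box_cart abs_le_iff field_simps)

lemma cube_sets [measurable, simp]: "cube Q \<in> sets lebesgue"
  by (simp add: cube_eq_cbox)

lemma vol_pos: "0 < snd Q \<Longrightarrow> 0 < vol Q"
  by (simp add: vol_def)

lemma vol_dilate: "vol (dilate k Q) = k ^ CARD('n) * vol (Q :: (real ^ 'n) \<times> real)"
  by (simp add: vol_def power_mult_distrib)

lemma emeasure_cube [simp]:
  fixes Q :: "(real ^ 'n) \<times> real"
  assumes "0 < snd Q"
  shows "emeasure lebesgue (cube Q) = ennreal (vol Q)"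
proof -
  have ne: "cbox (\<chi> i. fst Q $ i - snd Q) (\<chi> i. fst Q $ i + snd Q) \<noteq> {}"
    using assms by (auto simp: cube_eq_cbox[symmetric] cube_def intro!: exI[of _ "fst Q"])
  have "emeasure lborel (cube Q) = ennreal (measure lborel (cube Q))"
    using emeasure_lborel_cbox_finite by (intro emeasure_eq_ennreal_measure) (auto simp: cube_eq_cbox less_top)
  also have "measure lborel (cube Q) = vol Q"
    using content_cbox_cart[OF ne] by (simp add: cube_eq_cbox vol_def)
  finally show ?thesis by (simp add: cube_eq_cbox emeasure_completion)
qed

lemma cubes_eq: "cubes = {cube Q |Q. 0 < snd Q}"
proof (intro set_eqI iffI)
  fix X :: "(real ^ 'n) set"
  assume "X \<in> cubes"
  then obtain a l where X: "X = cbox a (\<chi> i. a $ i + l)" "0 < l"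
    by (auto simp: cubes_def)
  have "X = cube (\<chi> i. a $ i + l / 2, l / 2)"
    by (simp add: X cube_eq_cbox add.assoc)
  moreover have "0 < snd (\<chi> i. a $ i + l / 2, l / 2)" using X(2) by simp
  ultimately show "X \<in> {cube Q |Q. 0 < snd Q}" by blast
next
  fix X :: "(real ^ 'n) set"
  assume "X \<in> {cube Q |Q. 0 < snd Q}"
  then obtain Q where Q: "X = cube Q" "0 < snd Q" by auto
  have "X = cbox (\<chi> i. fst Q $ i - snd Q) (\<chi> i. (\<chi> i. fst Q $ i - snd Q) $ i + 2 * snd Q)"
    unfolding Q(1) cube_eq_cbox by (rule arg_cong2[where f = cbox]) (auto simp: vec_eq_iff)
  moreover have "0 < 2 * snd Q" using Q by simp
  ultimately show "X \<in> cubes" unfolding cubes_def by blast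
qed

lemma cube_subset_if_meets:
  assumes "cube Q \<inter> cube R \<noteq> {}" "fst R = fst S" "snd R + 2 * snd Q \<le> snd S"
  shows "cube Q \<subseteq> cube S"
proof
  fix x assume x: "x \<in> cube Q"
  obtain z where z: "z \<in> cube Q" "z \<in> cube R" using assms(1) by auto
  have "\<bar>x $ i - fst S $ i\<bar> \<le> snd S" for i
  proof -
    have "\<bar>x $ i - fst Q $ i\<bar> \<le> snd Q" "\<bar>z $ i - fst Q $ i\<bar> \<le> snd Q" "\<bar>z $ i - fst R $ i\<bar> \<le> snd R"
      using x z by (auto simp: cube_def)
    then show ?thesis using assms(2,3) by (smt (verit))
  qed
  then show "x \<in> cube S" by (simp add: cube_def)
qed

lemma cube_subset_dilate:
  assumes "cube Q \<inter> cube R \<noteq> {}" "snd Q \<le> snd R"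
  shows "cube Q \<subseteq> cube (dilate 3 R)"
  using assms by (intro cube_subset_if_meets[of Q R]) auto

lemma cube_subset_dilate_self: "1 \<le> k \<Longrightarrow> 0 < snd Q \<Longrightarrow> cube Q \<subseteq> cube (dilate k Q)"
proof -
  assume k: "1 \<le> k" "0 < snd Q"
  then have "snd Q \<le> k * snd Q" by (simp add: mult_le_cancel_right1)
  then show ?thesis unfolding cube_def snd_dilate fst_dilate by (auto intro: order_trans)
qed

lemma HL_maximal_eq: "HL_maximal g x = (SUP Q\<in>{Q. 0 < snd Q \<and> x \<in> cube Q}. avg g Q)"
proof -
  have "{Q \<in> cubes. x \<in> Q} = cube ` {Q. 0 < snd Q \<and> x \<in> cube Q}"
    unfolding cubes_eq by blast
  then show ?thesis unfolding HL_maximal_def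
    by (auto simp: image_image avg_def emeasure_cube intro!: SUP_cong)
qed

lemma avg_le_HL: "0 < snd Q \<Longrightarrow> x \<in> cube Q \<Longrightarrow> avg g Q \<le> HL_maximal g x"
  by (auto simp: HL_maximal_eq intro: SUP_upper)

lemma less_HL_iff: "a < HL_maximal g x \<longleftrightarrow> (\<exists>Q. 0 < snd Q \<and> x \<in> cube Q \<and> a < avg g Q)"
  by (auto simp: HL_maximal_eq less_SUP_iff)

text \<open>
  Passing to a larger cube costs only the ratio of the volumes; this is the reason why every
  comparison between overlapping cubes of comparable size below loses a constant at most.
\<close>

lemma avg_mono:
  fixes Q :: "(real ^ 'n) \<times> real"
  assumes "cube Q \<subseteq> cube R" "0 < snd Q" "snd R = k * snd Q" "0 < k"
  shows "avg g Q \<le> ennreal (k ^ CARD('n)) * avg g R"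
proof -
  have v: "vol R = k ^ CARD('n) * vol Q" using assms by (simp add: vol_def power_mult_distrib)
  have "avg g Q \<le> (\<integral>\<^sup>+t\<in>cube R. g t \<partial>lebesgue) / ennreal (vol Q)"
    unfolding avg_def using assms(1)
    by (intro divide_right_mono_ennreal nn_integral_mono) (auto simp: indicator_def)
  also have "\<dots> = ennreal (k ^ CARD('n)) * avg g R"
  proof -
    have "inverse (ennreal (vol Q)) = ennreal (k ^ CARD('n)) * inverse (ennreal (vol R))"
      using assms vol_pos[of Q] unfolding v
      by (simp add: inverse_ennreal ennreal_mult[symmetric] field_simps)
    then show ?thesis unfolding avg_def divide_ennreal_def
      by (simp add: ac_simps)
  qed
  finally show ?thesis .
qed

lemma less_HLI: "0 < snd Q \<Longrightarrow> x \<in> cube Q \<Longrightarrow> a < avg g Q \<Longrightarrow> a < HL_maximal g x"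
  by (rule order_less_le_trans[OF _ avg_le_HL])

text \<open>
  Cubes with rational data are countably many. They compute the maximal function exactly
  (\<open>less_HL_iff_rat\<close>), which settles measurability and lets covering arguments run over sequences.
\<close>

definition rat_cubes :: "((real ^ 'n) \<times> real) set" where
  "rat_cubes = {Q. (\<forall>i. fst Q $ i \<in> \<rat>) \<and> snd Q \<in> \<rat> \<and> 0 < snd Q}"

lemma countable_rat_cubes: "countable (rat_cubes :: ((real ^ 'n) \<times> real) set)"
proof -
  have "countable {x :: real ^ 'n. \<forall>i. x $ i \<in> \<rat>}"
  proof -
    have "countable (PiE (UNIV :: 'n set) (\<lambda>_. (\<rat> :: real set)))"
      by (intro countable_PiE) (auto simp: countable_rat)
    then have "countable ((\<lambda>f. \<chi> i. f i) ` (PiE (UNIV :: 'n set) (\<lambda>_. (\<rat> :: real set))))"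
      by simp
    moreover have "{x :: real ^ 'n. \<forall>i. x $ i \<in> \<rat>} \<subseteq> (\<lambda>f. \<chi> i. f i) ` (PiE (UNIV :: 'n set) (\<lambda>_. (\<rat> :: real set)))"
    proof
      fix x :: "real ^ 'n" assume "x \<in> {x. \<forall>i. x $ i \<in> \<rat>}"
      then show "x \<in> (\<lambda>f. \<chi> i. f i) ` (PiE (UNIV :: 'n set) (\<lambda>_. (\<rat> :: real set)))"
        by (intro image_eqI[of _ _ "\<lambda>i. x $ i"]) auto
    qed
    ultimately show ?thesis using countable_subset by blast
  qed
  then have "countable ({x :: real ^ 'n. \<forall>i. x $ i \<in> \<rat>} \<times> (\<rat> :: real set))"
    by (simp add: countable_rat)
  then show ?thesis
    by (rule countable_subset[rotated]) (auto simp: rat_cubes_def)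
qed

text \<open>
  The average depends continuously on the half side length in the denominator, so that a slightly
  larger rational cube still has average above \<open>a\<close>.
\<close>

lemma rat_cube_approx:
  fixes Q :: "(real ^ 'n) \<times> real"
  assumes "0 < snd Q" "a < avg g Q"
  obtains R where "R \<in> rat_cubes" "cube Q \<subseteq> cube R" "snd Q < snd R" "a < avg g R"
proof -
  define n where "n = CARD('n)"
  define I where "I = (\<integral>\<^sup>+t\<in>cube Q. g t \<partial>lebesgue)"
  have "\<exists>r>snd Q. \<forall>s. snd Q < s \<and> s < r \<longrightarrow> a < I / ennreal ((2 * s) ^ n)"
  proof (cases "I = \<infinity>")
    case True
    have "a < I / ennreal ((2 * s) ^ n)" for s
      using assms True by (auto simp: avg_def ennreal_top_divide less_top I_def vol_def)
    then show ?thesis by (intro exI[of _ "snd Q + 1"]) auto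
  next
    case False
    then obtain i where i: "I = ennreal i" "0 \<le> i" by (cases I) auto
    have "a < \<infinity>" using assms by (auto simp: less_top[symmetric])
    then obtain b where b: "a = ennreal b" "0 \<le> b" by (cases a) auto
    have "b < i / (2 * snd Q) ^ n"
      using assms i b unfolding avg_def I_def[symmetric] vol_def n_def
      by (simp add: divide_ennreal ennreal_less_iff)
    moreover have "((\<lambda>s. i / (2 * s) ^ n) \<longlongrightarrow> i / (2 * snd Q) ^ n) (at_right (snd Q))"
      using assms by (intro tendsto_intros) auto
    ultimately have "eventually (\<lambda>s. b < i / (2 * s) ^ n) (at_right (snd Q))"
      using order_tendstoD(1) by blast
    then obtain r where r: "r > snd Q" "\<And>s. snd Q < s \<Longrightarrow> s < r \<Longrightarrow> b < i / (2 * s) ^ n"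
      using eventually_at_right_field by (metis (no_types, lifting))
    then show ?thesis using assms i b
      by (intro exI[of _ r]) (auto simp: divide_ennreal ennreal_less_iff)
  qed
  then obtain r where r: "r > snd Q" "\<And>s. snd Q < s \<Longrightarrow> s < r \<Longrightarrow> a < I / ennreal ((2 * s) ^ n)"
    by auto
  obtain s where s: "s \<in> \<rat>" "snd Q < s" "s < r" using Rats_dense_in_real[OF r(1)] by auto
  have "\<exists>d\<in>\<rat>. \<bar>d - fst Q $ i\<bar> \<le> s - snd Q" for i
    using Rats_dense_in_real[of "fst Q $ i" "fst Q $ i + (s - snd Q)"] s by force
  then obtain d where d: "\<And>i. d i \<in> \<rat>" "\<And>i. \<bar>d i - fst Q $ i\<bar> \<le> s - snd Q" by metis
  define R where "R = ((\<chi> i. d i) :: real ^ 'n, s)"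
  have "R \<in> rat_cubes" using d s assms by (auto simp: rat_cubes_def R_def)
  moreover have sub: "cube Q \<subseteq> cube R"
  proof
    fix x assume "x \<in> cube Q"
    then have x: "\<bar>x $ i - fst Q $ i\<bar> \<le> snd Q" for i by (auto simp: cube_def)
    have "\<bar>x $ i - d i\<bar> \<le> s" for i using d(2)[of i] x[of i] by linarith
    then show "x \<in> cube R" by (auto simp: cube_def R_def)
  qed
  moreover have "a < avg g R"
  proof -
    have "a < I / ennreal ((2 * s) ^ n)" using r s by auto
    also have "\<dots> \<le> avg g R" unfolding I_def avg_def vol_def n_def R_def snd_conv
      using sub by (intro divide_right_mono_ennreal nn_integral_mono) (auto simp: indicator_def R_def)
    finally show ?thesis .
  qed
  ultimately show thesis using s by (intro that[of R]) (auto simp: R_def)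
qed

lemma less_HL_iff_rat:
  "a < HL_maximal g x \<longleftrightarrow> (\<exists>Q\<in>rat_cubes. x \<in> cube Q \<and> a < avg g Q)"
proof
  assume "a < HL_maximal g x"
  then obtain Q where Q: "0 < snd Q" "x \<in> cube Q" "a < avg g Q" by (auto simp: less_HL_iff)
  obtain R where "R \<in> rat_cubes" "cube Q \<subseteq> cube R" "a < avg g R"
    using rat_cube_approx[OF Q(1,3)] by metis
  then show "\<exists>Q\<in>rat_cubes. x \<in> cube Q \<and> a < avg g Q"
    using Q(2) by blast
qed (auto simp: less_HL_iff rat_cubes_def)

lemma HL_level_set: "{x. a < HL_maximal g x} = (\<Union>Q\<in>{Q\<in>rat_cubes. a < avg g Q}. cube Q)"
  by (auto simp: less_HL_iff_rat)

lemma HL_maximal_measurable [measurable]: "HL_maximal g \<in> borel_measurable lebesgue"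
proof (rule borel_measurableI_greater)
  fix a
  have "{x. a < HL_maximal g x} \<in> sets lebesgue"
    unfolding HL_level_set
    by (intro sets.countable_UN') (auto intro: countable_subset[OF _ countable_rat_cubes])
  then show "{x \<in> space lebesgue. a < HL_maximal g x} \<in> sets lebesgue" by simp
qed

lemma level_set_sets: "g \<in> borel_measurable lebesgue \<Longrightarrow> {x. ennreal y < g x} \<in> sets lebesgue"
  using measurable_sets[of g lebesgue borel "{ennreal y<..}"] by (simp add: vimage_def)

section \<open>Covering arguments and the weak (1,1) inequality\<close>

text \<open>
  Greedy selection: take a largest cube, discard what meets it, and repeat.
\<close>

lemma vitali_finite:
  assumes "finite I" "\<And>Q. Q \<in> I \<Longrightarrow> 0 < snd Q"
  shows "\<exists>J\<subseteq>I. disjoint_family_on cube J \<and> (\<forall>Q\<in>I. \<exists>R\<in>J. cube Q \<inter> cube R \<noteq> {} \<and> snd Q \<le> snd R)"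
  using assms
proof (induction "card I" arbitrary: I rule: less_induct)
  case less
  show ?case
  proof (cases "I = {}")
    case True
    then show ?thesis by (auto simp: disjoint_family_on_def)
  next
    case False
    have "Max (snd ` I) \<in> snd ` I" using False less.prems by (intro Max_in) auto
    then obtain R where R: "R \<in> I" "snd R = Max (snd ` I)" by auto
    have max: "snd Q \<le> snd R" if "Q \<in> I" for Q using that R less.prems by (auto intro!: Max_ge)
    have c: "fst R \<in> cube R" using less.prems(2)[OF R(1)] by (auto simp: cube_def)
    define I' where "I' = {Q \<in> I. cube Q \<inter> cube R = {}}"
    have "I' \<subset> I" using R c by (auto simp: I'_def)
    then have "card I' < card I" using less.prems by (intro psubset_card_mono) auto
    moreover have "finite I'" "\<And>Q. Q \<in> I' \<Longrightarrow> 0 < snd Q" using less.prems by (auto simp: I'_def)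
    ultimately obtain J where J: "J \<subseteq> I'" "disjoint_family_on cube J"
      "\<And>Q. Q\<in>I' \<Longrightarrow> \<exists>R\<in>J. cube Q \<inter> cube R \<noteq> {} \<and> snd Q \<le> snd R"
      using less.hyps[of I'] by blast
    have "disjoint_family_on cube (insert R J)"
      using J(1,2) unfolding disjoint_family_on_def I'_def by blast
    moreover have "\<exists>S\<in>insert R J. cube Q \<inter> cube S \<noteq> {} \<and> snd Q \<le> snd S" if "Q \<in> I" for Q
      using J(3)[of Q] max[OF that] that by (cases "cube Q \<inter> cube R = {}") (auto simp: I'_def)
    moreover have "insert R J \<subseteq> I" using J R by (auto simp: I'_def)
    ultimately show ?thesis by blast
  qed
qed

text \<open>
  The form of the covering argument that is used three times below. To each cube \<open>Q\<close> of a
  countable family belongs a piece \<open>S Q\<close> of the set to be measured. If \<open>T R\<close> absorbs the pieces of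
  all cubes that meet \<open>R\<close> and are not larger than \<open>R\<close>, a bound for disjoint families suffices.
  Taking \<open>S Q = Q\<close> and \<open>T R = 3 R\<close> gives the usual covering lemma; the one factor estimate needs
  smaller pieces.
\<close>

lemma vitali_measure:
  fixes S T :: "(real ^ 'n) \<times> real \<Rightarrow> 'a set"
  assumes "countable F" and pos: "\<And>Q. Q \<in> F \<Longrightarrow> 0 < snd Q"
    and S: "\<And>Q. Q \<in> F \<Longrightarrow> S Q \<in> sets M" and T: "\<And>Q. Q \<in> F \<Longrightarrow> T Q \<in> sets M"
    and sub: "\<And>Q R. Q \<in> F \<Longrightarrow> R \<in> F \<Longrightarrow> cube Q \<inter> cube R \<noteq> {} \<Longrightarrow> snd Q \<le> snd R \<Longrightarrow> S Q \<subseteq> T R"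
    and bound: "\<And>J. finite J \<Longrightarrow> J \<subseteq> F \<Longrightarrow> disjoint_family_on cube J \<Longrightarrow> (\<Sum>Q\<in>J. emeasure M (T Q)) \<le> B"
  shows "emeasure M (\<Union>Q\<in>F. S Q) \<le> B"
proof (cases "F = {}")
  case False
  define e where "e = from_nat_into F"
  have e: "range e = F" using assms(1) False by (simp add: e_def range_from_nat_into)
  define A where "A n = (\<Union>Q\<in>e ` {..<n}. S Q)" for n
  have "emeasure M (A n) \<le> B" for n
  proof -
    have sub': "e ` {..<n} \<subseteq> F" using e by auto
    have pos': "0 < snd Q" if "Q \<in> e ` {..<n}" for Q
      using pos that sub' by blast
    obtain J where J: "J \<subseteq> e ` {..<n}" "disjoint_family_on cube J"
      "\<And>Q. Q\<in>e ` {..<n} \<Longrightarrow> \<exists>R\<in>J. cube Q \<inter> cube R \<noteq> {} \<and> snd Q \<le> snd R"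
      using vitali_finite[OF _ pos'] by (metis finite_imageI finite_lessThan)
    have "finite J" using J(1) by (rule finite_subset) simp
    have "J \<subseteq> F" using J(1) sub' by auto
    have "A n \<subseteq> (\<Union>Q\<in>J. T Q)"
    proof
      fix x assume "x \<in> A n"
      then obtain Q where Q: "Q \<in> e ` {..<n}" "x \<in> S Q" unfolding A_def by blast
      then obtain R where R: "R \<in> J" "cube Q \<inter> cube R \<noteq> {}" "snd Q \<le> snd R" using J(3) by blast
      have "S Q \<subseteq> T R" using sub[OF _ _ R(2,3)] Q R \<open>J \<subseteq> F\<close> sub' by blast
      then show "x \<in> (\<Union>Q\<in>J. T Q)" using Q R by blast
    qed
    then have "emeasure M (A n) \<le> emeasure M (\<Union>Q\<in>J. T Q)"
      using T \<open>finite J\<close> \<open>J \<subseteq> F\<close> by (intro emeasure_mono sets.finite_UN) auto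
    also have "\<dots> \<le> (\<Sum>Q\<in>J. emeasure M (T Q))"
      using T \<open>finite J\<close> \<open>J \<subseteq> F\<close> by (intro emeasure_subadditive_finite) auto
    also have "\<dots> \<le> B" using bound J(2) \<open>finite J\<close> \<open>J \<subseteq> F\<close> by auto
    finally show ?thesis .
  qed
  moreover have "(SUP n. emeasure M (A n)) = emeasure M (\<Union>n. A n)"
  proof (rule SUP_emeasure_incseq)
    have "S (e k) \<in> sets M" for k using S e by blast
    then show "range A \<subseteq> sets M" unfolding A_def by auto
    show "incseq A" unfolding A_def incseq_def by (intro allI impI UN_mono image_mono) auto
  qed
  moreover have "(\<Union>n. A n) = (\<Union>Q\<in>F. S Q)"
    unfolding A_def e[symmetric] by auto
  ultimately show ?thesis by (metis SUP_least)
qed simp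

text \<open>
  Weak type bounds for a doubling measure reduce to a bound for disjoint cubes of large average.
\<close>

lemma maximal_level_set_le:
  assumes M: "sets M = sets lebesgue"
    and doubling: "\<And>Q. 0 < snd Q \<Longrightarrow> emeasure M (cube (dilate 3 Q)) \<le> D * emeasure M (cube Q)"
    and bound: "\<And>J. finite J \<Longrightarrow> disjoint_family_on cube J \<Longrightarrow>
       (\<And>Q. Q \<in> J \<Longrightarrow> 0 < snd Q \<and> a < avg g Q) \<Longrightarrow> (\<Sum>Q\<in>J. emeasure M (cube Q)) \<le> B"
  shows "emeasure M {x. a < HL_maximal g x} \<le> D * B"
  unfolding HL_level_set
proof (rule vitali_measure[where T = "\<lambda>Q. cube (dilate 3 Q)"])
  show "countable {Q \<in> rat_cubes. a < avg g Q}"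
    by (auto intro: countable_subset[OF _ countable_rat_cubes])
  show "cube Q \<subseteq> cube (dilate 3 R)"
    if "cube Q \<inter> cube R \<noteq> {}" "snd Q \<le> snd R" for Q R :: "(real ^ 'a) \<times> real"
    using that by (rule cube_subset_dilate)
  fix J :: "((real ^ 'a) \<times> real) set"
  assume J: "finite J" "J \<subseteq> {Q \<in> rat_cubes. a < avg g Q}" "disjoint_family_on cube J"
  have "(\<Sum>Q\<in>J. emeasure M (cube (dilate 3 Q))) \<le> (\<Sum>Q\<in>J. D * emeasure M (cube Q))"
    using J(2) by (intro sum_mono doubling) (auto simp: rat_cubes_def)
  also have "\<dots> = D * (\<Sum>Q\<in>J. emeasure M (cube Q))" by (simp add: sum_distrib_left)
  also have "\<dots> \<le> D * B" using J by (intro mult_left_mono bound) (auto simp: rat_cubes_def)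
  finally show "(\<Sum>Q\<in>J. emeasure M (cube (dilate 3 Q))) \<le> D * B" .
qed (auto simp: M rat_cubes_def)

lemma sum_set_nn_integral_le:
  assumes "finite J" "disjoint_family_on A J" "\<And>j. j \<in> J \<Longrightarrow> A j \<in> sets M" "g \<in> borel_measurable M"
  shows "(\<Sum>j\<in>J. \<integral>\<^sup>+t\<in>A j. g t \<partial>M) \<le> (\<integral>\<^sup>+t. g t \<partial>M)"
proof -
  have "(\<Sum>j\<in>J. \<integral>\<^sup>+t\<in>A j. g t \<partial>M) = (\<integral>\<^sup>+t\<in>(\<Union>j\<in>J. A j). g t \<partial>M)"
  proof -
    have "(\<Sum>j\<in>J. \<integral>\<^sup>+t\<in>A j. g t \<partial>M) = (\<Sum>j\<in>J. emeasure (density M g) (A j))"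
      using assms by (intro sum.cong) (auto simp: emeasure_density)
    also have "\<dots> = emeasure (density M g) (\<Union>j\<in>J. A j)"
      using assms by (intro sum_emeasure) auto
    also have "\<dots> = (\<integral>\<^sup>+t\<in>(\<Union>j\<in>J. A j). g t \<partial>M)"
      using assms by (intro emeasure_density sets.finite_UN) auto
    finally show ?thesis .
  qed
  also have "\<dots> \<le> (\<integral>\<^sup>+t. g t \<partial>M)"
    by (intro nn_integral_mono) (auto simp: indicator_def)
  finally show ?thesis .
qed

lemma weak_1_1:
  fixes g :: "real ^ 'n \<Rightarrow> ennreal"
  assumes g: "g \<in> borel_measurable lebesgue" and "0 < l"
  shows "emeasure lebesgue {x. ennreal l < HL_maximal g x} \<le> ennreal (3 ^ CARD('n)) * ((\<integral>\<^sup>+t. g t \<partial>lebesgue) / ennreal l)"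
proof (rule maximal_level_set_le)
  fix Q :: "(real ^ 'n) \<times> real" assume "0 < snd Q"
  then show "emeasure lebesgue (cube (dilate 3 Q)) \<le> ennreal (3 ^ CARD('n)) * emeasure lebesgue (cube Q)"
    by (simp add: emeasure_cube vol_dilate ennreal_mult vol_pos less_imp_le)
next
  fix J :: "((real ^ 'n) \<times> real) set"
  assume J: "finite J" "disjoint_family_on cube J" "\<And>Q. Q \<in> J \<Longrightarrow> 0 < snd Q \<and> ennreal l < avg g Q"
  have "emeasure lebesgue (cube Q) \<le> (\<integral>\<^sup>+t\<in>cube Q. g t \<partial>lebesgue) / ennreal l" if "Q \<in> J" for Q
  proof -
    have p: "0 < vol Q" using J(3)[OF that] by (simp add: vol_pos)
    have "ennreal l * ennreal (vol Q) \<le> avg g Q * ennreal (vol Q)"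
      using J(3)[OF that] by (intro mult_right_mono) auto
    also have "\<dots> = (\<integral>\<^sup>+t\<in>cube Q. g t \<partial>lebesgue)"
      unfolding avg_def using p by (subst ennreal_divide_times) (simp add: ennreal_divide_self)
    finally have "ennreal l * ennreal (vol Q) \<le> (\<integral>\<^sup>+t\<in>cube Q. g t \<partial>lebesgue)" .
    then have "ennreal l * ennreal (vol Q) / ennreal l \<le> (\<integral>\<^sup>+t\<in>cube Q. g t \<partial>lebesgue) / ennreal l"
      by (rule divide_right_mono_ennreal)
    moreover have "ennreal l * ennreal (vol Q) / ennreal l = ennreal (vol Q)"
      using \<open>0 < l\<close> p by (simp add: ennreal_mult[symmetric] divide_ennreal)
    ultimately show ?thesis using J(3)[OF that] by (simp add: emeasure_cube)
  qed
  then have "(\<Sum>Q\<in>J. emeasure lebesgue (cube Q)) \<le> (\<Sum>Q\<in>J. (\<integral>\<^sup>+t\<in>cube Q. g t \<partial>lebesgue) / ennreal l)"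
    by (rule sum_mono)
  also have "\<dots> = (\<Sum>Q\<in>J. (\<integral>\<^sup>+t\<in>cube Q. g t \<partial>lebesgue)) / ennreal l"
    by (simp add: divide_ennreal_def sum_distrib_right)
  also have "\<dots> \<le> (\<integral>\<^sup>+t. g t \<partial>lebesgue) / ennreal l"
    using J g by (intro divide_right_mono_ennreal sum_set_nn_integral_le) auto
  finally show "(\<Sum>Q\<in>J. emeasure lebesgue (cube Q)) \<le> (\<integral>\<^sup>+t. g t \<partial>lebesgue) / ennreal l" .
qed simp

lemma avg_times_vol:
  assumes "0 < snd Q"
  shows "avg g Q * ennreal (vol Q) = (\<integral>\<^sup>+t\<in>cube Q. g t \<partial>lebesgue)"
  unfolding avg_def using vol_pos[OF assms]
  by (subst ennreal_divide_times) (simp add: ennreal_divide_self)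

lemma avg_restrict:
  assumes "cube T \<subseteq> cube S"
  shows "avg (\<lambda>x. g x * indicator (cube S) x) T = avg g T"
proof -
  have "g t * indicator (cube S) t * indicator (cube T) t = g t * indicator (cube T) t" for t
    using assms by (auto simp: indicator_def)
  then show ?thesis by (simp add: avg_def)
qed

section \<open>Powers, a finite Hoelder inequality and the layer cake formula\<close>

lemma epowr_ennreal: "0 \<le> x \<Longrightarrow> epowr (ennreal x) s = ennreal (x powr s)"
  by (simp add: epowr_def)

lemma epowr_top: "epowr \<infinity> s = \<infinity>" "epowr top s = top"
  by (simp_all add: epowr_def)

lemma epowr_mono: "0 \<le> s \<Longrightarrow> a \<le> b \<Longrightarrow> epowr a s \<le> epowr b s"
  by (cases a; cases b) (auto simp: epowr_ennreal epowr_top powr_mono2 top_unique intro!: ennreal_leI)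

lemma epowr_measurable [measurable]: "(\<lambda>a. epowr a s) \<in> borel_measurable borel"
  unfolding epowr_def by measurable

lemma epowr_mult:
  assumes "0 < c" shows "epowr (ennreal c * a) s = ennreal (c powr s) * epowr a s"
proof (cases a)
  case (real r)
  then show ?thesis using assms by (simp add: ennreal_mult[symmetric] epowr_ennreal powr_mult)
next
  case top
  then show ?thesis using assms by (simp add: ennreal_mult_top epowr_top)
qed

lemma epowr_one: "epowr a 1 = a"
  by (cases a) (auto simp: epowr_ennreal epowr_top)

text \<open>
  Young's inequality, applied to each pair of terms after dividing by the two sums.
\<close>

lemma holder_sum:
  fixes a b :: "'i \<Rightarrow> real"
  assumes "finite J" "\<And>j. j \<in> J \<Longrightarrow> 0 \<le> a j" "\<And>j. j \<in> J \<Longrightarrow> 0 \<le> b j" "0 \<le> s" "s \<le> 1"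
  shows "(\<Sum>j\<in>J. a j powr (1 - s) * b j powr s) \<le> (\<Sum>j\<in>J. a j) powr (1 - s) * (\<Sum>j\<in>J. b j) powr s"
proof -
  define A where "A = (\<Sum>j\<in>J. a j)"
  define B where "B = (\<Sum>j\<in>J. b j)"
  have AB: "0 \<le> A" "0 \<le> B" using assms by (auto simp: A_def B_def sum_nonneg)
  show ?thesis
  proof (cases "A = 0 \<or> B = 0")
    case True
    then have "(\<forall>j\<in>J. a j = 0) \<or> (\<forall>j\<in>J. b j = 0)"
      using assms sum_nonneg_eq_0_iff[OF assms(1)] by (auto simp: A_def B_def)
    then show ?thesis by (auto simp flip: A_def B_def)
  next
    case False
    then have pos: "0 < A" "0 < B" using AB by auto
    have "a j powr (1 - s) * b j powr s \<le> A powr (1 - s) * B powr s * ((1 - s) * (a j / A) + s * (b j / B))" if "j \<in> J" for j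
    proof (cases "a j = 0 \<or> b j = 0")
      case True
      then show ?thesis using assms that pos by (auto intro!: mult_nonneg_nonneg add_nonneg_nonneg)
    next
      case False
      then have "0 < a j" "0 < b j" using assms(2,3)[OF that] by auto
      then have "(a j / A) powr (1 - s) * (b j / B) powr s \<le> (1 - s) * (a j / A) + s * (b j / B)"
        using pos assms by (intro Youngs_inequality_0) auto
      then have "A powr (1 - s) * B powr s * ((a j / A) powr (1 - s) * (b j / B) powr s)
          \<le> A powr (1 - s) * B powr s * ((1 - s) * (a j / A) + s * (b j / B))"
        by (intro mult_left_mono) auto
      moreover have "A powr (1 - s) * B powr s * ((a j / A) powr (1 - s) * (b j / B) powr s) = a j powr (1 - s) * b j powr s"
        using pos \<open>0 < a j\<close> \<open>0 < b j\<close> by (simp add: powr_divide)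
      ultimately show ?thesis by simp
    qed
    then have "(\<Sum>j\<in>J. a j powr (1 - s) * b j powr s) \<le> (\<Sum>j\<in>J. A powr (1 - s) * B powr s * ((1 - s) * (a j / A) + s * (b j / B)))"
      by (rule sum_mono)
    also have "\<dots> = A powr (1 - s) * B powr s * ((1 - s) * (A / A) + s * (B / B))"
      by (simp add: A_def B_def sum_distrib_left[symmetric] sum.distrib sum_divide_distrib[symmetric])
    also have "\<dots> = A powr (1 - s) * B powr s" using pos by simp
    finally show ?thesis by (simp add: A_def B_def)
  qed
qed

text \<open>
  Fubini for the region below the graph of \<open>f\<close>.
\<close>

lemma layer_cake:
  fixes f :: "'a \<Rightarrow> ennreal"
  assumes "sigma_finite_measure M" and f [measurable]: "f \<in> borel_measurable M"
  shows "(\<integral>\<^sup>+x. f x \<partial>M) = (\<integral>\<^sup>+y\<in>{0<..}. emeasure M {x \<in> space M. ennreal y < f x} \<partial>lborel)"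
    and "(\<lambda>y. emeasure M {x \<in> space M. ennreal y < f x}) \<in> borel_measurable borel"
proof -
  interpret M: sigma_finite_measure M by fact
  interpret pair_sigma_finite M "lborel :: real measure" ..
  define F :: "'a \<Rightarrow> real \<Rightarrow> ennreal" where "F x y = (if 0 < y \<and> ennreal y < f x then 1 else 0)" for x y
  have F [measurable]: "(\<lambda>(x, y). F x y) \<in> borel_measurable (M \<Otimes>\<^sub>M lborel)"
    unfolding F_def by measurable
  have 1: "(\<integral>\<^sup>+y. F x y \<partial>lborel) = f x" for x
  proof (cases "f x")
    case (real r)
    have "(\<integral>\<^sup>+y. F x y \<partial>lborel) = (\<integral>\<^sup>+y. indicator {0<..<r} y \<partial>lborel)"
      using real by (intro nn_integral_cong) (auto simp: F_def indicator_def ennreal_less_iff)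
    then show ?thesis using real by simp
  next
    case top
    have "F x = indicator {0<..}"
      using top by (auto simp: F_def indicator_def fun_eq_iff)
    then have "(\<integral>\<^sup>+y. F x y \<partial>lborel) = (\<integral>\<^sup>+y. indicator {0::real<..} y \<partial>lborel)"
      by simp
    also have "\<dots> = emeasure lborel {0::real<..}" by simp
    also have "\<dots> = \<infinity>"
    proof -
      have "ennreal (real n) \<le> emeasure lborel {0::real<..}" for n
      proof -
        have "emeasure lborel {0::real<..<real n} \<le> emeasure lborel {0::real<..}"
          by (intro emeasure_mono) auto
        then show ?thesis by simp
      qed
      then show ?thesis by (metis ennreal_Ex_less_of_nat ennreal_of_nat_eq_real_of_nat infinity_ennreal_def leD less_top)
    qed
    finally show ?thesis using top by simp
  qed
  have 2: "(\<integral>\<^sup>+x. F x y \<partial>M) = emeasure M {x \<in> space M. ennreal y < f x} * indicator {0<..} y" for y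
  proof -
    have "(\<integral>\<^sup>+x. F x y \<partial>M) = (\<integral>\<^sup>+x. indicator {x \<in> space M. ennreal y < f x} x * indicator {0<..} y \<partial>M)"
      by (intro nn_integral_cong) (auto simp: F_def indicator_def)
    then show ?thesis by (simp add: nn_integral_multc)
  qed
  show "(\<integral>\<^sup>+x. f x \<partial>M) = (\<integral>\<^sup>+y\<in>{0<..}. emeasure M {x \<in> space M. ennreal y < f x} \<partial>lborel)"
    using Fubini'[OF F] by (simp add: 1 2)
  have "(\<lambda>y. \<integral>\<^sup>+x. (if ennreal y < f x then 1 else 0) \<partial>M) \<in> borel_measurable borel"
    by (rule M.borel_measurable_nn_integral) measurable
  moreover have "(\<integral>\<^sup>+x. (if ennreal y < f x then 1 else 0) \<partial>M) = emeasure M {x \<in> space M. ennreal y < f x}" for y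
  proof -
    have "(\<integral>\<^sup>+x. (if ennreal y < f x then 1 else 0) \<partial>M) = (\<integral>\<^sup>+x. indicator {x \<in> space M. ennreal y < f x} x \<partial>M)"
      by (intro nn_integral_cong) (auto simp: indicator_def)
    then show ?thesis by simp
  qed
  ultimately show "(\<lambda>y. emeasure M {x \<in> space M. ennreal y < f x}) \<in> borel_measurable borel"
    by simp
qed

section \<open>Measures given by weights\<close>

lemma sets_wmeasure [simp, measurable_cong]: "sets (wmeasure w) = sets lebesgue"
  by (simp add: wmeasure_def)

lemma space_wmeasure [simp]: "space (wmeasure w) = UNIV"
  by (simp add: wmeasure_def)

lemma wmeasure_cube_finite:
  assumes "weight w"
  shows "emeasure (wmeasure w) (cube Q) < \<infinity>"
proof -
  have [measurable]: "w \<in> borel_measurable lebesgue" using assms by (simp add: weight_def)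
  have "set_integrable lebesgue (cube Q) w"
    using assms by (auto simp: weight_def cube_eq_cbox)
  then have "(\<integral>\<^sup>+x. ennreal (norm (indicator (cube Q) x *\<^sub>R w x)) \<partial>lebesgue) < \<infinity>"
    unfolding set_integrable_def integrable_iff_bounded by auto
  moreover have "emeasure (wmeasure w) (cube Q) \<le> (\<integral>\<^sup>+x. ennreal (norm (indicator (cube Q) x *\<^sub>R w x)) \<partial>lebesgue)"
    unfolding wmeasure_def
    by (subst emeasure_density)
      (auto intro!: nn_integral_mono simp: indicator_def ennreal_leI)
  ultimately show ?thesis by simp
qed

text \<open>
  A weight is positive almost everywhere, so that Lebesgue measure is absolutely continuous with
  respect to the weighted measure.
\<close>

lemma null_sets_wmeasure:
  assumes "weight w" "N \<in> sets lebesgue" "emeasure (wmeasure w) N = 0"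
  shows "emeasure lebesgue N = 0"
proof -
  have [measurable]: "w \<in> borel_measurable lebesgue" using assms by (simp add: weight_def)
  have "(\<integral>\<^sup>+x. ennreal (w x) * indicator N x \<partial>lebesgue) = 0"
    using assms by (simp add: wmeasure_def emeasure_density)
  then have "AE x in lebesgue. ennreal (w x) * indicator N x = 0"
    using assms by (subst (asm) nn_integral_0_iff_AE) auto
  moreover have "AE x in lebesgue. 0 < w x" using assms by (simp add: weight_def)
  ultimately have "AE x in lebesgue. x \<notin> N"
    by eventually_elim (auto simp: indicator_def ennreal_eq_0_iff split: if_splits)
  then show ?thesis using assms(2) by (simp add: AE_iff_measurable[where N = N])
qed

lemma wmeasure_cube_pos:
  assumes "weight w" "0 < snd Q"
  shows "0 < emeasure (wmeasure w) (cube Q)"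
  using null_sets_wmeasure[OF assms(1), of "cube Q"] assms(2) vol_pos[of Q]
  by (auto simp: zero_less_iff_neq_zero)

lemma UN_cubes: "(\<Union>n. cube (0 :: real ^ 'n, real n)) = UNIV"
proof -
  have "\<exists>n. x \<in> cube (0, real n)" for x :: "real ^ 'n"
  proof -
    obtain n where "norm x \<le> real n" using real_arch_simple by blast
    then have "\<bar>x $ i\<bar> \<le> real n" for i using component_le_norm_cart[of x i] by linarith
    then show ?thesis by (auto simp: cube_def)
  qed
  then show ?thesis by blast
qed

lemma sigma_finite_wmeasure:
  assumes "weight w"
  shows "sigma_finite_measure (wmeasure w)"
proof
  show "\<exists>A. countable A \<and> A \<subseteq> sets (wmeasure w) \<and> \<Union> A = space (wmeasure w) \<and> (\<forall>a\<in>A. emeasure (wmeasure w) a \<noteq> \<infinity>)"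
    using UN_cubes wmeasure_cube_finite[OF assms]
    by (intro exI[of _ "range (\<lambda>n. cube (0, real n))"]) (auto simp: less_top)
qed

lemma sigma_finite_lebesgue: "sigma_finite_measure (lebesgue :: (real ^ 'n) measure)"
proof
  have "emeasure lebesgue (cube (0 :: real ^ 'n, real n)) \<noteq> \<infinity>" for n
    using emeasure_lborel_cbox_finite by (auto simp: emeasure_completion cube_eq_cbox less_top)
  then show "\<exists>A. countable A \<and> A \<subseteq> sets lebesgue \<and> \<Union> A = space (lebesgue :: (real ^ 'n) measure) \<and> (\<forall>a\<in>A. emeasure lebesgue a \<noteq> \<infinity>)"
    using UN_cubes
    by (intro exI[of _ "range (\<lambda>n. cube (0 :: real ^ 'n, real n))"]) auto
qed

lemma distr_fun_measurable [measurable]: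
  assumes "weight w" "g \<in> borel_measurable lebesgue"
  shows "distr_fun w g \<in> borel_measurable borel"
  using layer_cake(2)[OF sigma_finite_wmeasure[OF assms(1)], of g] assms(2)
  by (simp add: distr_fun_def[abs_def] wmeasure_def)

section \<open>The restricted condition: doubling and packing\<close>

text \<open>
  The assumption \<open>restricted\<close> is \<open>|E| u(Q)^{1/q} \<le> K |Q| u(E)^{1/q}\<close>. This is the form in which the
  class \<open>A_q^R\<close> is used; \<open>AR_class_restricted_weight\<close> derives it from the definition by duality.
\<close>

locale restricted_weight =
  fixes u :: "real ^ 'n \<Rightarrow> real" and q K :: real
  assumes wt: "weight u" and q: "1 \<le> q" and K: "0 < K"
    and restricted: "\<And>Q E. 0 < snd Q \<Longrightarrow> E \<in> sets lebesgue \<Longrightarrow> E \<subseteq> cube Q \<Longrightarrow>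
      emeasure lebesgue E * epowr (emeasure (wmeasure u) (cube Q)) (1 / q)
        \<le> ennreal K * (ennreal (vol Q) * epowr (emeasure (wmeasure u) E) (1 / q))"
begin

abbreviation \<mu> :: "(real ^ 'n) measure" where "\<mu> \<equiv> wmeasure u"

definition mass :: "(real ^ 'n) \<times> real \<Rightarrow> real" where
  "mass Q = measure \<mu> (cube Q)"

lemma emeasure_mass: "emeasure \<mu> (cube Q) = ennreal (mass Q)"
  using wmeasure_cube_finite[OF wt, of Q] unfolding mass_def
  by (intro emeasure_eq_ennreal_measure) auto

lemma mass_pos: "0 < snd Q \<Longrightarrow> 0 < mass Q"
  using wmeasure_cube_pos[OF wt, of Q] by (simp add: emeasure_mass)

lemma mass_nonneg: "0 \<le> mass Q" by (simp add: mass_def)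

text \<open>
  A set that fills a fixed proportion of a cube carries a fixed proportion of its \<open>u\<close>-measure.
  Doubling is the case of a cube inside its dilate.
\<close>

lemma emeasure_cube_le:
  assumes "0 < snd Q" "E \<in> sets lebesgue" "E \<subseteq> cube Q" "0 < a" "ennreal (a * vol Q) \<le> emeasure lebesgue E"
  shows "emeasure \<mu> (cube Q) \<le> ennreal ((K / a) powr q) * emeasure \<mu> E"
proof -
  have "emeasure \<mu> E \<le> emeasure \<mu> (cube Q)" using assms by (intro emeasure_mono) auto
  then have fin: "emeasure \<mu> E < \<infinity>" using wmeasure_cube_finite[OF wt, of Q] by (rule order_le_less_trans)
  then obtain e where e: "emeasure \<mu> E = ennreal e" "0 \<le> e" by (cases "emeasure \<mu> E") auto
  have v: "0 < vol Q" using assms(1) by (rule vol_pos)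
  have "ennreal (a * vol Q) * epowr (emeasure \<mu> (cube Q)) (1 / q) \<le> emeasure lebesgue E * epowr (emeasure \<mu> (cube Q)) (1 / q)"
    using assms by (intro mult_right_mono) auto
  also have "\<dots> \<le> ennreal K * (ennreal (vol Q) * epowr (emeasure \<mu> E) (1 / q))"
    using assms by (intro restricted) auto
  finally have "a * vol Q * mass Q powr (1 / q) \<le> K * (vol Q * e powr (1 / q))"
    using assms K v e by (simp add: emeasure_mass epowr_ennreal mass_nonneg ennreal_mult[symmetric])
  then have "mass Q powr (1 / q) \<le> (K / a) * e powr (1 / q)"
    using v assms by (simp add: field_simps)
  then have "(mass Q powr (1 / q)) powr q \<le> ((K / a) * e powr (1 / q)) powr q"
    using q by (intro powr_mono2) auto
  moreover have "((K / a) * e powr (1 / q)) powr q = (K / a) powr q * e"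
    using q e by (subst powr_mult) (auto simp: powr_powr)
  moreover have "(mass Q powr (1 / q)) powr q = mass Q"
    using q by (simp add: powr_powr mass_nonneg)
  ultimately have "mass Q \<le> (K / a) powr q * e" by simp
  then show ?thesis using e by (simp add: emeasure_mass ennreal_mult[symmetric] ennreal_leI)
qed

lemma doubling:
  assumes "0 < snd Q" "1 \<le> k"
  shows "emeasure \<mu> (cube (dilate k Q)) \<le> ennreal ((K * k ^ CARD('n)) powr q) * emeasure \<mu> (cube Q)"
proof -
  have "emeasure \<mu> (cube (dilate k Q)) \<le> ennreal ((K / (1 / k ^ CARD('n))) powr q) * emeasure \<mu> (cube Q)"
    using assms cube_subset_dilate_self[OF assms(2,1)]
    by (intro emeasure_cube_le) (auto simp: vol_dilate)
  then show ?thesis by simp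
qed

text \<open>
  The restricted condition for the level sets \<open>{g > y} \<inter> Q\<close>, integrated over \<open>y\<close>.
\<close>

lemma avg_le_Lq1:
  assumes g [measurable]: "g \<in> borel_measurable lebesgue" and Q: "0 < snd Q"
  shows "avg g Q * epowr (emeasure \<mu> (cube Q)) (1 / q)
    \<le> ennreal K * (\<integral>\<^sup>+y\<in>{0<..}. epowr (emeasure \<mu> ({x. ennreal y < g x} \<inter> cube Q)) (1 / q) \<partial>lborel)"
proof -
  define P where "P = epowr (emeasure \<mu> (cube Q)) (1 / q)"
  define h where "h = (\<lambda>x. g x * indicator (cube Q) x)"
  have [measurable]: "h \<in> borel_measurable lebesgue" unfolding h_def by measurable
  have h': "h \<in> borel_measurable \<mu>" by (simp add: measurable_cong_sets[of \<mu> lebesgue])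
  have hset: "{x. ennreal y < h x} = {x. ennreal y < g x} \<inter> cube Q" if "0 < y" for y
    using that by (auto simp: h_def indicator_def)
  have [measurable]: "(\<lambda>y. emeasure lebesgue {x. ennreal y < h x}) \<in> borel_measurable borel"
    using layer_cake(2)[OF sigma_finite_lebesgue, of h] by simp
  have [measurable]: "(\<lambda>y. emeasure \<mu> {x. ennreal y < h x}) \<in> borel_measurable borel"
    using layer_cake(2)[OF sigma_finite_wmeasure[OF wt] h'] by simp
  have sets: "{x. ennreal y < h x} \<in> sets lebesgue" for y
    using measurable_sets[of h lebesgue borel "{ennreal y<..}"] by (simp add: vimage_def)
  have "avg g Q * P * ennreal (vol Q) = (\<integral>\<^sup>+x. h x \<partial>lebesgue) * P"
    using avg_times_vol[OF Q, of g] by (simp add: h_def ac_simps)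
  also have "\<dots> = (\<integral>\<^sup>+y\<in>{0<..}. emeasure lebesgue {x. ennreal y < h x} \<partial>lborel) * P"
    using layer_cake(1)[OF sigma_finite_lebesgue, of h] by simp
  also have "\<dots> = (\<integral>\<^sup>+y. emeasure lebesgue {x. ennreal y < h x} * P * indicator {0<..} y \<partial>lborel)"
    by (subst nn_integral_multc[symmetric]) (auto intro!: nn_integral_cong simp: ac_simps)
  also have "\<dots> \<le> (\<integral>\<^sup>+y. ennreal K * (ennreal (vol Q) * epowr (emeasure \<mu> {x. ennreal y < h x}) (1 / q)) * indicator {0<..} y \<partial>lborel)"
  proof (intro nn_integral_mono)
    fix y
    show "emeasure lebesgue {x. ennreal y < h x} * P * indicator {0<..} y \<le> ennreal K * (ennreal (vol Q) * epowr (emeasure \<mu> {x. ennreal y < h x}) (1 / q)) * indicator {0<..} y"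
    proof (cases "0 < y")
      case True
      then show ?thesis using restricted[OF Q sets, of y] by (simp add: P_def hset)
    qed simp
  qed
  also have "\<dots> = (\<integral>\<^sup>+y. ennreal K * ennreal (vol Q) * (epowr (emeasure \<mu> ({x. ennreal y < h x})) (1 / q) * indicator {0<..} y) \<partial>lborel)"
    by (simp add: ac_simps)
  also have "\<dots> = ennreal K * ennreal (vol Q) * (\<integral>\<^sup>+y\<in>{0<..}. epowr (emeasure \<mu> ({x. ennreal y < h x})) (1 / q) \<partial>lborel)"
    by (rule nn_integral_cmult) measurable
  also have "(\<integral>\<^sup>+y\<in>{0<..}. epowr (emeasure \<mu> ({x. ennreal y < h x})) (1 / q) \<partial>lborel)
     = (\<integral>\<^sup>+y\<in>{0<..}. epowr (emeasure \<mu> ({x. ennreal y < g x} \<inter> cube Q)) (1 / q) \<partial>lborel)" (is "_ = ?L")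
    by (intro nn_integral_cong) (auto simp: hset indicator_def)
  finally have "(avg g Q * P) * ennreal (vol Q) \<le> (ennreal K * ?L) * ennreal (vol Q)" by (simp add: ac_simps)
  then have "(avg g Q * P) * ennreal (vol Q) / ennreal (vol Q) \<le> (ennreal K * ?L) * ennreal (vol Q) / ennreal (vol Q)"
    by (rule divide_right_mono_ennreal)
  moreover have "x * ennreal (vol Q) / ennreal (vol Q) = x" for x
    using vol_pos[OF Q] by (subst ennreal_times_divide[symmetric]) (simp add: ennreal_divide_self)
  ultimately show ?thesis by (simp add: P_def)
qed

lemma restricted_integral_le_norm: "(\<integral>\<^sup>+y\<in>{0<..}. epowr (distr_fun u g y) (1 / q) \<partial>lborel) \<le> norm_Lq1 q u g"
proof -
  have "1 * (\<integral>\<^sup>+y\<in>{0<..}. epowr (distr_fun u g y) (1 / q) \<partial>lborel) \<le> norm_Lq1 q u g"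
    unfolding norm_Lq1_def using q by (intro mult_right_mono) auto
  then show ?thesis by simp
qed

text \<open>
  With \<open>a_Q = (avg g Q)^q u(Q)\<close> and \<open>T = \<Sum> a_Q\<close>, write \<open>a_Q = a_Q^{1 - 1/q} (avg g Q) u(Q)^{1/q}\<close>
  and bound the last two factors by \<open>avg_le_Lq1\<close>. Hoelder for the sum under the integral over \<open>y\<close>
  and the disjointness of the cubes give \<open>T \<le> K N T^{1 - 1/q}\<close>, hence \<open>T^{1/q} \<le> K N\<close>.
  This replaces Minkowski's inequality in \<open>L^{q,1}\<close>.
\<close>

lemma packing:
  assumes g [measurable]: "g \<in> borel_measurable lebesgue" and N: "norm_Lq1 q u g \<le> ennreal N" "0 \<le> N"
    and J: "finite J" "disjoint_family_on cube J" "\<And>Q. Q \<in> J \<Longrightarrow> 0 < snd Q"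
  shows "(\<Sum>Q\<in>J. epowr (avg g Q) q * emeasure \<mu> (cube Q)) \<le> ennreal ((K * N) powr q)"
proof -
  define L where "L = (\<integral>\<^sup>+y\<in>{0<..}. epowr (distr_fun u g y) (1 / q) \<partial>lborel)"
  define s where "s = 1 / q"
  have s: "0 < s" "s \<le> 1" using q by (auto simp: s_def)
  have LN: "L \<le> ennreal N" using restricted_integral_le_norm[of g] N(1) unfolding L_def by (rule order_trans)
  define b where "b Q y = measure \<mu> ({x. ennreal y < g x} \<inter> cube Q)" for Q y
  have lev [measurable]: "{x. ennreal y < g x} \<in> sets lebesgue" for y
    using measurable_sets[of g lebesgue borel "{ennreal y<..}"] by (simp add: vimage_def)
  have b: "emeasure \<mu> ({x. ennreal y < g x} \<inter> cube Q) = ennreal (b Q y)" for Q y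
  proof -
    have "emeasure \<mu> ({x. ennreal y < g x} \<inter> cube Q) \<le> emeasure \<mu> (cube Q)"
      by (intro emeasure_mono) auto
    then show ?thesis unfolding b_def using wmeasure_cube_finite[OF wt, of Q]
      by (intro emeasure_eq_ennreal_measure) (auto simp: less_top)
  qed
  have b0: "0 \<le> b Q y" for Q y by (simp add: b_def)
  have bmeas [measurable]: "(\<lambda>y. b Q y) \<in> borel_measurable borel" for Q
  proof -
    have [measurable]: "(\<lambda>x. g x * indicator (cube Q) x) \<in> borel_measurable lebesgue" by measurable
    then have "(\<lambda>x. g x * indicator (cube Q) x) \<in> borel_measurable \<mu>"
      by (simp add: measurable_cong_sets[of \<mu> lebesgue])
    from layer_cake(2)[OF sigma_finite_wmeasure[OF wt] this]
    have 1: "(\<lambda>y. emeasure \<mu> {x. ennreal y < g x * indicator (cube Q) x}) \<in> borel_measurable borel" by simp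
    define B where "B y = (if 0 \<le> y then enn2real (emeasure \<mu> {x. ennreal y < g x * indicator (cube Q) x}) else b Q 0)" for y
    have "B \<in> borel_measurable borel" unfolding B_def using 1 by measurable
    moreover have "B = b Q"
    proof
      fix y
      show "B y = b Q y"
      proof (cases "0 \<le> y")
        case True
        have "{x. ennreal y < g x * indicator (cube Q) x} = {x. ennreal y < g x} \<inter> cube Q"
          by (auto simp: indicator_def split: if_splits)
        then show ?thesis using True by (simp add: B_def b_def measure_def)
      next
        case False
        then show ?thesis by (simp add: B_def b_def ennreal_neg)
      qed
    qed
    ultimately show ?thesis by simp
  qed
  have bsum: "ennreal (\<Sum>Q\<in>J. b Q y) \<le> distr_fun u g y" for y
  proof -
    have disj: "disjoint_family_on (\<lambda>Q. {x. ennreal y < g x} \<inter> cube Q) J"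
      using J(2) unfolding disjoint_family_on_def by blast
    have "ennreal (\<Sum>Q\<in>J. b Q y) = (\<Sum>Q\<in>J. emeasure \<mu> ({x. ennreal y < g x} \<inter> cube Q))"
      using b0 by (simp add: b sum_ennreal)
    also have "\<dots> = emeasure \<mu> (\<Union>Q\<in>J. {x. ennreal y < g x} \<inter> cube Q)"
      using J disj by (intro sum_emeasure) auto
    also have "\<dots> \<le> distr_fun u g y"
      unfolding distr_fun_def by (intro emeasure_mono) auto
    finally show ?thesis .
  qed
  have base: "avg g Q * epowr (emeasure \<mu> (cube Q)) (1 / q) \<le> ennreal K * (\<integral>\<^sup>+y. ennreal (b Q y powr s * indicator {0<..} y) \<partial>lborel)"
    if "Q \<in> J" for Q
  proof -
    have "(\<integral>\<^sup>+y\<in>{0<..}. epowr (emeasure \<mu> ({x. ennreal y < g x} \<inter> cube Q)) (1 / q) \<partial>lborel) = (\<integral>\<^sup>+y. ennreal (b Q y powr s * indicator {0<..} y) \<partial>lborel)"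
      by (intro nn_integral_cong) (auto simp: b epowr_ennreal b0 s_def indicator_def)
    then show ?thesis using avg_le_Lq1[OF g J(3)[OF that]] by simp
  qed
  have fin: "avg g Q < \<infinity>" if "Q \<in> J" for Q
  proof -
    have "(\<integral>\<^sup>+y. ennreal (b Q y powr s * indicator {0<..} y) \<partial>lborel) \<le> L"
      unfolding L_def
    proof (intro nn_integral_mono)
      fix y
      have "emeasure \<mu> ({x. ennreal y < g x} \<inter> cube Q) \<le> distr_fun u g y"
        unfolding distr_fun_def by (intro emeasure_mono) auto
      then have "epowr (ennreal (b Q y)) s \<le> epowr (distr_fun u g y) s"
        using s unfolding b by (intro epowr_mono) auto
      then show "ennreal (b Q y powr s * indicator {0<..} y) \<le> epowr (distr_fun u g y) (1 / q) * indicator {0<..} y"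
        by (auto simp: indicator_def epowr_ennreal b0 s_def)
    qed
    then have "avg g Q * epowr (emeasure \<mu> (cube Q)) (1 / q) \<le> ennreal K * ennreal N"
      using base[OF that] LN by (meson mult_left_mono order_trans zero_le)
    then have "avg g Q * ennreal (mass Q powr (1 / q)) < \<infinity>"
      by (simp add: emeasure_mass epowr_ennreal mass_nonneg ennreal_mult[symmetric] K N less_imp_le order_le_less_trans)
    then show ?thesis using mass_pos[OF J(3)[OF that]]
      by (auto simp: ennreal_mult_less_top ennreal_eq_0_iff powr_gt_zero less_top not_le)
  qed
  define A where "A Q = enn2real (avg g Q)" for Q
  have A: "avg g Q = ennreal (A Q)" if "Q \<in> J" for Q using fin[OF that] by (simp add: A_def less_top)
  have A0: "0 \<le> A Q" for Q by (simp add: A_def)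
  define a where "a Q = A Q powr q * mass Q" for Q
  have a0: "0 \<le> a Q" for Q by (simp add: a_def mass_nonneg)
  define T where "T = (\<Sum>Q\<in>J. a Q)"
  have T0: "0 \<le> T" by (simp add: T_def a0 sum_nonneg)
  have sumT: "(\<Sum>Q\<in>J. epowr (avg g Q) q * emeasure \<mu> (cube Q)) = ennreal T"
    using a0 unfolding T_def
    by (subst sum_ennreal[symmetric]) (auto intro!: sum.cong simp: A epowr_ennreal A0 emeasure_mass a_def ennreal_mult mass_nonneg)
  have asplit: "a Q = a Q powr (1 - s) * (A Q * mass Q powr s)" for Q
  proof (cases "a Q = 0")
    case False
    then have "0 < a Q" using a0[of Q] by simp
    then have "A Q \<noteq> 0" by (auto simp: a_def)
    then have "A Q * mass Q powr s = a Q powr s"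
      using A0[of Q] q mass_nonneg[of Q] by (simp add: a_def powr_mult powr_powr s_def)
    then show ?thesis using \<open>0 < a Q\<close> by (simp add: powr_add[symmetric])
  qed simp
  have "ennreal T = (\<Sum>Q\<in>J. ennreal (a Q powr (1 - s)) * (avg g Q * epowr (emeasure \<mu> (cube Q)) (1 / q)))"
    unfolding T_def
    by (subst sum_ennreal[symmetric])
      (auto intro!: sum.cong simp: a0 A A0 emeasure_mass epowr_ennreal mass_nonneg ennreal_mult[symmetric] simp flip: s_def asplit)
  also have "\<dots> \<le> (\<Sum>Q\<in>J. ennreal (a Q powr (1 - s)) * (ennreal K * (\<integral>\<^sup>+y. ennreal (b Q y powr s * indicator {0<..} y) \<partial>lborel)))"
    by (intro sum_mono mult_left_mono base) auto
  also have "\<dots> = ennreal K * (\<Sum>Q\<in>J. (\<integral>\<^sup>+y. ennreal (a Q powr (1 - s)) * ennreal (b Q y powr s * indicator {0<..} y) \<partial>lborel))"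
    by (subst nn_integral_cmult) (auto simp: sum_distrib_left ac_simps)
  also have "\<dots> = ennreal K * (\<integral>\<^sup>+y. (\<Sum>Q\<in>J. ennreal (a Q powr (1 - s)) * ennreal (b Q y powr s * indicator {0<..} y)) \<partial>lborel)"
    by (subst nn_integral_sum) auto
  also have "\<dots> \<le> ennreal K * (\<integral>\<^sup>+y. ennreal (T powr (1 - s)) * (epowr (distr_fun u g y) (1 / q) * indicator {0<..} y) \<partial>lborel)"
  proof (intro mult_left_mono nn_integral_mono)
    fix y
    have "(\<Sum>Q\<in>J. ennreal (a Q powr (1 - s)) * ennreal (b Q y powr s)) = ennreal (\<Sum>Q\<in>J. a Q powr (1 - s) * b Q y powr s)"
      by (subst sum_ennreal[symmetric]) (auto simp: ennreal_mult)
    also have "\<dots> \<le> ennreal (T powr (1 - s) * (\<Sum>Q\<in>J. b Q y) powr s)"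
      unfolding T_def using s by (intro ennreal_leI holder_sum) (auto simp: a0 b0 J)
    also have "\<dots> = ennreal (T powr (1 - s)) * epowr (ennreal (\<Sum>Q\<in>J. b Q y)) s"
      by (simp add: ennreal_mult epowr_ennreal sum_nonneg b0)
    also have "\<dots> \<le> ennreal (T powr (1 - s)) * epowr (distr_fun u g y) s"
      using s by (intro mult_left_mono epowr_mono bsum) auto
    finally show "(\<Sum>Q\<in>J. ennreal (a Q powr (1 - s)) * ennreal (b Q y powr s * indicator {0<..} y))
       \<le> ennreal (T powr (1 - s)) * (epowr (distr_fun u g y) (1 / q) * indicator {0<..} y)"
      by (auto simp: indicator_def s_def)
  qed auto
  also have "\<dots> = ennreal K * (ennreal (T powr (1 - s)) * L)"
    unfolding L_def using distr_fun_measurable[OF wt g]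
    by (subst nn_integral_cmult) auto
  also have "\<dots> \<le> ennreal K * (ennreal (T powr (1 - s)) * ennreal N)"
    by (intro mult_left_mono LN) auto
  also have "\<dots> = ennreal (K * N * T powr (1 - s))"
    using K N by (simp add: ennreal_mult ac_simps)
  finally have *: "T \<le> K * N * T powr (1 - s)"
    using K N by (simp add: ennreal_le_iff)
  have "T \<le> (K * N) powr q"
  proof (cases "T = 0")
    case False
    then have T: "0 < T" using T0 by simp
    have "T = T powr s * T powr (1 - s)" using T by (simp add: powr_add[symmetric])
    with * have "T powr s * T powr (1 - s) \<le> K * N * T powr (1 - s)" by simp
    then have "T powr s \<le> K * N" using T by simp
    then have "(T powr s) powr q \<le> (K * N) powr q" using q by (intro powr_mono2) auto
    then show ?thesis using T q by (simp add: powr_powr s_def)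
  qed simp
  then show ?thesis unfolding sumT by (rule ennreal_leI)
qed

end

section \<open>Infima of the maximal function over cubes\<close>

definition inf_maximal :: "(real ^ 'n \<Rightarrow> ennreal) \<Rightarrow> (real ^ 'n) \<times> real \<Rightarrow> ennreal" where
  "inf_maximal g Q = (INF x\<in>cube Q. HL_maximal g x)"

lemma inf_maximal_le: "x \<in> cube Q \<Longrightarrow> inf_maximal g Q \<le> HL_maximal g x"
  unfolding inf_maximal_def by (rule INF_lower)

lemma inf_maximal_antimono: "cube Q \<subseteq> cube R \<Longrightarrow> inf_maximal g R \<le> inf_maximal g Q"
  unfolding inf_maximal_def by (rule INF_superset_mono) auto

lemma avg_le_inf_maximal: "0 < snd T \<Longrightarrow> cube Q \<subseteq> cube T \<Longrightarrow> avg g T \<le> inf_maximal g Q"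
  unfolding inf_maximal_def by (intro INF_greatest avg_le_HL) auto

text \<open>
  If a cube around \<open>y\<close> is larger than \<open>Q\<close>, its fivefold dilate reaches every point \<open>z\<close> of \<open>3 Q\<close>, so
  that its average is controlled by the maximal function at \<open>z\<close>. Values of the maximal function
  on \<open>Q\<close> far above that level therefore come from small cubes, which see only \<open>3 Q\<close>.
\<close>

lemma HL_locally_determined:
  fixes Q :: "(real ^ 'n) \<times> real"
  assumes Q: "0 < snd Q" and y: "y \<in> cube Q" and z: "z \<in> cube (dilate 3 Q)"
    and less: "ennreal (5 ^ CARD('n)) * HL_maximal g z \<le> a" "a < HL_maximal g y"
  shows "a < HL_maximal (\<lambda>x. g x * indicator (cube (dilate 3 Q)) x) y"
proof -
  obtain R where R: "0 < snd R" "y \<in> cube R" "a < avg g R" using less(2) by (auto simp: less_HL_iff)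
  have meets: "cube R \<inter> cube Q \<noteq> {}" "cube Q \<inter> cube R \<noteq> {}" using R y by auto
  show ?thesis
  proof (cases "snd R \<le> snd Q")
    case True
    then have "cube R \<subseteq> cube (dilate 3 Q)" using meets by (intro cube_subset_dilate)
    then have "avg (\<lambda>x. g x * indicator (cube (dilate 3 Q)) x) R = avg g R" by (rule avg_restrict)
    with R show ?thesis unfolding less_HL_iff by (intro exI[of _ R]) simp
  next
    case False
    have "\<bar>z $ i - fst R $ i\<bar> \<le> 5 * snd R" for i
    proof -
      have "\<bar>z $ i - fst Q $ i\<bar> \<le> 3 * snd Q" "\<bar>y $ i - fst Q $ i\<bar> \<le> snd Q" "\<bar>y $ i - fst R $ i\<bar> \<le> snd R"
        using z y R(2) by (auto simp: cube_def)
      then show ?thesis using False by linarith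
    qed
    then have "z \<in> cube (dilate 5 R)" by (simp add: cube_def)
    have "avg g R \<le> ennreal (5 ^ CARD('n)) * avg g (dilate 5 R)"
      using R(1) by (intro avg_mono cube_subset_dilate_self) auto
    also have "\<dots> \<le> ennreal (5 ^ CARD('n)) * HL_maximal g z"
      using R(1) \<open>z \<in> cube (dilate 5 R)\<close> by (intro mult_left_mono avg_le_HL) auto
    finally show ?thesis using R(3) less(1) by (auto dest: order_less_le_trans)
  qed
qed

lemma set_integral_cube_le:
  assumes "0 < snd Q" "avg g Q \<le> ennreal l" "0 \<le> l"
  shows "(\<integral>\<^sup>+x. g x * indicator (cube Q) x \<partial>lebesgue) \<le> ennreal (l * vol Q)"
  unfolding avg_times_vol[OF assms(1), symmetric] using assms vol_pos[OF assms(1)]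
  by (auto simp: ennreal_mult intro: mult_right_mono)

lemma pow_le_two_pow_9: "3 ^ k \<le> (2 * 9 ^ k :: real)" "5 ^ k \<le> (2 * 9 ^ k :: real)"
  by (rule order_trans[OF power_mono[of _ 9 k]]; simp)+

lemma one_le_two_pow_9: "1 \<le> (2 * 9 ^ k :: real)"
  using one_le_power[of "9::real" k] by linarith

text \<open>
  The weak (1,1) inequality for the restriction of \<open>g\<close> to \<open>3 Q\<close>: its constant \<open>3^n\<close> and the volume
  ratio \<open>3^n\<close> make up the factor \<open>9^n\<close>, and the factor 2 leaves half of the cube free. This fixes
  the number \<open>2 * 9^n\<close> by which levels are raised from here on.
\<close>

lemma local_level_set_small:
  fixes Q :: "(real ^ 'n) \<times> real"
  assumes g [measurable]: "g \<in> borel_measurable lebesgue" and Q: "0 < snd Q" and l: "0 < l"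
    and a: "avg g (dilate 3 Q) \<le> ennreal l"
  shows "emeasure lebesgue {x. ennreal (2 * 9 ^ CARD('n) * l) < HL_maximal (\<lambda>x. g x * indicator (cube (dilate 3 Q)) x) x}
    \<le> ennreal (vol Q / 2)"
proof -
  let ?n = "CARD('n)"
  have "emeasure lebesgue {x. ennreal (2 * 9 ^ ?n * l) < HL_maximal (\<lambda>x. g x * indicator (cube (dilate 3 Q)) x) x}
     \<le> ennreal (3 ^ ?n) * ((\<integral>\<^sup>+x. g x * indicator (cube (dilate 3 Q)) x \<partial>lebesgue) / ennreal (2 * 9 ^ ?n * l))"
    using l by (intro weak_1_1) auto
  also have "\<dots> \<le> ennreal (3 ^ ?n) * (ennreal (l * vol (dilate 3 Q)) / ennreal (2 * 9 ^ ?n * l))"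
    using Q l a by (intro mult_left_mono divide_right_mono_ennreal set_integral_cube_le) auto
  also have "\<dots> = ennreal (3 ^ ?n * (l * (3 ^ ?n * vol Q) / (2 * 9 ^ ?n * l)))"
    using l vol_pos[OF Q] by (simp add: divide_ennreal ennreal_mult[symmetric] vol_dilate)
  also have "3 ^ ?n * (l * (3 ^ ?n * vol Q) / (2 * 9 ^ ?n * l)) = vol Q / 2"
  proof -
    have "(9::real) ^ ?n = 3 ^ ?n * 3 ^ ?n" by (simp flip: power_mult_distrib)
    then show ?thesis using l by (simp add: field_simps)
  qed
  finally show ?thesis .
qed

text \<open>
  Given \<open>z\<close> in \<open>3 Q\<close>, some point \<open>y\<close> of \<open>Q\<close> lies outside the small set of
  \<open>local_level_set_small\<close> at level \<open>l = M g(z)\<close>. By \<open>HL_locally_determined\<close> the maximal function at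
  \<open>y\<close> is then at most \<open>2 * 9^n\<close> times its value at \<open>z\<close>.
\<close>

lemma inf_maximal_dilate:
  fixes Q :: "(real ^ 'n) \<times> real"
  assumes g [measurable]: "g \<in> borel_measurable lebesgue" and Q: "0 < snd Q" and pos: "0 < inf_maximal g (dilate 3 Q)"
  shows "inf_maximal g Q \<le> ennreal (2 * 9 ^ CARD('n)) * inf_maximal g (dilate 3 Q)"
proof -
  let ?n = "CARD('n)"
  have "inf_maximal g Q \<le> ennreal (2 * 9 ^ ?n) * HL_maximal g z" if z: "z \<in> cube (dilate 3 Q)" for z
  proof (cases "HL_maximal g z")
    case top
    then show ?thesis by (simp add: ennreal_mult_top)
  next
    case (real l)
    have l: "0 < l" using real inf_maximal_le[OF z, of g] pos by (auto simp: ennreal_eq_0_iff intro: ccontr)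
    let ?h = "\<lambda>x. g x * indicator (cube (dilate 3 Q)) x"
    define E where "E = {x. ennreal (2 * 9 ^ ?n * l) < HL_maximal ?h x}"
    have "avg g (dilate 3 Q) \<le> ennreal l"
      using avg_le_HL[OF _ z, of g] Q real by simp
    then have "emeasure lebesgue E \<le> ennreal (vol Q / 2)"
      unfolding E_def using Q l by (intro local_level_set_small) auto
    also have "\<dots> < emeasure lebesgue (cube Q)"
      using Q vol_pos[OF Q] by (simp add: ennreal_less_iff)
    finally have "\<not> cube Q \<subseteq> E"
      using emeasure_mono[of "cube Q" E lebesgue] level_set_sets[OF HL_maximal_measurable]
      unfolding E_def not_le[symmetric] by blast
    then obtain y where "y \<in> cube Q" "y \<notin> E" by blast
    then have y: "y \<in> cube Q" "HL_maximal ?h y \<le> ennreal (2 * 9 ^ ?n * l)"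
      by (auto simp: E_def not_less)
    have "HL_maximal g y \<le> ennreal (2 * 9 ^ ?n * l)"
    proof (rule ccontr)
      assume "\<not> ?thesis"
      moreover have "ennreal (5 ^ ?n) * HL_maximal g z \<le> ennreal (2 * 9 ^ ?n * l)"
        using pow_le_two_pow_9(2)[of ?n] l by (auto simp: real ennreal_mult[symmetric] intro!: ennreal_leI mult_right_mono)
      ultimately have "ennreal (2 * 9 ^ ?n * l) < HL_maximal ?h y"
        using HL_locally_determined[OF Q y(1) z] by (simp add: not_le)
      with y(2) show False by simp
    qed
    then show ?thesis using inf_maximal_le[OF y(1), of g] l by (simp add: real ennreal_mult)
  qed
  then have "inf_maximal g Q / ennreal (2 * 9 ^ ?n) \<le> HL_maximal g z" if "z \<in> cube (dilate 3 Q)" for z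
    using that by (intro divide_le_posI_ennreal) (auto simp: ac_simps)
  then have "inf_maximal g Q / ennreal (2 * 9 ^ ?n) \<le> inf_maximal g (dilate 3 Q)"
    by (subst (2) inf_maximal_def) (rule INF_greatest)
  then have "ennreal (2 * 9 ^ ?n) * (inf_maximal g Q / ennreal (2 * 9 ^ ?n)) \<le> ennreal (2 * 9 ^ ?n) * inf_maximal g (dilate 3 Q)"
    by (rule mult_left_mono) simp
  moreover have "ennreal (2 * 9 ^ ?n) * (inf_maximal g Q / ennreal (2 * 9 ^ ?n)) = inf_maximal g Q"
    by (subst mult.commute, subst ennreal_divide_times) (simp add: ennreal_divide_self)
  ultimately show ?thesis by simp
qed

section \<open>Exponential decay of level sets\<close>

context restricted_weight
begin

text \<open>
  Let \<open>\<Omega>\<close> and \<open>\<Omega>'\<close> be the two level sets. Cubes \<open>R\<close> that are nearly maximal among those with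
  average above \<open>l\<close> cover \<open>\<Omega>\<close> and lie in \<open>\<Omega>\<close>, and \<open>\<Omega>'\<close> fills at most half of each, so that
  \<open>u(R) \<le> C u(R - \<Omega>')\<close>. A Vitali selection yields \<open>u(\<Omega>) \<le> C u(\<Omega> - \<Omega>')\<close>, and therefore
  \<open>u(\<Omega>') \<le> (1 - 1/C) u(\<Omega>)\<close>. Since the cubes lie in \<open>\<Omega>\<close>, the overlap constant of the covering
  only worsens \<open>C\<close>; the ratio stays below 1.
\<close>

lemma level_set_decay:
  "\<exists>\<theta>. 0 \<le> \<theta> \<and> \<theta> < 1 \<and> (\<forall>h l. h \<in> borel_measurable lebesgue \<longrightarrow> (\<integral>\<^sup>+x. h x \<partial>lebesgue) < \<infinity> \<longrightarrow> 0 < l \<longrightarrow>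
     emeasure \<mu> {x. ennreal l < HL_maximal h x} < \<infinity> \<longrightarrow>
     emeasure \<mu> {x. ennreal (2 * 9 ^ CARD('n) * l) < HL_maximal h x}
       \<le> ennreal \<theta> * emeasure \<mu> {x. ennreal l < HL_maximal h x})"
proof -
  let ?n = "CARD('n)"
  define C where "C = max 1 ((K * 3 ^ ?n) powr q * (K / (1 / 2)) powr q)"
  have C: "1 \<le> C" by (simp add: C_def)
  have "emeasure \<mu> {x. ennreal (2 * 9 ^ CARD('n) * l) < HL_maximal h x}
       \<le> ennreal (1 - 1 / C) * emeasure \<mu> {x. ennreal l < HL_maximal h x}"
    if h [measurable]: "h \<in> borel_measurable lebesgue" and fin: "(\<integral>\<^sup>+x. h x \<partial>lebesgue) < \<infinity>" and l: "0 < l"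
      and \<mu>fin: "emeasure \<mu> {x. ennreal l < HL_maximal h x} < \<infinity>" for h l
  proof -
    define \<Omega> where "\<Omega> = {x. ennreal l < HL_maximal h x}"
    define \<Omega>' where "\<Omega>' = {x. ennreal (2 * 9 ^ ?n * l) < HL_maximal h x}"
    have ms [measurable]: "\<Omega> \<in> sets lebesgue" "\<Omega>' \<in> sets lebesgue"
      unfolding \<Omega>_def \<Omega>'_def
      using measurable_sets[OF HL_maximal_measurable[of h], of "{ennreal l<..}"]
        measurable_sets[OF HL_maximal_measurable[of h], of "{ennreal (2 * 9 ^ ?n * l)<..}"] by (auto simp: vimage_def)
    have "l \<le> 2 * 9 ^ ?n * l" using l mult_right_mono[OF one_le_two_pow_9[of ?n], of l] by simp
    then have sub: "\<Omega>' \<subseteq> \<Omega>" unfolding \<Omega>_def \<Omega>'_def by (auto dest: order_le_less_trans[OF ennreal_leI])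
    \<comment> \<open>Near maximality: no cube of at least twice the size that contains \<open>R\<close> has average above \<open>l\<close>.\<close>
    define F where "F = {R \<in> rat_cubes. ennreal l < avg h R \<and>
      (\<forall>T. cube R \<subseteq> cube T \<longrightarrow> 2 * snd R \<le> snd T \<longrightarrow> avg h T \<le> ennreal l)}"
    have Fpos: "0 < snd R" if "R \<in> F" for R using that by (auto simp: F_def rat_cubes_def)
    have F\<Omega>: "cube R \<subseteq> \<Omega>" if "R \<in> F" for R
    proof
      fix x assume "x \<in> cube R"
      then have "avg h R \<le> HL_maximal h x" by (rule avg_le_HL[OF Fpos[OF that]])
      then show "x \<in> \<Omega>" using that by (auto simp: F_def \<Omega>_def intro: order_less_le_trans)
    qed
    have cover: "\<Omega> \<subseteq> (\<Union>R\<in>F. cube R)"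
    proof
      fix x assume "x \<in> \<Omega>"
      \<comment> \<open>The half side lengths of cubes around \<open>x\<close> with average above \<open>l\<close> are bounded because \<open>h\<close> is
        integrable; a cube of more than half their supremum is nearly maximal.\<close>
      define X where "X = {snd T |T. 0 < snd T \<and> x \<in> cube T \<and> ennreal l < avg h T}"
      have ne: "X \<noteq> {}" using \<open>x \<in> \<Omega>\<close> by (auto simp: X_def \<Omega>_def less_HL_iff)
      obtain I where I: "(\<integral>\<^sup>+x. h x \<partial>lebesgue) = ennreal I" "0 \<le> I" using fin by (cases "\<integral>\<^sup>+x. h x \<partial>lebesgue") auto
      have "r \<le> max 1 (I / l)" if "r \<in> X" for r
      proof -
        obtain T where T: "r = snd T" "0 < snd T" "x \<in> cube T" "ennreal l < avg h T" using \<open>r \<in> X\<close> by (auto simp: X_def)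
        have "ennreal l * ennreal (vol T) \<le> avg h T * ennreal (vol T)" using T by (intro mult_right_mono) auto
        also have "\<dots> = (\<integral>\<^sup>+t\<in>cube T. h t \<partial>lebesgue)" by (rule avg_times_vol[OF T(2)])
        also have "\<dots> \<le> ennreal I" unfolding I(1)[symmetric] by (intro nn_integral_mono) (auto simp: indicator_def)
        finally have "l * vol T \<le> I" using l I vol_pos[OF T(2)] by (simp add: ennreal_mult[symmetric])
        then have v: "vol T \<le> I / l" using l by (simp add: field_simps)
        show ?thesis
        proof (cases "r \<le> 1")
          case False
          have "r \<le> 2 * r" using T by simp
          also have "\<dots> \<le> (2 * r) ^ ?n" using False by (intro self_le_power) auto
          also have "\<dots> = vol T" by (simp add: vol_def T)
          finally show ?thesis using v by simp
        qed simp
      qed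
      then have bdd: "bdd_above X" by (auto simp: bdd_above_def)
      obtain r0 where "r0 \<in> X" using ne by blast
      then have "r0 \<le> Sup X" "0 < r0" using cSup_upper[OF _ bdd] by (auto simp: X_def)
      then have Spos: "0 < Sup X" by simp
      then obtain r where "r \<in> X" "Sup X / 2 < r" using less_cSup_iff[OF ne bdd, of "Sup X / 2"] by auto
      then obtain T0 where T0: "Sup X / 2 < snd T0" "0 < snd T0" "x \<in> cube T0" "ennreal l < avg h T0" by (auto simp: X_def)
      obtain R where R: "R \<in> rat_cubes" "cube T0 \<subseteq> cube R" "snd T0 < snd R" "ennreal l < avg h R"
        using rat_cube_approx[OF T0(2,4)] by metis
      have xR: "x \<in> cube R" using T0 R by auto
      have "avg h T \<le> ennreal l" if T: "cube R \<subseteq> cube T" "2 * snd R \<le> snd T" for T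
      proof (rule ccontr)
        assume "\<not> ?thesis"
        then have "ennreal l < avg h T" by simp
        moreover have "0 < snd T" "x \<in> cube T" using T xR R(3) T0(2) by auto
        ultimately have "snd T \<in> X" unfolding X_def by blast
        then have "snd T \<le> Sup X" using bdd by (rule cSup_upper)
        then show False using T0 R T by linarith
      qed
      then have "R \<in> F" using R by (auto simp: F_def)
      with xR show "x \<in> (\<Union>R\<in>F. cube R)" by auto
    qed
    have small: "emeasure \<mu> (cube R) \<le> ennreal ((K / (1 / 2)) powr q) * emeasure \<mu> (cube R - \<Omega>')" if R: "R \<in> F" for R
    proof (rule emeasure_cube_le)
      have max: "avg h T \<le> ennreal l" if "cube R \<subseteq> cube T" "2 * snd R \<le> snd T" for T
        using R that unfolding F_def by blast
      have R0: "0 < snd R" by (rule Fpos[OF R])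
      have a3: "avg h (dilate 3 R) \<le> ennreal l" using R0 by (intro max cube_subset_dilate_self) auto
      define E where "E = {x. ennreal (2 * 9 ^ CARD('n) * l) < HL_maximal (\<lambda>x. h x * indicator (cube (dilate 3 R)) x) x}"
      have Em [measurable]: "E \<in> sets lebesgue"
        unfolding E_def using measurable_sets[OF HL_maximal_measurable[of "(\<lambda>x. h x * indicator (cube (dilate 3 R)) x)"], of "{ennreal (2 * 9 ^ CARD('n) * l)<..}"]
        by (auto simp: vimage_def)
      have E: "emeasure lebesgue E \<le> ennreal (vol R / 2)"
        unfolding E_def using R0 l a3 by (intro local_level_set_small) auto
      \<comment> \<open>A cube larger than \<open>R\<close> cannot have average above \<open>2 * 9^n * l\<close>, since its dilate contradicts the
        near maximality of \<open>R\<close>; the smaller ones see only the restriction of \<open>h\<close> to \<open>3 R\<close>.\<close>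
      have "cube R \<inter> \<Omega>' \<subseteq> E"
      proof
        fix z assume z: "z \<in> cube R \<inter> \<Omega>'"
        then obtain T where T: "0 < snd T" "z \<in> cube T" "ennreal (2 * 9 ^ ?n * l) < avg h T"
          by (auto simp: \<Omega>'_def less_HL_iff)
        have meets: "cube T \<inter> cube R \<noteq> {}" "cube R \<inter> cube T \<noteq> {}" using z T by auto
        have "snd T \<le> snd R"
        proof (rule ccontr)
          assume c: "\<not> ?thesis"
          have "avg h (dilate 3 T) \<le> ennreal l"
            using c meets T by (intro max cube_subset_dilate) auto
          then have "ennreal (3 ^ ?n) * avg h (dilate 3 T) \<le> ennreal (3 ^ ?n) * ennreal l"
            by (rule mult_left_mono) simp
          moreover have "avg h T \<le> ennreal (3 ^ ?n) * avg h (dilate 3 T)"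
            using T by (intro avg_mono cube_subset_dilate_self) auto
          moreover have "ennreal (3 ^ ?n) * ennreal l \<le> ennreal (2 * 9 ^ ?n * l)"
            using l pow_le_two_pow_9(1)[of ?n] by (auto simp: ennreal_mult[symmetric] intro!: ennreal_leI)
          ultimately show False using T(3) by (meson leD order_trans)
        qed
        then have "cube T \<subseteq> cube (dilate 3 R)" using meets by (intro cube_subset_dilate)
        then have "avg (\<lambda>x. h x * indicator (cube (dilate 3 R)) x) T = avg h T" by (rule avg_restrict)
        then show "z \<in> E"
          unfolding E_def using less_HLI[OF T(1,2), of "ennreal (2 * 9 ^ ?n * l)" "\<lambda>x. h x * indicator (cube (dilate 3 R)) x"] T(3) by simp
      qed
      then have "emeasure lebesgue (cube R \<inter> \<Omega>') \<le> ennreal (vol R / 2)"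
        using E emeasure_mono[of "cube R \<inter> \<Omega>'" E lebesgue] by (auto intro: order_trans)
      moreover have "emeasure lebesgue (cube R) = emeasure lebesgue (cube R - \<Omega>') + emeasure lebesgue (cube R \<inter> \<Omega>')"
        by (subst plus_emeasure) (auto intro!: arg_cong[where f = "emeasure lebesgue"])
      ultimately have "ennreal (vol R) \<le> emeasure lebesgue (cube R - \<Omega>') + ennreal (vol R / 2)"
        using R0 by (auto intro: add_left_mono)
      then have "ennreal (vol R) - ennreal (vol R / 2) \<le> emeasure lebesgue (cube R - \<Omega>')"
        by (simp add: ennreal_minus_le_iff add.commute)
      then show "ennreal (1 / 2 * vol R) \<le> emeasure lebesgue (cube R - \<Omega>')"
        using vol_pos[OF R0] by (simp add: ennreal_minus)
    qed (auto simp: Fpos R)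
    have "emeasure \<mu> (\<Union>R\<in>F. cube R) \<le> ennreal C * emeasure \<mu> (\<Omega> - \<Omega>')"
    proof (rule vitali_measure[where T = "\<lambda>Q. cube (dilate 3 Q)"])
      show "countable F" unfolding F_def by (auto intro: countable_subset[OF _ countable_rat_cubes])
      show "cube Q \<subseteq> cube (dilate 3 R)"
        if "cube Q \<inter> cube R \<noteq> {}" "snd Q \<le> snd R" for Q R :: "(real ^ 'n) \<times> real"
        using that by (rule cube_subset_dilate)
      fix J assume J: "finite J" "J \<subseteq> F" "disjoint_family_on cube J"
      have "(\<Sum>R\<in>J. emeasure \<mu> (cube (dilate 3 R))) \<le> (\<Sum>R\<in>J. ennreal C * emeasure \<mu> (cube R - \<Omega>'))"
      proof (rule sum_mono)
        fix R assume "R \<in> J"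
        then have R: "R \<in> F" using J by auto
        have "emeasure \<mu> (cube (dilate 3 R)) \<le> ennreal ((K * 3 ^ ?n) powr q) * emeasure \<mu> (cube R)"
          using Fpos[OF R] by (intro doubling) auto
        also have "\<dots> \<le> ennreal ((K * 3 ^ ?n) powr q) * (ennreal ((K / (1 / 2)) powr q) * emeasure \<mu> (cube R - \<Omega>'))"
          by (intro mult_left_mono small R) auto
        also have "\<dots> = ennreal ((K * 3 ^ ?n) powr q * (K / (1 / 2)) powr q) * emeasure \<mu> (cube R - \<Omega>')"
          by (simp add: ennreal_mult ac_simps)
        also have "\<dots> \<le> ennreal C * emeasure \<mu> (cube R - \<Omega>')"
          unfolding C_def by (intro mult_right_mono ennreal_leI) auto
        finally show "emeasure \<mu> (cube (dilate 3 R)) \<le> ennreal C * emeasure \<mu> (cube R - \<Omega>')" .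
      qed
      also have "\<dots> = ennreal C * (\<Sum>R\<in>J. emeasure \<mu> (cube R - \<Omega>'))" by (simp add: sum_distrib_left)
      also have "(\<Sum>R\<in>J. emeasure \<mu> (cube R - \<Omega>')) = emeasure \<mu> (\<Union>R\<in>J. cube R - \<Omega>')"
      proof (rule sum_emeasure)
        show "disjoint_family_on (\<lambda>R. cube R - \<Omega>') J" using J(3) unfolding disjoint_family_on_def by blast
      qed (use J in auto)
      also have "\<dots> \<le> emeasure \<mu> (\<Omega> - \<Omega>')"
      proof (rule emeasure_mono)
        show "(\<Union>R\<in>J. cube R - \<Omega>') \<subseteq> \<Omega> - \<Omega>'" using J(2) F\<Omega> by blast
      qed auto
      finally show "(\<Sum>R\<in>J. emeasure \<mu> (cube (dilate 3 R))) \<le> ennreal C * emeasure \<mu> (\<Omega> - \<Omega>')"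
        by (simp add: mult_left_mono)
    qed (auto simp: Fpos)
    moreover have "emeasure \<mu> \<Omega> \<le> emeasure \<mu> (\<Union>R\<in>F. cube R)"
    proof (rule emeasure_mono[OF cover])
      have "countable F" unfolding F_def by (auto intro: countable_subset[OF _ countable_rat_cubes])
      then show "(\<Union>R\<in>F. cube R) \<in> sets \<mu>" by (intro sets.countable_UN') auto
    qed
    ultimately have le: "emeasure \<mu> \<Omega> \<le> ennreal C * emeasure \<mu> (\<Omega> - \<Omega>')" by (rule order_trans[rotated])
    have fin\<Omega>: "emeasure \<mu> \<Omega> < \<infinity>" using \<mu>fin by (simp add: \<Omega>_def)
    have fin\<Omega>': "emeasure \<mu> \<Omega>' < \<infinity>" using fin\<Omega> emeasure_mono[OF sub, of \<mu>] by (auto intro: order_le_less_trans)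
    obtain m where m: "emeasure \<mu> \<Omega> = ennreal m" "0 \<le> m" using fin\<Omega> by (cases "emeasure \<mu> \<Omega>") auto
    obtain m' where m': "emeasure \<mu> \<Omega>' = ennreal m'" "0 \<le> m'" using fin\<Omega>' by (cases "emeasure \<mu> \<Omega>'") auto
    have mm: "m' \<le> m" using emeasure_mono[OF sub, of \<mu>] m m' by simp
    have "emeasure \<mu> (\<Omega> - \<Omega>') = ennreal (m - m')"
      using sub m m' fin\<Omega>' by (subst emeasure_Diff) (auto simp: ennreal_minus)
    with le have "m \<le> C * (m - m')" using m mm C by (simp add: ennreal_mult[symmetric])
    then have "m' \<le> (1 - 1 / C) * m" using C by (simp add: field_simps)
    then show ?thesis using m m' C by (simp add: \<Omega>_def[symmetric] \<Omega>'_def[symmetric] ennreal_mult[symmetric] ennreal_leI)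
  qed
  then show ?thesis using C by (intro exI[of _ "1 - 1 / C"]) auto
qed

text \<open>
  Restrict \<open>g\<close> to \<open>3 Q\<close>; this changes no level set in \<open>Q\<close> above the first step. The level set of the
  restriction at height \<open>inf M g\<close> is contained in \<open>9 Q\<close>, where the iteration of \<open>level_set_decay\<close>
  can start.
\<close>

lemma maximal_decay:
  "\<exists>\<theta> C. 0 \<le> \<theta> \<and> \<theta> < 1 \<and> 0 < C \<and> (\<forall>g Q k. g \<in> borel_measurable lebesgue \<longrightarrow> 0 < snd Q \<longrightarrow>
     0 < inf_maximal g Q \<longrightarrow> inf_maximal g Q < \<infinity> \<longrightarrow>
     emeasure \<mu> {x \<in> cube Q. ennreal ((2 * 9 ^ CARD('n)) ^ k) * inf_maximal g Q < HL_maximal g x}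
       \<le> ennreal (C * \<theta> ^ k) * emeasure \<mu> (cube Q))"
proof -
  let ?n = "CARD('n)"
  let ?A = "2 * 9 ^ CARD('n) :: real"
  obtain \<theta> where \<theta>: "0 \<le> \<theta>" "\<theta> < 1" and dec: "\<And>h l. h \<in> borel_measurable lebesgue \<Longrightarrow> (\<integral>\<^sup>+x. h x \<partial>lebesgue) < \<infinity> \<Longrightarrow> 0 < l \<Longrightarrow>
     emeasure \<mu> {x. ennreal l < HL_maximal h x} < \<infinity> \<Longrightarrow>
     emeasure \<mu> {x. ennreal (?A * l) < HL_maximal h x} \<le> ennreal \<theta> * emeasure \<mu> {x. ennreal l < HL_maximal h x}"
    using level_set_decay by auto
  define C where "C = (K * 9 ^ ?n) powr q"
  have C: "0 < C" using K by (simp add: C_def)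
  have "emeasure \<mu> {x \<in> cube Q. ennreal (?A ^ k) * inf_maximal g Q < HL_maximal g x} \<le> ennreal (C * \<theta> ^ k) * emeasure \<mu> (cube Q)"
    if g [measurable]: "g \<in> borel_measurable lebesgue" and Q: "0 < snd Q" and I: "0 < inf_maximal g Q" "inf_maximal g Q < \<infinity>" for g Q k
  proof -
    obtain l where l: "inf_maximal g Q = ennreal l" "0 < l" using I by (cases "inf_maximal g Q") auto
    have Q9: "emeasure \<mu> (cube (dilate 9 Q)) \<le> ennreal C * emeasure \<mu> (cube Q)"
      unfolding C_def using Q by (intro doubling) auto
    show ?thesis
    proof (cases k)
      case 0
      have "emeasure \<mu> {x \<in> cube Q. ennreal (?A ^ k) * inf_maximal g Q < HL_maximal g x} \<le> emeasure \<mu> (cube (dilate 9 Q))"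
        using cube_subset_dilate_self[of 9 Q] Q by (intro emeasure_mono) auto
      then show ?thesis using Q9 0 by simp
    next
      case (Suc k')
      let ?h = "\<lambda>x. g x * indicator (cube (dilate 3 Q)) x"
      have hm [measurable]: "?h \<in> borel_measurable lebesgue" by measurable
      have a3: "avg g (dilate 3 Q) \<le> ennreal l"
        using avg_le_inf_maximal[of "dilate 3 Q" Q g] cube_subset_dilate_self[of 3 Q] Q l by simp
      have int: "(\<integral>\<^sup>+x. ?h x \<partial>lebesgue) \<le> ennreal (l * vol (dilate 3 Q))"
        using Q a3 l by (intro set_integral_cube_le) auto
      have base: "{x. ennreal l < HL_maximal ?h x} \<subseteq> cube (dilate 9 Q)"
      proof
        fix x assume "x \<in> {x. ennreal l < HL_maximal ?h x}"
        then obtain R where R: "0 < snd R" "x \<in> cube R" "ennreal l < avg ?h R" by (auto simp: less_HL_iff)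
        have meets: "cube R \<inter> cube (dilate 3 Q) \<noteq> {}"
        proof
          assume "cube R \<inter> cube (dilate 3 Q) = {}"
          then have "(\<lambda>t. ?h t * indicator (cube R) t) = (\<lambda>_. 0)" by (auto simp: indicator_def fun_eq_iff)
          then have "avg ?h R = 0" by (simp only: avg_def) simp
          with R l show False by simp
        qed
        have "snd R < 3 * snd Q"
        proof (rule ccontr)
          assume c: "\<not> ?thesis"
          have "vol (dilate 3 Q) \<le> vol R" using c Q unfolding vol_def by (intro power_mono) auto
          have "avg ?h R \<le> ennreal (l * vol (dilate 3 Q)) / ennreal (vol R)"
            unfolding avg_def
            by (intro divide_right_mono_ennreal order_trans[OF _ int] nn_integral_mono) (auto simp: indicator_def)
          also have "\<dots> = ennreal (l * vol (dilate 3 Q) / vol R)"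
            using l vol_pos[OF R(1)] vol_pos[of "dilate 3 Q"] Q by (intro divide_ennreal) auto
          also have "\<dots> \<le> ennreal l"
            using l vol_pos[OF R(1)] \<open>vol (dilate 3 Q) \<le> vol R\<close> by (intro ennreal_leI) (auto simp: field_simps)
          finally show False using R(3) by simp
        qed
        then have "cube R \<subseteq> cube (dilate 9 Q)"
          using meets by (intro cube_subset_if_meets[of R "dilate 3 Q"]) auto
        with R show "x \<in> cube (dilate 9 Q)" by auto
      qed
      \<comment> \<open>The restriction is integrable and its first level set has finite measure, as the iteration
        requires.\<close>
      have iter: "emeasure \<mu> {x. ennreal (?A ^ j * l) < HL_maximal ?h x} \<le> ennreal (\<theta> ^ j) * emeasure \<mu> (cube (dilate 9 Q))" for j
      proof (induction j)
        case 0
        show ?case using base by (auto intro!: emeasure_mono)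
      next
        case (Suc j)
        have "emeasure \<mu> {x. ennreal (?A * (?A ^ j * l)) < HL_maximal ?h x} \<le> ennreal \<theta> * emeasure \<mu> {x. ennreal (?A ^ j * l) < HL_maximal ?h x}"
        proof (rule dec[OF hm])
          show "(\<integral>\<^sup>+x. ?h x \<partial>lebesgue) < \<infinity>" using int by (rule order_le_less_trans) simp
          have "ennreal (\<theta> ^ j) * emeasure \<mu> (cube (dilate 9 Q)) < \<infinity>" by (simp add: emeasure_mass ennreal_mult_less_top)
          with Suc show "emeasure \<mu> {x. ennreal (?A ^ j * l) < HL_maximal ?h x} < \<infinity>" by (rule order_le_less_trans)
        qed (use l in auto)
        also have "\<dots> \<le> ennreal \<theta> * (ennreal (\<theta> ^ j) * emeasure \<mu> (cube (dilate 9 Q)))"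
          by (intro mult_left_mono Suc) auto
        finally show ?case using \<theta> by (simp add: ac_simps ennreal_mult)
      qed
      have sub: "{x \<in> cube Q. ennreal (?A ^ Suc j) * inf_maximal g Q < HL_maximal g x} \<subseteq> {x. ennreal (?A ^ Suc j * l) < HL_maximal ?h x}" for j
      proof
        fix x assume "x \<in> {x \<in> cube Q. ennreal (?A ^ Suc j) * inf_maximal g Q < HL_maximal g x}"
        then have x: "x \<in> cube Q" "ennreal (?A ^ Suc j * l) < HL_maximal g x" using l by (auto simp: ennreal_mult)
        then obtain R where R: "0 < snd R" "x \<in> cube R" "ennreal (?A ^ Suc j * l) < avg g R" by (auto simp: less_HL_iff)
        have meets: "cube R \<inter> cube Q \<noteq> {}" "cube Q \<inter> cube R \<noteq> {}" using R x by auto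
        have "snd R \<le> snd Q"
        proof (rule ccontr)
          assume "\<not> ?thesis"
          then have "avg g (dilate 3 R) \<le> inf_maximal g Q"
            using meets R by (intro avg_le_inf_maximal cube_subset_dilate) auto
          then have "ennreal (3 ^ ?n) * avg g (dilate 3 R) \<le> ennreal (3 ^ ?n) * ennreal l"
            unfolding l(1) by (rule mult_left_mono) simp
          moreover have "avg g R \<le> ennreal (3 ^ ?n) * avg g (dilate 3 R)"
            using R by (intro avg_mono cube_subset_dilate_self) auto
          moreover have "ennreal (3 ^ ?n) * ennreal l \<le> ennreal (?A ^ Suc j * l)"
          proof -
            have "3 ^ ?n * 1 \<le> ?A * ?A ^ j"
              by (intro mult_mono one_le_power one_le_two_pow_9 pow_le_two_pow_9(1)) auto
            then show ?thesis using l by (auto simp: ennreal_mult[symmetric] intro!: ennreal_leI mult_right_mono)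
          qed
          ultimately show False using R(3) by (meson leD order_trans)
        qed
        then have "cube R \<subseteq> cube (dilate 3 Q)" using meets by (intro cube_subset_dilate)
        then have "avg ?h R = avg g R" by (rule avg_restrict)
        then show "x \<in> {x. ennreal (?A ^ Suc j * l) < HL_maximal ?h x}"
          using less_HLI[OF R(1,2), of "ennreal (?A ^ Suc j * l)" ?h] R(3) by simp
      qed
      have ms: "{x. ennreal (?A ^ k * l) < HL_maximal ?h x} \<in> sets \<mu>"
        using measurable_sets[OF HL_maximal_measurable[of ?h], of "{ennreal (?A ^ k * l)<..}"] by (auto simp: vimage_def)
      have "emeasure \<mu> {x \<in> cube Q. ennreal (?A ^ k) * inf_maximal g Q < HL_maximal g x} \<le> emeasure \<mu> {x. ennreal (?A ^ k * l) < HL_maximal ?h x}"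
        using sub[of k'] ms unfolding Suc by (intro emeasure_mono)
      also have "\<dots> \<le> ennreal (\<theta> ^ k) * emeasure \<mu> (cube (dilate 9 Q))" by (rule iter)
      also have "\<dots> \<le> ennreal (\<theta> ^ k) * (ennreal C * emeasure \<mu> (cube Q))" by (intro mult_left_mono Q9) auto
      finally show ?thesis using C \<theta> by (simp add: ennreal_mult ac_simps)
    qed
  qed
  then show ?thesis using \<theta> C by blast
qed

end

section \<open>From the weak norm of the inverse weight to the restricted condition\<close>

lemma lebesgue_eq_integral_inverse_weight:
  assumes w: "weight w" and E: "E \<in> sets lebesgue" "E \<subseteq> X"
  shows "emeasure lebesgue E = (\<integral>\<^sup>+x. ennreal (indicator X x * inverse (w x)) * indicator E x \<partial>wmeasure w)"
proof -
  have wm [measurable]: "w \<in> borel_measurable lebesgue" using w by (simp add: weight_def)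
  have "(\<lambda>x. ennreal (indicator X x * inverse (w x)) * indicator E x) = (\<lambda>x. ennreal (inverse (w x)) * indicator E x)"
    using E(2) by (auto simp: fun_eq_iff indicator_def)
  then have "(\<integral>\<^sup>+x. ennreal (indicator X x * inverse (w x)) * indicator E x \<partial>wmeasure w)
     = (\<integral>\<^sup>+x. ennreal (w x) * (ennreal (inverse (w x)) * indicator E x) \<partial>lebesgue)"
    unfolding wmeasure_def using E(1) by (simp add: nn_integral_density)
  also have "\<dots> = (\<integral>\<^sup>+x. indicator E x \<partial>lebesgue)"
  proof (rule nn_integral_cong_AE)
    have "AE x in lebesgue. 0 < w x" using w by (simp add: weight_def)
    then show "AE x in lebesgue. ennreal (w x) * (ennreal (inverse (w x)) * indicator E x) = indicator E x"
      by eventually_elim (auto simp: indicator_def ennreal_mult[symmetric])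
  qed
  finally show ?thesis using E(1) by simp
qed

text \<open>
  Half of the duality between \<open>L^{q,1}\<close> and \<open>L^{q',\<infinity>}\<close>, for the indicator function of \<open>E\<close>. By the layer
  cake formula the left side is the integral over \<open>y\<close> of a function bounded both by \<open>e = M(E)\<close> and by
  \<open>(N / y)^{q'}\<close>. The proof splits the integral at the point \<open>y0\<close> where the two bounds agree.
\<close>

lemma weak_norm_integral_bound:
  fixes h :: "'a \<Rightarrow> ennreal" and M :: "'a measure"
  assumes sf: "sigma_finite_measure M" and h [measurable]: "h \<in> borel_measurable M" and E [measurable]: "E \<in> sets M"
    and q: "1 < q" and N: "0 < N" and e: "emeasure M E = ennreal e" "0 < e"
    and weak: "\<And>y. 0 < y \<Longrightarrow> ennreal y * epowr (emeasure M {x \<in> space M. ennreal y < h x}) (1 / (q / (q - 1))) \<le> ennreal N"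
  shows "(\<integral>\<^sup>+x. h x * indicator E x \<partial>M) \<le> ennreal (q * N * e powr (1 / q))"
proof -
  define r where "r = q / (q - 1)"
  have r: "1 < r" using q by (simp add: r_def field_simps)
  have r': "1 - 1 / r = 1 / q" "1 + 1 / (r - 1) = q" using q by (auto simp: r_def field_simps)
  define y0 where "y0 = N * e powr (- 1 / r)"
  have y0: "0 < y0" using N e by (simp add: y0_def)
  have bound: "emeasure M {x \<in> space M. ennreal y < h x} \<le> ennreal (N powr r * y powr (- r))" if y: "0 < y" for y
  proof -
    have w: "ennreal y * epowr (emeasure M {x \<in> space M. ennreal y < h x}) (1 / r) \<le> ennreal N"
      using weak[OF y] by (simp add: r_def)
    then have "emeasure M {x \<in> space M. ennreal y < h x} \<noteq> top"
      using y by (auto simp: epowr_top ennreal_mult_top top_unique)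
    then obtain a where a: "emeasure M {x \<in> space M. ennreal y < h x} = ennreal a" "0 \<le> a"
      by (cases "emeasure M {x \<in> space M. ennreal y < h x}") auto
    have "y * a powr (1 / r) \<le> N"
      using w a y N by (simp add: epowr_ennreal ennreal_mult[symmetric])
    then have "a powr (1 / r) \<le> N / y" using y by (simp add: field_simps)
    then have "(a powr (1 / r)) powr r \<le> (N / y) powr r" using r by (intro powr_mono2) auto
    moreover have "(N / y) powr r = N powr r * y powr (- r)"
      using y N by (simp add: powr_divide powr_minus_divide)
    ultimately have "a \<le> N powr r * y powr (- r)"
      using a r by (simp add: powr_powr)
    then show ?thesis using a by (simp add: ennreal_leI)
  qed
  have "(\<integral>\<^sup>+x. h x * indicator E x \<partial>M) = (\<integral>\<^sup>+y\<in>{0<..}. emeasure M {x \<in> space M. ennreal y < h x * indicator E x} \<partial>lborel)"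
    by (rule layer_cake(1)[OF sf]) measurable
  also have "\<dots> \<le> (\<integral>\<^sup>+y. ennreal e * indicator {0<..<y0} y + ennreal (N powr r * y powr (- r)) * indicator {y0..} y \<partial>lborel)"
  proof (intro nn_integral_mono)
    fix y :: real
    have s: "{x \<in> space M. ennreal y < h x * indicator E x} \<subseteq> E" "{x \<in> space M. ennreal y < h x * indicator E x} \<subseteq> {x \<in> space M. ennreal y < h x}"
      using E by (auto simp: indicator_def dest: sets.sets_into_space split: if_splits)
    have m: "emeasure M {x \<in> space M. ennreal y < h x * indicator E x} \<le> ennreal e"
       "emeasure M {x \<in> space M. ennreal y < h x * indicator E x} \<le> emeasure M {x \<in> space M. ennreal y < h x}"
      using emeasure_mono[OF s(1) E] emeasure_mono[OF s(2), of M] e by auto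
    show "emeasure M {x \<in> space M. ennreal y < h x * indicator E x} * indicator {0<..} y
       \<le> ennreal e * indicator {0<..<y0} y + ennreal (N powr r * y powr (- r)) * indicator {y0..} y"
      using m bound[of y] y0 by (cases "0 < y"; cases "y < y0") (auto intro: order_trans)
  qed
  also have "\<dots> = (\<integral>\<^sup>+y. ennreal e * indicator {0<..<y0} y \<partial>lborel) + (\<integral>\<^sup>+y. ennreal (N powr r * y powr (- r)) * indicator {y0..} y \<partial>lborel)"
    by (rule nn_integral_add) auto
  also have "(\<integral>\<^sup>+y. ennreal e * indicator {0<..<y0} y \<partial>lborel) = ennreal (e * y0)"
    using e y0 by (simp add: nn_integral_cmult_indicator ennreal_mult)
  also have "(\<integral>\<^sup>+y. ennreal (N powr r * y powr (- r)) * indicator {y0..} y \<partial>lborel) = ennreal (0 - (- (N powr r * y0 powr (1 - r) / (r - 1))))"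
  proof (rule nn_integral_FTC_atLeast)
    fix x assume "y0 \<le> x"
    then have "0 < x" using y0 by simp
    then show "((\<lambda>x. - (N powr r * x powr (1 - r) / (r - 1))) has_real_derivative N powr r * x powr (- r)) (at x)"
    proof -
      have "((\<lambda>x. (- (N powr r / (r - 1))) * x powr (1 - r)) has_real_derivative (- (N powr r / (r - 1))) * ((1 - r) * x powr (1 - r - 1))) (at x)"
        by (intro DERIV_cmult has_real_derivative_powr \<open>0 < x\<close>)
      moreover have "(- (N powr r / (r - 1))) * ((1 - r) * x powr (1 - r - 1)) = N powr r * x powr (- r)"
        using r by (simp add: divide_simps) (simp add: algebra_simps)
      moreover have "(\<lambda>x. (- (N powr r / (r - 1))) * x powr (1 - r)) = (\<lambda>x. - (N powr r * x powr (1 - r) / (r - 1)))"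
        by (simp add: fun_eq_iff)
      ultimately show ?thesis by simp
    qed
  next
    have "((\<lambda>x::real. x powr (1 - r)) \<longlongrightarrow> 0) at_top"
      using r by (intro tendsto_neg_powr filterlim_ident) auto
    then have "((\<lambda>x. - (N powr r * x powr (1 - r) / (r - 1))) \<longlongrightarrow> - (N powr r * 0 / (r - 1))) at_top"
      using r by (intro tendsto_intros) auto
    then show "((\<lambda>x. - (N powr r * x powr (1 - r) / (r - 1))) \<longlongrightarrow> 0) at_top" by simp
  qed (use N in auto)
  also have "ennreal (e * y0) + ennreal (0 - (- (N powr r * y0 powr (1 - r) / (r - 1)))) = ennreal (e * y0 + N powr r * y0 powr (1 - r) / (r - 1))"
    using e y0 r N by (subst ennreal_plus) auto
  also have "e * y0 + N powr r * y0 powr (1 - r) / (r - 1) = q * N * e powr (1 / q)"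
  proof -
    have "e * y0 = N * (e powr 1 * e powr (- 1 / r))" using e by (simp add: y0_def)
    also have "e powr 1 * e powr (- 1 / r) = e powr (1 + - 1 / r)" by (rule powr_add[symmetric])
    also have "1 + - 1 / r = 1 / q" using r'(1) by simp
    finally have 1: "e * y0 = N * e powr (1 / q)" .
    have "N powr r * y0 powr (1 - r) = (N powr r * N powr (1 - r)) * e powr ((- 1 / r) * (1 - r))"
      using N e by (simp add: y0_def powr_mult powr_powr)
    also have "(- 1 / r) * (1 - r) = 1 / q" using r r'(1) by (simp add: field_simps)
    also have "N powr r * N powr (1 - r) = N" using N by (simp add: powr_add[symmetric])
    finally have 2: "N powr r * y0 powr (1 - r) = N * e powr (1 / q)" .
    have "N * e powr (1 / q) + N * e powr (1 / q) / (r - 1) = (1 + 1 / (r - 1)) * N * e powr (1 / q)"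
      by (simp add: algebra_simps)
    then show ?thesis unfolding 1 2 r'(2) .
  qed
  finally show ?thesis .
qed

text \<open>
  Since \<open>|E|\<close> is the integral of \<open>1 / w\<close> over \<open>E\<close> with respect to \<open>w\<close>, this is the duality of
  \<open>weak_norm_integral_bound\<close>; for \<open>q = 1\<close> it is the pairing of \<open>L^1\<close> with \<open>L^\<infinity>\<close>.
\<close>

lemma dual_weak_norm_bound:
  fixes w :: "real ^ 'n \<Rightarrow> real"
  assumes w: "weight w" and q: "1 \<le> q" and Q: "0 < snd Q" and E: "E \<in> sets lebesgue" "E \<subseteq> cube Q"
    and N: "norm_Lqinf (conj_exponent q) w (\<lambda>x. ennreal (indicator (cube Q) x * inverse (w x))) \<le> ennreal N" "0 < N"
  shows "emeasure lebesgue E \<le> ennreal (q * N) * epowr (emeasure (wmeasure w) E) (1 / q)"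
proof -
  have wm [measurable]: "w \<in> borel_measurable lebesgue" using w by (simp add: weight_def)
  define h where "h = (\<lambda>x. ennreal (indicator (cube Q) x * inverse (w x)))"
  have hm: "h \<in> borel_measurable lebesgue" unfolding h_def by measurable
  then have hm' [measurable]: "h \<in> borel_measurable (wmeasure w)" by (simp add: measurable_cong_sets[of "wmeasure w" lebesgue])
  have E': "E \<in> sets (wmeasure w)" using E by simp
  have eq: "emeasure lebesgue E = (\<integral>\<^sup>+x. h x * indicator E x \<partial>wmeasure w)"
    unfolding h_def by (rule lebesgue_eq_integral_inverse_weight[OF w E])
  show ?thesis
  proof (cases "q = 1")
    case True
    have "esssup (wmeasure w) h \<le> ennreal N" using N(1) True by (simp add: norm_Lqinf_def conj_exponent_def h_def)
    moreover have "AE x in wmeasure w. h x \<le> esssup (wmeasure w) h" by (rule esssup_AE)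
    ultimately have "AE x in wmeasure w. h x * indicator E x \<le> ennreal N * indicator E x"
      by (auto intro!: mult_right_mono elim: order_trans)
    then have "(\<integral>\<^sup>+x. h x * indicator E x \<partial>wmeasure w) \<le> (\<integral>\<^sup>+x. ennreal N * indicator E x \<partial>wmeasure w)"
      by (rule nn_integral_mono_AE)
    then show ?thesis using E' True by (simp add: eq nn_integral_cmult_indicator epowr_one)
  next
    case False
    then have q1: "1 < q" using q by simp
    have "emeasure (wmeasure w) E \<le> emeasure (wmeasure w) (cube Q)" using E by (intro emeasure_mono) auto
    then have "emeasure (wmeasure w) E < \<infinity>" using wmeasure_cube_finite[OF w, of Q] by (rule order_le_less_trans)
    then obtain e where e: "emeasure (wmeasure w) E = ennreal e" "0 \<le> e" by (cases "emeasure (wmeasure w) E") auto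
    show ?thesis
    proof (cases "e = 0")
      case True
      then show ?thesis using null_sets_wmeasure[OF w E(1)] e by simp
    next
      case False
      have "(\<integral>\<^sup>+x. h x * indicator E x \<partial>wmeasure w) \<le> ennreal (q * N * e powr (1 / q))"
      proof (rule weak_norm_integral_bound[OF sigma_finite_wmeasure[OF w] hm' E' q1 N(2) e(1)])
        fix y :: real assume "0 < y"
        then have "ennreal y * epowr (emeasure (wmeasure w) {x \<in> space (wmeasure w). ennreal y < h x}) (1 / (q / (q - 1)))
            \<le> norm_Lqinf (conj_exponent q) w h"
          using q1 unfolding norm_Lqinf_def conj_exponent_def distr_fun_def
          by (auto intro!: SUP_upper2[of y])
        then show "ennreal y * epowr (emeasure (wmeasure w) {x \<in> space (wmeasure w). ennreal y < h x}) (1 / (q / (q - 1))) \<le> ennreal N"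
          using N(1) by (simp add: h_def)
      qed (use e False in auto)
      then show ?thesis using e N q by (simp add: eq epowr_ennreal ennreal_mult)
    qed
  qed
qed

lemma AR_class_restricted_weight:
  fixes w :: "real ^ 'n \<Rightarrow> real"
  assumes q: "1 \<le> q" and AR: "w \<in> AR_class q"
  shows "\<exists>K. restricted_weight w q K"
proof -
  have w: "weight w" using AR by (simp add: AR_class_def)
  obtain A where A: "AR_const q w = ennreal A" "0 \<le> A" using AR by (cases "AR_const q w") (auto simp: AR_class_def)
  define K where "K = q * (A + 1)"
  have "emeasure lebesgue E * epowr (emeasure (wmeasure w) (cube Q)) (1 / q)
        \<le> ennreal K * (ennreal (vol Q) * epowr (emeasure (wmeasure w) E) (1 / q))"
    if Q: "0 < snd Q" and E: "E \<in> sets lebesgue" "E \<subseteq> cube Q" for Q E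
  proof -
    define N where "N = norm_Lqinf (conj_exponent q) w (\<lambda>x. ennreal (indicator (cube Q) x * inverse (w x)))"
    obtain b where b: "emeasure (wmeasure w) (cube Q) = ennreal b" "0 < b"
      using wmeasure_cube_finite[OF w, of Q] wmeasure_cube_pos[OF w Q] by (cases "emeasure (wmeasure w) (cube Q)") auto
    define \<beta> where "\<beta> = b powr (1 / q)"
    have \<beta>: "0 < \<beta>" "epowr (emeasure (wmeasure w) (cube Q)) (1 / q) = ennreal \<beta>"
      using b by (auto simp: \<beta>_def epowr_ennreal)
    have v: "0 < vol Q" using Q by (rule vol_pos)
    have "ennreal \<beta> * N / ennreal (vol Q) \<le> ennreal A"
      unfolding A(1)[symmetric] AR_const_def N_def \<beta>(2)[symmetric] emeasure_cube[OF Q, symmetric]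
    proof (rule SUP_upper)
      show "cube Q \<in> cubes" unfolding cubes_eq using Q by blast
    qed
    then have "ennreal \<beta> * N / ennreal (vol Q) * ennreal (vol Q) \<le> ennreal A * ennreal (vol Q)"
      by (rule mult_right_mono) simp
    moreover have "ennreal \<beta> * N / ennreal (vol Q) * ennreal (vol Q) = ennreal \<beta> * N"
      using v by (subst ennreal_divide_times) (simp add: ennreal_divide_self)
    ultimately have bN: "ennreal \<beta> * N \<le> ennreal (A * vol Q)" using A v by (simp add: ennreal_mult)
    then have "N \<noteq> top" using \<beta> by (auto simp: ennreal_mult_top top_unique)
    then obtain n where n: "N = ennreal n" "0 \<le> n" by (cases N) auto
    \<comment> \<open>\<open>A + 1\<close> instead of \<open>A\<close> keeps the bound for the weak norm strictly positive.\<close>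
    define M where "M = (A + 1) * vol Q / \<beta>"
    have M: "0 < M" using A v \<beta> by (simp add: M_def)
    have "\<beta> * n \<le> A * vol Q" using bN n \<beta> A v by (simp add: ennreal_mult[symmetric])
    also have "\<dots> \<le> (A + 1) * vol Q" using v by (intro mult_right_mono) auto
    finally have "n \<le> M" using \<beta> by (simp add: M_def field_simps)
    then have "N \<le> ennreal M" using n by (simp add: ennreal_leI)
    then have "emeasure lebesgue E \<le> ennreal (q * M) * epowr (emeasure (wmeasure w) E) (1 / q)"
      unfolding N_def using M by (intro dual_weak_norm_bound[OF w q Q E])
    then have "emeasure lebesgue E * ennreal \<beta> \<le> ennreal (q * M) * epowr (emeasure (wmeasure w) E) (1 / q) * ennreal \<beta>"
      by (rule mult_right_mono) simp
    also have "\<dots> = ennreal (q * M * \<beta>) * epowr (emeasure (wmeasure w) E) (1 / q)"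
      using M q \<beta> by (simp add: ennreal_mult ac_simps)
    also have "q * M * \<beta> = K * vol Q" using \<beta> by (simp add: M_def K_def)
    finally show ?thesis using A q v \<beta> by (simp add: K_def ennreal_mult ac_simps)
  qed
  then have "restricted_weight w q K"
    using w q A by unfold_locales (auto simp: K_def)
  then show ?thesis by blast
qed

section \<open>Positivity and finiteness of maximal functions and norms\<close>

text \<open>
  Some cube contains both \<open>Q\<close> and a cube on which \<open>g\<close> has positive average.
\<close>

lemma inf_maximal_pos:
  fixes Q :: "(real ^ 'n) \<times> real"
  assumes Q0: "0 < snd Q0" "0 < avg g Q0" and Q: "0 < snd Q"
  shows "0 < inf_maximal g Q"
proof -
  define T where "T = (fst Q0, snd Q0 + snd Q + (\<Sum>i\<in>UNIV. \<bar>fst Q $ i - fst Q0 $ i\<bar>))"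
  have S: "0 \<le> (\<Sum>i\<in>UNIV. \<bar>fst Q $ i - fst Q0 $ i\<bar>)" by (rule sum_nonneg) simp
  have T: "0 < snd T" unfolding T_def snd_conv using Q0(1) Q S by linarith
  have "cube Q \<subseteq> cube T"
  proof
    fix x assume "x \<in> cube Q"
    then have x: "\<bar>x $ i - fst Q $ i\<bar> \<le> snd Q" for i by (simp add: cube_def)
    have d: "\<bar>fst Q $ i - fst Q0 $ i\<bar> \<le> (\<Sum>i\<in>UNIV. \<bar>fst Q $ i - fst Q0 $ i\<bar>)" for i by (rule member_le_sum) auto
    have "\<bar>x $ i - fst Q0 $ i\<bar> \<le> snd T" for i
      using x[of i] d[of i] Q0(1) unfolding T_def snd_conv by linarith
    then show "x \<in> cube T" by (simp add: cube_def T_def)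
  qed
  then have "avg g T \<le> inf_maximal g Q" using T by (intro avg_le_inf_maximal)
  moreover have "cube Q0 \<subseteq> cube T"
  proof
    fix x assume "x \<in> cube Q0"
    then have x: "\<bar>x $ i - fst Q0 $ i\<bar> \<le> snd Q0" for i by (simp add: cube_def)
    have "\<bar>x $ i - fst Q0 $ i\<bar> \<le> snd T" for i
      using x[of i] Q S unfolding T_def snd_conv by linarith
    then show "x \<in> cube T" by (simp add: cube_def T_def)
  qed
  then have "avg g Q0 \<le> ennreal ((snd T / snd Q0) ^ CARD('n)) * avg g T"
    using Q0 T by (intro avg_mono) auto
  then have "avg g T \<noteq> 0" using Q0 by auto
  ultimately show ?thesis by (auto simp: zero_less_iff_neq_zero)
qed

context restricted_weight
begin

lemma norm_pos:
  assumes g: "g \<in> borel_measurable lebesgue" and Q: "0 < snd Q" "0 < avg g Q"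
  shows "0 < norm_Lq1 q u g"
proof (rule ccontr)
  assume "\<not> ?thesis"
  then have "norm_Lq1 q u g \<le> ennreal 0" by simp
  then have "(\<Sum>Q\<in>{Q}. epowr (avg g Q) q * emeasure \<mu> (cube Q)) \<le> ennreal ((K * 0) powr q)"
    using Q by (intro packing[OF g]) (auto simp: disjoint_family_on_def)
  then have "epowr (avg g Q) q = 0 \<or> emeasure \<mu> (cube Q) = 0" by simp
  then show False
    using wmeasure_cube_pos[OF wt Q(1)] Q(2) by (cases "avg g Q") (auto simp: epowr_ennreal epowr_top)
qed

text \<open>
  The weak type \<open>(q, q)\<close> bound: packing, applied to disjoint cubes with averages above \<open>n\<close>, shows that
  the level set at height \<open>n\<close> has measure at most \<open>c / n\<close>.
\<close>

lemma HL_maximal_finite_AE: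
  assumes g: "g \<in> borel_measurable lebesgue" and N: "norm_Lq1 q u g \<le> ennreal N" "0 \<le> N"
  shows "emeasure lebesgue {x. HL_maximal g x = \<infinity>} = 0"
proof -
  define c where "c = (K * 3 ^ CARD('n)) powr q * (K * N) powr q"
  have c: "0 \<le> c" by (simp add: c_def)
  have ms: "{x. HL_maximal g x = \<infinity>} \<in> sets lebesgue"
    using measurable_sets[OF HL_maximal_measurable[of g], of "{\<infinity>}"] by (simp add: vimage_def)
  have "emeasure \<mu> {x. HL_maximal g x = \<infinity>} \<le> ennreal (c / real n)" if n: "1 \<le> n" for n :: nat
  proof -
    have "emeasure \<mu> {x. HL_maximal g x = \<infinity>} \<le> emeasure \<mu> {x. ennreal (real n) < HL_maximal g x}"
      using level_set_sets[OF HL_maximal_measurable] by (intro emeasure_mono) auto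
    also have "\<dots> \<le> ennreal ((K * 3 ^ CARD('n)) powr q) * ennreal ((K * N) powr q / real n)"
    proof (rule maximal_level_set_le)
      fix J :: "((real ^ 'n) \<times> real) set"
      assume J: "finite J" "disjoint_family_on cube J" "\<And>Q. Q \<in> J \<Longrightarrow> 0 < snd Q \<and> ennreal (real n) < avg g Q"
      have "ennreal (real n) * emeasure \<mu> (cube Q) \<le> epowr (avg g Q) q * emeasure \<mu> (cube Q)" if "Q \<in> J" for Q
      proof (intro mult_right_mono)
        have "real n powr 1 \<le> real n powr q" using q n by (intro powr_mono) auto
        then have "ennreal (real n) \<le> epowr (ennreal (real n)) q" using n by (simp add: epowr_ennreal ennreal_leI)
        also have "\<dots> \<le> epowr (avg g Q) q" using J(3)[OF that] q by (intro epowr_mono) auto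
        finally show "ennreal (real n) \<le> epowr (avg g Q) q" .
      qed simp
      then have "(\<Sum>Q\<in>J. ennreal (real n) * emeasure \<mu> (cube Q)) \<le> (\<Sum>Q\<in>J. epowr (avg g Q) q * emeasure \<mu> (cube Q))"
        by (rule sum_mono)
      also have "\<dots> \<le> ennreal ((K * N) powr q)" using J by (intro packing[OF g N]) auto
      finally have "ennreal (real n * (\<Sum>Q\<in>J. mass Q)) \<le> ennreal ((K * N) powr q)"
        using n by (simp add: emeasure_mass sum_distrib_left[symmetric] sum_ennreal mass_nonneg ennreal_mult sum_nonneg)
      then have "real n * (\<Sum>Q\<in>J. mass Q) \<le> (K * N) powr q" by simp
      then have "(\<Sum>Q\<in>J. mass Q) \<le> (K * N) powr q / real n" using n by (simp add: field_simps)
      then show "(\<Sum>Q\<in>J. emeasure \<mu> (cube Q)) \<le> ennreal ((K * N) powr q / real n)"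
        by (simp add: emeasure_mass sum_ennreal mass_nonneg ennreal_leI)
    qed (use doubling[where k=3] in auto)
    also have "\<dots> = ennreal (c / real n)" by (simp add: c_def ennreal_mult[symmetric])
    finally show ?thesis .
  qed
  moreover have "(\<lambda>n. ennreal (c / real n)) \<longlonglongrightarrow> ennreal 0"
    by (intro tendsto_ennrealI lim_const_over_n)
  ultimately have "emeasure \<mu> {x. HL_maximal g x = \<infinity>} \<le> ennreal 0"
    by (intro LIMSEQ_le_const[of "\<lambda>n. ennreal (c / real n)"]) auto
  then show ?thesis using null_sets_wmeasure[OF wt ms] by simp
qed

end

section \<open>The estimate for one factor over a slice\<close>

lemma prod_ennreal_pos:
  "finite I \<Longrightarrow> (\<And>i. i \<in> I \<Longrightarrow> 0 < f i) \<Longrightarrow> 0 < (\<Prod>i\<in>I. f i :: ennreal)"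
  by (induction I rule: finite_induct) (auto simp: ennreal_zero_less_mult_iff)

lemma prod_ennreal_pos_iff:
  "finite I \<Longrightarrow> 0 < (\<Prod>i\<in>I. f i :: ennreal) \<longleftrightarrow> (\<forall>i\<in>I. 0 < f i)"
  by (induction I rule: finite_induct) (auto simp: ennreal_zero_less_mult_iff)

lemma prod_ennreal_finite_factor:
  assumes "finite I" "\<And>i. i \<in> I \<Longrightarrow> 0 < f i" "(\<Prod>i\<in>I. f i :: ennreal) < \<infinity>" "i \<in> I"
  shows "f i < \<infinity>"
proof -
  have "(\<Prod>i\<in>I. f i) = f i * (\<Prod>i\<in>I - {i}. f i)" using assms by (intro prod.remove)
  moreover have "0 < (\<Prod>i\<in>I - {i}. f i)" using assms by (intro prod_ennreal_pos) auto
  then have "(\<Prod>i\<in>I - {i}. f i) \<noteq> 0" by (simp only: zero_less_iff_neq_zero not_False_eq_True)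
  ultimately show ?thesis using assms(2)[OF assms(4)] assms(3)
    by (simp only: ennreal_mult_less_top infinity_ennreal_def zero_less_iff_neq_zero) blast
qed

text \<open>
  The least \<open>k\<close> with \<open>l < B^k t\<close>; this is the index of the class of a point.
\<close>

lemma geometric_class:
  fixes B t l :: real
  assumes "1 < B" "0 < t" "t \<le> B * l" "0 < l"
  obtains k :: nat where "l < B ^ k * t" "B ^ k * t \<le> B * l"
proof -
  obtain k0 where "l / t < B ^ k0" using real_arch_pow[OF assms(1)] by blast
  then have ex: "l < B ^ k0 * t" using assms by (simp add: field_simps)
  define k where "k = (LEAST k. l < B ^ k * t)"
  have k: "l < B ^ k * t" unfolding k_def using ex by (rule LeastI)
  have "B ^ k * t \<le> B * l"
  proof (cases k)
    case 0
    then show ?thesis using assms by simp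
  next
    case (Suc k')
    then have "\<not> l < B ^ k' * t" unfolding k_def by (metis lessI not_less_Least)
    then have "B * (B ^ k' * t) \<le> B * l" using assms by (intro mult_left_mono) auto
    then show ?thesis by (simp add: Suc mult.assoc)
  qed
  with k show thesis by (rule that)
qed

context restricted_weight
begin

text \<open>
  A point \<open>x\<close> of the slice \<open>D\<close> belongs to class \<open>k\<close>, with the cube \<open>Q\<close>, if \<open>Q\<close> nearly attains
  \<open>F x = M f(x)\<close> and \<open>l < B^k G_Q F x \<le> B l\<close>; these points form \<open>S k Q\<close>. When a selected cube \<open>R\<close>
  absorbs \<open>Q\<close>, only \<open>G_{3R} \<le> G_Q\<close> is remembered, which leads to \<open>T k R\<close>. On \<open>T k R\<close> two facts hold.
  First, \<open>F x \<le> B l / (B^k G_{3R})\<close>, and the right side is at most a constant times the average of \<open>f\<close>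
  over \<open>R\<close>, because \<open>R\<close> itself belongs to a point of class \<open>k\<close> and \<open>G_R \<le> B G_{3R}\<close>. Second,
  \<open>G x > l / F x \<ge> B^{k-1} G_{3R}\<close>, so that \<open>maximal_decay\<close> makes the measure of \<open>T k R\<close>
  exponentially small in \<open>k\<close>. The packing estimate sums over \<open>R\<close>, a geometric series over \<open>k\<close>.
\<close>

lemma maximal_product_estimate:
  fixes I :: "'i set"
  assumes I: "finite I"
  shows "\<exists>C>0. \<forall>f g l N. f \<in> borel_measurable lebesgue \<longrightarrow> (\<forall>j\<in>I. g j \<in> borel_measurable lebesgue) \<longrightarrow>
    (\<forall>j\<in>I. \<forall>Q. 0 < snd Q \<longrightarrow> 0 < inf_maximal (g j) Q) \<longrightarrow> norm_Lq1 q u f \<le> ennreal N \<longrightarrow> 0 \<le> N \<longrightarrow> 0 < l \<longrightarrow>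
    (\<integral>\<^sup>+x\<in>{x. ennreal l < HL_maximal f x * (\<Prod>j\<in>I. HL_maximal (g j) x) \<and>
        HL_maximal f x * (\<Prod>j\<in>I. HL_maximal (g j) x) \<le> ennreal (2 * l)}. epowr (HL_maximal f x) q \<partial>\<mu>)
      \<le> ennreal (C * N powr q)"
proof -
  define A where "A = (2 * 9 ^ CARD('n) :: real)"
  obtain \<theta> C0 where \<theta>: "0 \<le> \<theta>" "\<theta> < 1" "0 < C0" and
    decay0: "\<forall>g Q k. g \<in> borel_measurable lebesgue \<longrightarrow> 0 < snd Q \<longrightarrow> 0 < inf_maximal g Q \<longrightarrow> inf_maximal g Q < \<infinity> \<longrightarrow>
     emeasure \<mu> {x \<in> cube Q. ennreal (A ^ k) * inf_maximal g Q < HL_maximal g x} \<le> ennreal (C0 * \<theta> ^ k) * emeasure \<mu> (cube Q)"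
    using maximal_decay unfolding A_def[symmetric] by (elim exE conjE) (rule that)
  have decay: "\<And>g Q k. g \<in> borel_measurable lebesgue \<Longrightarrow> 0 < snd Q \<Longrightarrow> 0 < inf_maximal g Q \<Longrightarrow> inf_maximal g Q < \<infinity> \<Longrightarrow>
     emeasure \<mu> {x \<in> cube Q. ennreal (A ^ k) * inf_maximal g Q < HL_maximal g x} \<le> ennreal (C0 * \<theta> ^ k) * emeasure \<mu> (cube Q)"
    using decay0 by blast
  have A2: "2 \<le> A" using one_le_power[of "9::real" "CARD('n)"] by (simp add: A_def)
  define r where "r = card I"
  \<comment> \<open>If a product of \<open>r\<close> factors exceeds \<open>B^k\<close> times its typical size, then one factor exceeds \<open>A^k\<close>
    times its own. The maximum ensures \<open>B \<ge> 2\<close> when there are no factors at all.\<close>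
  define B where "B = A ^ max 1 r"
  have AB: "A \<le> B" unfolding B_def using A2 by (intro self_le_power) auto
  have ArB: "A ^ r \<le> B" unfolding B_def using A2 by (intro power_increasing) auto
  have B2: "2 \<le> B" using A2 AB by simp
  define K3 where "K3 = (K * 3 ^ CARD('n)) powr q"
  have K3: "0 \<le> K3" by (simp add: K3_def)
  \<comment> \<open>The proportion of \<open>3 R\<close> that class \<open>k\<close> can occupy: everything for \<open>k = 0\<close>, and for \<open>k > 0\<close> one
    decay bound for each of the \<open>r\<close> factors.\<close>
  define \<psi> where "\<psi> k = (if k = 0 then 1 else real r * (C0 * \<theta> ^ (k - 1)))" for k :: nat
  have \<psi>0: "0 \<le> \<psi> k" for k using \<theta> by (simp add: \<psi>_def)
  have "summable (\<lambda>k. \<psi> (Suc k))"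
    unfolding \<psi>_def using \<theta> by (auto intro!: summable_mult summable_geometric)
  then have \<psi>s: "summable \<psi>" by (simp add: summable_Suc_iff)
  define c where "c k = ((2 * B\<^sup>2) powr q * K3 * K powr q) * \<psi> k" for k
  have c0: "0 \<le> c k" for k using K3 \<psi>0 by (simp add: c_def)
  have cs: "summable c" unfolding c_def using \<psi>s by (rule summable_mult)
  define C where "C = suminf c + 1"
  have C: "0 < C" using suminf_nonneg[OF cs c0] by (simp add: C_def)
  have "(\<integral>\<^sup>+x\<in>{x. ennreal l < HL_maximal f x * (\<Prod>j\<in>I. HL_maximal (g j) x) \<and>
        HL_maximal f x * (\<Prod>j\<in>I. HL_maximal (g j) x) \<le> ennreal (2 * l)}. epowr (HL_maximal f x) q \<partial>\<mu>)
      \<le> ennreal (C * N powr q)"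
    if f [measurable]: "f \<in> borel_measurable lebesgue" and g: "\<And>j. j \<in> I \<Longrightarrow> g j \<in> borel_measurable lebesgue"
      and gpos: "\<And>j Q. j \<in> I \<Longrightarrow> 0 < snd Q \<Longrightarrow> 0 < inf_maximal (g j) Q"
      and N: "norm_Lq1 q u f \<le> ennreal N" "0 \<le> N" and l: "0 < l" for f g l N
  proof -
    define F where "F = HL_maximal f"
    define G where "G = (\<lambda>x. \<Prod>j\<in>I. HL_maximal (g j) x)"
    define GQ where "GQ = (\<lambda>Q. \<Prod>j\<in>I. inf_maximal (g j) Q)"
    have Fm [measurable]: "F \<in> borel_measurable lebesgue" unfolding F_def by (rule HL_maximal_measurable)
    have Fm' [measurable]: "F \<in> borel_measurable \<mu>" by (simp add: measurable_cong_sets[of \<mu> lebesgue] Fm)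
    have Gm [measurable]: "G \<in> borel_measurable lebesgue" unfolding G_def
      by (intro borel_measurable_prod_ennreal HL_maximal_measurable)
    define D where "D = {x. ennreal l < F x * G x \<and> F x * G x \<le> ennreal (2 * l)}"
    have Dm [measurable]: "D \<in> sets lebesgue"
    proof -
      have "{x \<in> space lebesgue. ennreal l < F x * G x \<and> F x * G x \<le> ennreal (2 * l)} \<in> sets lebesgue" by measurable
      then show ?thesis by (simp add: D_def)
    qed
    have GQ_le: "x \<in> cube Q \<Longrightarrow> GQ Q \<le> G x" for x Q
      unfolding GQ_def G_def by (intro prod_mono_ennreal inf_maximal_le)
    have GQ_anti: "cube Q \<subseteq> cube R \<Longrightarrow> GQ R \<le> GQ Q" for Q R
      unfolding GQ_def by (intro prod_mono_ennreal inf_maximal_antimono)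
    have GQ_pos: "0 < snd Q \<Longrightarrow> 0 < GQ Q" for Q
      unfolding GQ_def using I gpos by (intro prod_ennreal_pos) auto
    have GQ_dil: "GQ Q \<le> ennreal B * GQ (dilate 3 Q)" if Q: "0 < snd Q" for Q
    proof -
      have "GQ Q \<le> (\<Prod>j\<in>I. ennreal A * inf_maximal (g j) (dilate 3 Q))"
        unfolding GQ_def A_def using Q gpos g by (intro prod_mono_ennreal inf_maximal_dilate) auto
      also have "\<dots> = ennreal (A ^ r) * GQ (dilate 3 Q)"
        using A2 by (simp add: prod.distrib GQ_def r_def ennreal_power)
      also have "\<dots> \<le> ennreal B * GQ (dilate 3 Q)" by (intro mult_right_mono ennreal_leI ArB) auto
      finally show ?thesis .
    qed
    have D_fin: "0 < F x" "F x < \<infinity>" "0 < G x" "G x < \<infinity>" if "x \<in> D" for x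
    proof -
      have p: "ennreal l < F x * G x" "F x * G x \<le> ennreal (2 * l)" using that by (auto simp: D_def)
      from p(1) have "0 < F x * G x" by (rule le_less_trans[rotated]) simp
      then show "0 < F x" "0 < G x" by (auto simp: ennreal_zero_less_mult_iff)
      moreover have "F x * G x < top" using p(2) by (rule order_le_less_trans) simp
      ultimately show "F x < \<infinity>" "G x < \<infinity>" by (auto simp: ennreal_mult_less_top)
    qed
    define S where "S k Q = {x \<in> D. x \<in> cube Q \<and> F x < 2 * avg f Q \<and>
       ennreal l < ennreal (B ^ k) * GQ Q * F x \<and> ennreal (B ^ k) * GQ Q * F x \<le> ennreal (B * l)}" for k Q
    define T where "T k R = {x \<in> D. x \<in> cube (dilate 3 R) \<and> ennreal (B ^ k) * GQ (dilate 3 R) * F x \<le> ennreal (B * l)}" for k R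
    define \<F> where "\<F> k = {Q \<in> rat_cubes. S k Q \<noteq> {}}" for k
    have \<F>pos: "0 < snd Q" if "Q \<in> \<F> k" for k Q using that by (auto simp: \<F>_def rat_cubes_def)
    have Fc: "countable (\<F> k)" for k unfolding \<F>_def by (auto intro: countable_subset[OF _ countable_rat_cubes])
    have Sm: "S k Q \<in> sets lebesgue" for k Q
    proof -
      have "{x \<in> space lebesgue. x \<in> D \<and> x \<in> cube Q \<and> F x < 2 * avg f Q \<and>
       ennreal l < ennreal (B ^ k) * GQ Q * F x \<and> ennreal (B ^ k) * GQ Q * F x \<le> ennreal (B * l)} \<in> sets lebesgue"
        by measurable
      then show ?thesis by (simp add: S_def)
    qed
    have Tm: "T k Q \<in> sets lebesgue" for k Q
    proof -
      have "{x \<in> space lebesgue. x \<in> D \<and> x \<in> cube (dilate 3 Q) \<and> ennreal (B ^ k) * GQ (dilate 3 Q) * F x \<le> ennreal (B * l)} \<in> sets lebesgue"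
        by measurable
      then show ?thesis by (simp add: T_def)
    qed
    have cover: "D \<subseteq> (\<Union>k. \<Union>Q\<in>\<F> k. S k Q)"
    proof
      fix x assume x: "x \<in> D"
      obtain \<phi> where \<phi>: "F x = ennreal \<phi>" "0 < \<phi>" using D_fin[OF x] by (cases "F x") auto
      have "ennreal (\<phi> / 2) < HL_maximal f x" using \<phi> unfolding F_def by (simp add: ennreal_less_iff)
      then obtain Q where Q: "Q \<in> rat_cubes" "x \<in> cube Q" "ennreal (\<phi> / 2) < avg f Q" by (auto simp: less_HL_iff_rat)
      have Q0: "0 < snd Q" using Q by (auto simp: rat_cubes_def)
      have "2 * ennreal (\<phi> / 2) < 2 * avg f Q" by (intro ennreal_mult_strict_left_mono Q) auto
      moreover have "2 * ennreal (\<phi> / 2) = ennreal \<phi>" using \<phi> by (simp add: ennreal_mult[symmetric] flip: ennreal_numeral)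
      ultimately have F2: "F x < 2 * avg f Q" using \<phi> by simp
      have "GQ Q < \<infinity>" using GQ_le[OF Q(2)] D_fin(4)[OF x] by (rule order_le_less_trans)
      then obtain \<gamma> where \<gamma>: "GQ Q = ennreal \<gamma>" "0 < \<gamma>" using GQ_pos[OF Q0] by (cases "GQ Q") auto
      have "GQ Q * F x \<le> F x * G x" using mult_right_mono[OF GQ_le[OF Q(2)], of "F x"] by (simp add: ac_simps)
      also have "\<dots> \<le> ennreal (2 * l)" using x by (simp add: D_def)
      finally have "\<gamma> * \<phi> \<le> 2 * l" using \<gamma> \<phi> l by (simp add: ennreal_mult[symmetric])
      also have "\<dots> \<le> B * l" using B2 l by (intro mult_right_mono) auto
      finally obtain k where k: "l < B ^ k * (\<gamma> * \<phi>)" "B ^ k * (\<gamma> * \<phi>) \<le> B * l"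
        using geometric_class[of B "\<gamma> * \<phi>" l] B2 \<gamma> \<phi> l by (metis less_le_trans mult_pos_pos one_less_numeral_iff semiring_norm(76))
      have "ennreal (B ^ k) * GQ Q * F x = ennreal (B ^ k * (\<gamma> * \<phi>))"
        using B2 \<gamma> \<phi> by (simp add: ennreal_mult ac_simps)
      then have "x \<in> S k Q" using k x Q F2 l B2 by (auto simp: S_def ennreal_less_iff intro!: ennreal_leI)
      moreover from this have "Q \<in> \<F> k" using Q(1) unfolding \<F>_def by blast
      ultimately show "x \<in> (\<Union>k. \<Union>Q\<in>\<F> k. S k Q)" by blast
    qed
    have finR: "\<exists>\<gamma>. GQ (dilate 3 R) = ennreal \<gamma> \<and> 0 < \<gamma>" if R: "R \<in> \<F> k" for R k
    proof -
      obtain x0 where x0: "x0 \<in> S k R" using R by (auto simp: \<F>_def)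
      then have "x0 \<in> D" "x0 \<in> cube (dilate 3 R)"
        using cube_subset_dilate_self[of 3 R] \<F>pos[OF R] by (auto simp: S_def)
      then have "GQ (dilate 3 R) < \<infinity>" using GQ_le D_fin(4) by (meson order_le_less_trans)
      then show ?thesis using GQ_pos[of "dilate 3 R"] \<F>pos[OF R] by (cases "GQ (dilate 3 R)") auto
    qed
    have Tsmall: "emeasure \<mu> (T k R) \<le> ennreal (\<psi> k * K3) * emeasure \<mu> (cube R)" if R: "R \<in> \<F> k" for k R
    proof -
      have R0: "0 < snd R" by (rule \<F>pos[OF R])
      have dbl: "emeasure \<mu> (cube (dilate 3 R)) \<le> ennreal K3 * emeasure \<mu> (cube R)"
        unfolding K3_def by (intro doubling R0) simp
      obtain \<gamma> where \<gamma>: "GQ (dilate 3 R) = ennreal \<gamma>" "0 < \<gamma>" using finR[OF R] by auto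
      have "emeasure \<mu> (T k R) \<le> ennreal (\<psi> k) * emeasure \<mu> (cube (dilate 3 R))"
      proof (cases k)
        case 0
        have "emeasure \<mu> (T k R) \<le> emeasure \<mu> (cube (dilate 3 R))" by (intro emeasure_mono) (auto simp: T_def)
        then show ?thesis by (simp add: 0 \<psi>_def)
      next
        case (Suc k')
        define U where "U j = {x \<in> cube (dilate 3 R). ennreal (A ^ k') * inf_maximal (g j) (dilate 3 R) < HL_maximal (g j) x}" for j
        have Um: "U j \<in> sets \<mu>" for j
        proof -
          have [measurable]: "HL_maximal (g j) \<in> borel_measurable lebesgue" by (rule HL_maximal_measurable)
          have "{x \<in> space lebesgue. x \<in> cube (dilate 3 R) \<and> ennreal (A ^ k') * inf_maximal (g j) (dilate 3 R) < HL_maximal (g j) x} \<in> sets lebesgue"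
            by measurable
          then show ?thesis by (simp add: U_def)
        qed
        \<comment> \<open>Otherwise \<open>G x \<le> B^{k-1} G_{3R}\<close>, and then \<open>F x * G x \<le> l\<close>, which is false on \<open>D\<close>.\<close>
        have sub: "T k R \<subseteq> (\<Union>j\<in>I. U j)"
        proof (rule ccontr)
          assume "\<not> ?thesis"
          then obtain x where x: "x \<in> T k R" "\<And>j. j \<in> I \<Longrightarrow> x \<notin> U j" by blast
          then have xD: "x \<in> D" "x \<in> cube (dilate 3 R)" and xl: "ennreal (B ^ k) * GQ (dilate 3 R) * F x \<le> ennreal (B * l)"
            by (auto simp: T_def)
          obtain \<phi> where \<phi>: "F x = ennreal \<phi>" "0 < \<phi>" using D_fin[OF xD(1)] by (cases "F x") auto
          have "G x \<le> (\<Prod>j\<in>I. ennreal (A ^ k') * inf_maximal (g j) (dilate 3 R))"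
            unfolding G_def using x(2) xD(2) by (intro prod_mono_ennreal) (auto simp: U_def not_less)
          also have "\<dots> = ennreal ((A ^ k') ^ r) * ennreal \<gamma>"
            using A2 \<gamma>(1) by (simp add: prod.distrib r_def ennreal_power GQ_def)
          also have "\<dots> \<le> ennreal (B ^ k') * ennreal \<gamma>"
          proof -
            have "(A ^ k') ^ r = (A ^ r) ^ k'" by (simp add: power_mult[symmetric] mult.commute)
            also have "\<dots> \<le> B ^ k'" using ArB A2 by (intro power_mono) auto
            finally show ?thesis by (intro mult_right_mono ennreal_leI) auto
          qed
          finally have "F x * G x \<le> ennreal \<phi> * (ennreal (B ^ k') * ennreal \<gamma>)"
            unfolding \<phi>(1) by (rule mult_left_mono) simp
          also have "\<dots> = ennreal (B ^ k' * \<gamma> * \<phi>)" using \<phi> \<gamma> B2 by (simp add: ennreal_mult ac_simps)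
          also have "\<dots> \<le> ennreal l"
          proof -
            have "B ^ k * \<gamma> * \<phi> \<le> B * l" using xl \<gamma> \<phi> B2 l by (simp add: ennreal_mult[symmetric])
            then have "B * (B ^ k' * \<gamma> * \<phi>) \<le> B * l" by (simp add: Suc mult.assoc)
            then show ?thesis using B2 by (intro ennreal_leI) simp
          qed
          finally show False using xD(1) unfolding D_def by (simp add: not_less[symmetric])
        qed
        have "emeasure \<mu> (T k R) \<le> emeasure \<mu> (\<Union>j\<in>I. U j)"
          using sub Um I by (intro emeasure_mono sets.finite_UN) auto
        also have "\<dots> \<le> (\<Sum>j\<in>I. emeasure \<mu> (U j))" using Um I by (intro emeasure_subadditive_finite) auto
        also have "\<dots> \<le> (\<Sum>j\<in>I. ennreal (C0 * \<theta> ^ k') * emeasure \<mu> (cube (dilate 3 R)))"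
        proof (rule sum_mono)
          fix j assume j: "j \<in> I"
          have "inf_maximal (g j) (dilate 3 R) < \<infinity>"
            using prod_ennreal_finite_factor[OF I, of "\<lambda>j. inf_maximal (g j) (dilate 3 R)" j] gpos R0 j \<gamma>(1) by (auto simp: GQ_def)
          then show "emeasure \<mu> (U j) \<le> ennreal (C0 * \<theta> ^ k') * emeasure \<mu> (cube (dilate 3 R))"
            unfolding U_def using j g gpos R0 by (intro decay) auto
        qed
        also have "\<dots> = ennreal (\<psi> k) * emeasure \<mu> (cube (dilate 3 R))"
          using \<theta> by (simp add: Suc \<psi>_def r_def ennreal_mult ennreal_of_nat_eq_real_of_nat mult.assoc)
        finally show ?thesis .
      qed
      also have "\<dots> \<le> ennreal (\<psi> k) * (ennreal K3 * emeasure \<mu> (cube R))" by (intro mult_left_mono dbl) simp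
      finally show ?thesis using \<psi>0 K3 by (simp add: ennreal_mult mult.assoc)
    qed
    have FT: "F x \<le> ennreal (2 * B\<^sup>2) * avg f R" if R: "R \<in> \<F> k" and x: "x \<in> T k R" for x k R
    proof -
      obtain x0 where x0: "x0 \<in> S k R" using R by (auto simp: \<F>_def)
      have x0D: "x0 \<in> D" "x0 \<in> cube R" using x0 by (auto simp: S_def)
      have xD: "x \<in> D" using x by (auto simp: T_def)
      obtain \<phi> where \<phi>: "F x = ennreal \<phi>" "0 < \<phi>" using D_fin[OF xD] by (cases "F x") auto
      obtain \<phi>0 where \<phi>0: "F x0 = ennreal \<phi>0" "0 < \<phi>0" using D_fin[OF x0D(1)] by (cases "F x0") auto
      obtain \<gamma> where \<gamma>: "GQ (dilate 3 R) = ennreal \<gamma>" "0 < \<gamma>" using finR[OF R] by auto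
      show ?thesis
      proof (cases "avg f R")
        case top
        then show ?thesis using B2 by (simp add: ennreal_mult_top)
      next
        case (real \<alpha>)
        have "GQ R < \<infinity>" using GQ_le[OF x0D(2)] D_fin(4)[OF x0D(1)] by (rule order_le_less_trans)
        then obtain \<gamma>R where \<gamma>R: "GQ R = ennreal \<gamma>R" "0 < \<gamma>R" using GQ_pos[OF \<F>pos[OF R]] by (cases "GQ R") auto
        have 1: "B ^ k * \<gamma> * \<phi> \<le> B * l"
          using x \<gamma> \<phi> B2 l by (simp add: T_def ennreal_mult[symmetric])
        have 2: "l < B ^ k * \<gamma>R * \<phi>0"
          using x0 \<gamma>R \<phi>0 B2 l by (simp add: S_def ennreal_mult[symmetric] ennreal_less_iff)
        have 3: "\<gamma>R \<le> B * \<gamma>"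
          using GQ_dil[OF \<F>pos[OF R]] \<gamma> \<gamma>R B2 by (simp add: ennreal_mult[symmetric])
        have 4: "\<phi>0 \<le> 2 * \<alpha>"
        proof -
          have "ennreal \<phi>0 < 2 * ennreal \<alpha>" using x0 \<phi>0 real by (simp add: S_def)
          also have "\<dots> = ennreal (2 * \<alpha>)" using real by (simp add: ennreal_mult[symmetric] flip: ennreal_numeral)
          finally show ?thesis using \<phi>0 by (simp add: ennreal_less_iff)
        qed
        have "B ^ k * \<gamma>R * \<phi>0 \<le> B ^ k * (B * \<gamma>) * (2 * \<alpha>)"
          using 3 4 B2 \<gamma> \<gamma>R \<phi>0 by (intro mult_mono) auto
        with 2 have "l \<le> B ^ k * (B * \<gamma>) * (2 * \<alpha>)" by simp
        then have "B * l \<le> B * (B ^ k * (B * \<gamma>) * (2 * \<alpha>))" using B2 by (intro mult_left_mono) auto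
        \<comment> \<open>The factor \<open>B^2\<close> has one power from the width of a class and one from the comparison of \<open>G_R\<close>
          with \<open>G_{3R}\<close>.\<close>
        with 1 have "B ^ k * \<gamma> * \<phi> \<le> B * (B ^ k * (B * \<gamma>) * (2 * \<alpha>))" by simp
        then have "(B ^ k * \<gamma>) * \<phi> \<le> (B ^ k * \<gamma>) * (2 * B\<^sup>2 * \<alpha>)"
          by (simp add: power2_eq_square ac_simps)
        moreover have "0 < B ^ k * \<gamma>" using B2 \<gamma> by simp
        ultimately have "\<phi> \<le> 2 * B\<^sup>2 * \<alpha>" by (rule mult_left_le_imp_le)
        then show ?thesis using \<phi> real B2 by (simp add: ennreal_mult[symmetric] ennreal_leI)
      qed
    qed
    \<comment> \<open>Measuring with \<open>\<rho>\<close> turns the integrals into measures, to which the covering argument applies.\<close>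
    define \<rho> where "\<rho> = density \<mu> (\<lambda>x. epowr (F x) q)"
    have \<rho>s [simp]: "sets \<rho> = sets lebesgue" by (simp add: \<rho>_def)
    have pm: "(\<lambda>x. epowr (F x) q) \<in> borel_measurable \<mu>" by measurable
    have \<rho>T: "emeasure \<rho> (T k R) \<le> ennreal ((2 * B\<^sup>2) powr q * (\<psi> k * K3)) * (epowr (avg f R) q * emeasure \<mu> (cube R))"
      if R: "R \<in> \<F> k" for k R
    proof -
      have "emeasure \<rho> (T k R) = (\<integral>\<^sup>+x. epowr (F x) q * indicator (T k R) x \<partial>\<mu>)"
        unfolding \<rho>_def using pm Tm by (intro emeasure_density) auto
      also have "\<dots> \<le> (\<integral>\<^sup>+x. epowr (ennreal (2 * B\<^sup>2) * avg f R) q * indicator (T k R) x \<partial>\<mu>)"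
        using FT[OF R] q by (intro nn_integral_mono) (auto simp: indicator_def intro!: epowr_mono)
      also have "\<dots> = epowr (ennreal (2 * B\<^sup>2) * avg f R) q * emeasure \<mu> (T k R)"
        using Tm by (intro nn_integral_cmult_indicator) simp
      also have "\<dots> = ennreal ((2 * B\<^sup>2) powr q) * epowr (avg f R) q * emeasure \<mu> (T k R)"
        using B2 by (subst epowr_mult) auto
      also have "\<dots> \<le> ennreal ((2 * B\<^sup>2) powr q) * epowr (avg f R) q * (ennreal (\<psi> k * K3) * emeasure \<mu> (cube R))"
        by (intro mult_left_mono Tsmall R) simp
      finally show ?thesis using \<psi>0 K3 by (simp add: ennreal_mult ac_simps)
    qed
    have class_bound: "emeasure \<rho> (\<Union>Q\<in>\<F> k. S k Q) \<le> ennreal (c k * N powr q)" for k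
    proof (rule vitali_measure[where T = "T k"])
      fix Q R assume QR: "Q \<in> \<F> k" "R \<in> \<F> k" "cube Q \<inter> cube R \<noteq> {}" "snd Q \<le> snd R"
      have sub: "cube Q \<subseteq> cube (dilate 3 R)" by (rule cube_subset_dilate[OF QR(3,4)])
      show "S k Q \<subseteq> T k R"
      proof
        fix x assume x: "x \<in> S k Q"
        have "ennreal (B ^ k) * GQ (dilate 3 R) * F x \<le> ennreal (B ^ k) * GQ Q * F x"
          by (intro mult_right_mono mult_left_mono GQ_anti sub) auto
        then show "x \<in> T k R" using x sub by (auto simp: S_def T_def intro: order_trans)
      qed
    next
      fix J assume J: "finite J" "J \<subseteq> \<F> k" "disjoint_family_on cube J"
      have "(\<Sum>R\<in>J. emeasure \<rho> (T k R)) \<le> (\<Sum>R\<in>J. ennreal ((2 * B\<^sup>2) powr q * (\<psi> k * K3)) * (epowr (avg f R) q * emeasure \<mu> (cube R)))"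
        using J by (intro sum_mono \<rho>T) auto
      also have "\<dots> = ennreal ((2 * B\<^sup>2) powr q * (\<psi> k * K3)) * (\<Sum>R\<in>J. epowr (avg f R) q * emeasure \<mu> (cube R))"
        by (simp add: sum_distrib_left)
      also have "\<dots> \<le> ennreal ((2 * B\<^sup>2) powr q * (\<psi> k * K3)) * ennreal ((K * N) powr q)"
        using J \<F>pos by (intro mult_left_mono packing[OF f N]) auto
      also have "\<dots> = ennreal (c k * N powr q)"
        using \<psi>0 K3 K N by (simp add: c_def ennreal_mult[symmetric] powr_mult ac_simps)
      finally show "(\<Sum>R\<in>J. emeasure \<rho> (T k R)) \<le> ennreal (c k * N powr q)" .
    qed (auto simp: Fc \<F>pos Sm Tm)
    have UNm: "(\<Union>Q\<in>\<F> k. S k Q) \<in> sets \<rho>" for k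
      using Sm Fc by (intro sets.countable_UN') auto
    have "(\<integral>\<^sup>+x\<in>D. epowr (F x) q \<partial>\<mu>) = emeasure \<rho> D"
      unfolding \<rho>_def using pm Dm by (intro emeasure_density[symmetric]) auto
    also have "\<dots> \<le> emeasure \<rho> (\<Union>k. \<Union>Q\<in>\<F> k. S k Q)"
      using UNm by (intro emeasure_mono cover) auto
    also have "\<dots> \<le> (\<Sum>k. emeasure \<rho> (\<Union>Q\<in>\<F> k. S k Q))"
      using UNm by (intro emeasure_subadditive_countably) auto
    also have "\<dots> \<le> (\<Sum>k. ennreal (c k * N powr q))"
      by (intro suminf_le class_bound) auto
    also have "\<dots> = ennreal (\<Sum>k. c k * N powr q)"
      using c0 cs by (intro suminf_ennreal2) (auto intro: summable_mult2)
    also have "(\<Sum>k. c k * N powr q) = suminf c * N powr q"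
      by (rule suminf_mult2[OF cs, symmetric])
    also have "ennreal (suminf c * N powr q) \<le> ennreal (C * N powr q)"
      by (intro ennreal_leI mult_right_mono) (auto simp: C_def)
    finally show ?thesis by (simp add: D_def F_def G_def)
  qed
  then show ?thesis
    by (intro exI[of _ C] conjI allI impI) (use C in \<open>simp_all del: split_paired_All\<close>)
qed

end

section \<open>Combining the factors\<close>

lemma weighted_arith_geom_mean:
  fixes x \<theta> :: "'i \<Rightarrow> real"
  assumes "finite I" "\<And>i. i \<in> I \<Longrightarrow> 0 < x i" "\<And>i. i \<in> I \<Longrightarrow> 0 \<le> \<theta> i" "(\<Sum>i\<in>I. \<theta> i) = 1"
  shows "(\<Prod>i\<in>I. x i powr \<theta> i) \<le> (\<Sum>i\<in>I. \<theta> i * x i)"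
proof -
  have "I \<noteq> {}" using assms(4) by auto
  have x0: "x i \<noteq> 0" if "i \<in> I" for i using assms(2)[OF that] by simp
  have "(\<Prod>i\<in>I. x i powr \<theta> i) = exp (\<Sum>i\<in>I. \<theta> i *\<^sub>R ln (x i))"
    unfolding exp_sum[OF assms(1)] by (intro prod.cong) (auto simp: powr_def x0)
  also have "\<dots> \<le> (\<Sum>i\<in>I. \<theta> i * exp (ln (x i)))"
    using assms \<open>I \<noteq> {}\<close> by (intro convex_on_sum[OF _ _ exp_convex]) auto
  also have "\<dots> = (\<Sum>i\<in>I. \<theta> i * x i)" using assms(2) by (intro sum.cong) auto
  finally show ?thesis .
qed

text \<open>
  Hoelder's inequality with the exponents \<open>p i / P\<close> for the functions \<open>w i (F i)^{p i}\<close>. Bounds \<open>Y i\<close> for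
  their integrals are given, and so the pointwise inequality between weighted geometric and
  arithmetic means of \<open>w i (F i)^{p i} / Y i\<close> can be integrated directly.
\<close>

lemma product_weight_slice:
  fixes w :: "'i \<Rightarrow> real ^ 'n \<Rightarrow> real" and F :: "'i \<Rightarrow> real ^ 'n \<Rightarrow> ennreal"
  assumes I: "finite I" and p: "\<And>i. i \<in> I \<Longrightarrow> 0 < p i" and P: "0 < P" "(\<Sum>i\<in>I. P / p i) = 1"
    and w: "\<And>i. i \<in> I \<Longrightarrow> weight (w i)" and F: "\<And>i. i \<in> I \<Longrightarrow> F i \<in> borel_measurable lebesgue"
    and D: "D \<in> sets lebesgue" and l: "0 < l"
    and FD: "\<And>x. x \<in> D \<Longrightarrow> ennreal l < (\<Prod>i\<in>I. F i x)" "\<And>x. x \<in> D \<Longrightarrow> (\<Prod>i\<in>I. F i x) < \<infinity>"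
    and Y: "\<And>i. i \<in> I \<Longrightarrow> 0 < Y i"
      "\<And>i. i \<in> I \<Longrightarrow> (\<integral>\<^sup>+x\<in>D. epowr (F i x) (p i) \<partial>wmeasure (w i)) \<le> ennreal (Y i)"
  shows "emeasure (wmeasure (\<lambda>x. \<Prod>i\<in>I. w i x powr (P / p i))) D \<le> ennreal ((\<Prod>i\<in>I. Y i powr (P / p i)) / l powr P)"
proof -
  define \<theta> where "\<theta> i = P / p i" for i
  have \<theta>: "0 \<le> \<theta> i" "p i * \<theta> i = P" if "i \<in> I" for i using p[OF that] P by (auto simp: \<theta>_def)
  have \<theta>sum: "(\<Sum>i\<in>I. \<theta> i) = 1" using P by (simp add: \<theta>_def)
  define \<nu> where "\<nu> = (\<lambda>x. \<Prod>i\<in>I. w i x powr \<theta> i)"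
  define Z where "Z = (\<Prod>i\<in>I. Y i powr \<theta> i)"
  have Z: "0 < Z" unfolding Z_def using Y(1) by (intro prod_pos) (simp add: less_imp_neq[symmetric])
  define c where "c = l powr P"
  have c: "0 < c" using l by (simp add: c_def)
  have wm [measurable]: "w i \<in> borel_measurable lebesgue" if "i \<in> I" for i using w[OF that] by (simp add: weight_def)
  have \<nu>m [measurable]: "\<nu> \<in> borel_measurable lebesgue"
    unfolding \<nu>_def by (intro borel_measurable_prod powr_real_measurable wm) auto
  have pm: "(\<lambda>x. epowr (F i x) (p i)) \<in> borel_measurable lebesgue" if "i \<in> I" for i
    using F[OF that] by measurable
  define R where "R i x = ennreal (w i x) * (epowr (F i x) (p i) * indicator D x)" for i x
  have Rm: "R i \<in> borel_measurable lebesgue" if "i \<in> I" for i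
    unfolding R_def using pm[OF that] wm[OF that] D by measurable
  have Rint: "(\<integral>\<^sup>+x. R i x \<partial>lebesgue) \<le> ennreal (Y i)" if i: "i \<in> I" for i
  proof -
    have "(\<integral>\<^sup>+x. R i x \<partial>lebesgue) = (\<integral>\<^sup>+x\<in>D. epowr (F i x) (p i) \<partial>wmeasure (w i))"
      unfolding R_def wmeasure_def using pm[OF i] wm[OF i] D by (subst nn_integral_density) auto
    then show ?thesis using Y(2)[OF i] by simp
  qed
  have pt: "\<nu> x \<le> (Z / c) * (\<Sum>i\<in>I. (\<theta> i / Y i) * (w i x * enn2real (F i x) powr p i))"
    if x: "x \<in> D" and wx: "\<forall>i\<in>I. 0 < w i x" for x
  proof -
    have "0 < (\<Prod>i\<in>I. F i x)" using FD(1)[OF x] by (rule le_less_trans[rotated]) simp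
    then have Fpos: "0 < F i x" if "i \<in> I" for i using that by (simp add: prod_ennreal_pos_iff[OF I])
    have Ffin: "F i x < \<infinity>" if "i \<in> I" for i
      using prod_ennreal_finite_factor[OF I _ FD(2)[OF x] that] Fpos by blast
    define h where "h i = enn2real (F i x)" for i
    have h: "F i x = ennreal (h i)" "0 < h i" if "i \<in> I" for i
      using Fpos[OF that] Ffin[OF that] by (auto simp: h_def enn2real_positive_iff)
    have "(\<Prod>i\<in>I. F i x) = ennreal (\<Prod>i\<in>I. h i)"
      using h by (subst prod_ennreal[symmetric]) (auto intro!: prod.cong less_imp_le)
    then have hl: "l \<le> (\<Prod>i\<in>I. h i)" using FD(1)[OF x] l by (simp add: ennreal_less_iff)
    have "c \<le> (\<Prod>i\<in>I. h i) powr P" unfolding c_def using hl l P by (intro powr_mono2) auto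
    also have "\<dots> = (\<Prod>i\<in>I. h i powr P)" using h by (simp add: prod_powr_distrib less_imp_le)
    finally have ch: "c \<le> (\<Prod>i\<in>I. h i powr P)" .
    have \<nu>0: "0 \<le> \<nu> x" by (simp add: \<nu>_def prod_nonneg)
    have "\<nu> x * c / Z \<le> \<nu> x * (\<Prod>i\<in>I. h i powr P) / Z"
      using ch \<nu>0 Z by (intro divide_right_mono mult_left_mono) auto
    also have "\<dots> = (\<Prod>i\<in>I. (w i x * h i powr p i / Y i) powr \<theta> i)"
    proof -
      have "(w i x * h i powr p i / Y i) powr \<theta> i = w i x powr \<theta> i * h i powr P / Y i powr \<theta> i" if i: "i \<in> I" for i
        using wx Y(1)[OF i] h[OF i] i \<theta>(2)[OF i] by (simp add: powr_divide powr_mult powr_powr)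
      then show ?thesis by (simp add: \<nu>_def Z_def prod_dividef prod.distrib)
    qed
    also have "\<dots> \<le> (\<Sum>i\<in>I. \<theta> i * (w i x * h i powr p i / Y i))"
    proof (rule weighted_arith_geom_mean[OF I])
      fix i assume i: "i \<in> I"
      have "0 < h i powr p i" using h(2)[OF i] by simp
      then show "0 < w i x * h i powr p i / Y i" using wx Y(1)[OF i] i by simp
    qed (use \<theta> \<theta>sum in auto)
    finally have "\<nu> x * c / Z \<le> (\<Sum>i\<in>I. (\<theta> i / Y i) * (w i x * h i powr p i))" by simp
    then have "(Z / c) * (\<nu> x * c / Z) \<le> (Z / c) * (\<Sum>i\<in>I. (\<theta> i / Y i) * (w i x * h i powr p i))"
      using Z c by (intro mult_left_mono) auto
    then show ?thesis using Z c by (simp add: h_def)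
  qed
  have "emeasure (wmeasure \<nu>) D = (\<integral>\<^sup>+x. ennreal (\<nu> x) * indicator D x \<partial>lebesgue)"
    unfolding wmeasure_def using D by (intro emeasure_density) auto
  also have "\<dots> \<le> (\<integral>\<^sup>+x. ennreal (Z / c) * (\<Sum>i\<in>I. ennreal (\<theta> i / Y i) * R i x) \<partial>lebesgue)"
  proof (rule nn_integral_mono_AE)
    have "AE x in lebesgue. \<forall>i\<in>I. 0 < w i x"
      using w I by (intro AE_finite_allI) (auto simp: weight_def)
    then show "AE x in lebesgue. ennreal (\<nu> x) * indicator D x \<le> ennreal (Z / c) * (\<Sum>i\<in>I. ennreal (\<theta> i / Y i) * R i x)"
    proof eventually_elim
      case (elim x)
      show ?case
      proof (cases "x \<in> D")
        case True
        have pos: "0 < (\<Prod>i\<in>I. F i x)" using FD(1)[OF True] by (rule le_less_trans[rotated]) simp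
        have Fe: "F i x = ennreal (enn2real (F i x))" if "i \<in> I" for i
          using prod_ennreal_finite_factor[OF I _ FD(2)[OF True] that] pos by (simp add: prod_ennreal_pos_iff[OF I])
        have Re: "R i x = ennreal (w i x * enn2real (F i x) powr p i)" if "i \<in> I" for i
          unfolding R_def using True elim that by (subst Fe[OF that]) (simp add: epowr_ennreal ennreal_mult less_imp_le)
        have "ennreal (\<nu> x) \<le> ennreal ((Z / c) * (\<Sum>i\<in>I. (\<theta> i / Y i) * (w i x * enn2real (F i x) powr p i)))"
          by (intro ennreal_leI pt True elim)
        also have "\<dots> = ennreal (Z / c) * ennreal (\<Sum>i\<in>I. (\<theta> i / Y i) * (w i x * enn2real (F i x) powr p i))"
          using Z c by (intro ennreal_mult sum_nonneg) (use \<theta> Y(1) elim in \<open>auto simp: less_imp_le\<close>)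
        also have "ennreal (\<Sum>i\<in>I. (\<theta> i / Y i) * (w i x * enn2real (F i x) powr p i)) = (\<Sum>i\<in>I. ennreal (\<theta> i / Y i) * R i x)"
          using \<theta> Y(1) elim
          by (subst sum_ennreal[symmetric]) (auto intro!: sum.cong simp: Re less_imp_le ennreal_mult simp del: times_divide_eq_left)
        finally show ?thesis using True by simp
      qed simp
    qed
  qed
  also have "\<dots> = ennreal (Z / c) * (\<Sum>i\<in>I. ennreal (\<theta> i / Y i) * (\<integral>\<^sup>+x. R i x \<partial>lebesgue))"
    using Rm by (subst nn_integral_cmult) (auto simp: nn_integral_sum nn_integral_cmult)
  also have "\<dots> \<le> ennreal (Z / c) * (\<Sum>i\<in>I. ennreal (\<theta> i / Y i) * ennreal (Y i))"
    by (intro mult_left_mono sum_mono Rint) auto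
  also have "(\<Sum>i\<in>I. ennreal (\<theta> i / Y i) * ennreal (Y i)) = ennreal (\<Sum>i\<in>I. \<theta> i)"
    using \<theta>(1) Y(1) by (subst sum_ennreal[symmetric])
      (auto intro!: sum.cong simp: ennreal_mult[symmetric] less_imp_le less_imp_neq[symmetric])
  finally show ?thesis using \<theta>sum by (simp add: \<nu>_def \<theta>_def Z_def c_def)
qed

text \<open>
  If some \<open>f i\<close> vanishes almost everywhere, then its maximal function and hence the left side
  vanish. Otherwise all norms on the right are positive; if one of them is infinite, so is the
  product. In the remaining case the level set \<open>{H > y}\<close> is covered by the slices at heights
  \<open>2^s y\<close> and the set where some maximal function is infinite, which is a null set.
\<close>

theorem theorem4p1:
  fixes m :: nat and p :: "nat \<Rightarrow> real" and P :: real
    and w :: "nat \<Rightarrow> real ^ 'n \<Rightarrow> real" and \<nu> :: "real ^ 'n \<Rightarrow> real"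
  assumes "1 \<le> m"
    and "\<And>i. i \<in> {1..m} \<Longrightarrow> 1 \<le> p i"
    and "1 / P = (\<Sum>i=1..m. 1 / p i)"
    and "\<And>i. i \<in> {1..m} \<Longrightarrow> weight (w i)"
    and "\<And>i. i \<in> {1..m} \<Longrightarrow> w i \<in> AR_class (p i)"
    and "\<nu> = (\<lambda>x. \<Prod>i=1..m. w i x powr (P / p i))"
  shows "\<exists>C>0. \<forall>f :: nat \<Rightarrow> real ^ 'n \<Rightarrow> complex.
           (\<forall>i\<in>{1..m}. f i \<in> borel_measurable lebesgue) \<longrightarrow>
           norm_Lqinf (ereal P) \<nu> (HL_maximal_prod m f)
             \<le> ennreal C * (\<Prod>i=1..m. norm_Lq1 (p i) (w i) (modulus (f i)))"
proof -
  let ?I = "{1..m}"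
  have p0: "0 < p i" if "i \<in> ?I" for i using assms(2)[OF that] by simp
  have "0 < (\<Sum>i=1..m. 1 / p i)" using assms(1) p0 by (intro sum_pos) auto
  then have P: "0 < P" using assms(3) by (metis zero_less_divide_1_iff)
  have \<theta>sum: "(\<Sum>i=1..m. P / p i) = 1"
  proof -
    have "(\<Sum>i=1..m. P / p i) = P * (\<Sum>i=1..m. 1 / p i)" by (simp add: sum_distrib_left)
    also have "\<dots> = 1" using P by (simp only: assms(3)[symmetric]) simp
    finally show ?thesis .
  qed
  have "\<exists>K. restricted_weight (w i) (p i) K" if "i \<in> ?I" for i
    by (rule AR_class_restricted_weight[OF assms(2,5)[OF that]])
  then obtain K where K: "\<And>i. i \<in> ?I \<Longrightarrow> restricted_weight (w i) (p i) (K i)" by metis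
  define Est where "Est i c \<longleftrightarrow> 0 < c \<and> (\<forall>f g l N. f \<in> borel_measurable lebesgue \<longrightarrow> (\<forall>j\<in>?I - {i}. g j \<in> borel_measurable lebesgue) \<longrightarrow>
    (\<forall>j\<in>?I - {i}. \<forall>Q. 0 < snd Q \<longrightarrow> 0 < inf_maximal (g j) Q) \<longrightarrow> norm_Lq1 (p i) (w i) f \<le> ennreal N \<longrightarrow> 0 \<le> N \<longrightarrow> 0 < l \<longrightarrow>
    (\<integral>\<^sup>+x\<in>{x. ennreal l < HL_maximal f x * (\<Prod>j\<in>?I - {i}. HL_maximal (g j) x) \<and>
        HL_maximal f x * (\<Prod>j\<in>?I - {i}. HL_maximal (g j) x) \<le> ennreal (2 * l)}. epowr (HL_maximal f x) (p i) \<partial>wmeasure (w i))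
      \<le> ennreal (c * N powr p i))" for i c
  have "\<exists>c. Est i c" if "i \<in> ?I" for i
    unfolding Est_def by (rule restricted_weight.maximal_product_estimate[OF K[OF that]]) simp
  then have "\<forall>i\<in>?I. \<exists>c. Est i c" by blast
  from bchoice[OF this] obtain C where Est: "\<forall>i\<in>?I. Est i (C i)" by blast
  have C: "0 < C i" if "i \<in> ?I" for i
    using Est that by (simp add: Est_def)
  have est: "(\<integral>\<^sup>+x\<in>{x. ennreal l < HL_maximal f x * (\<Prod>j\<in>?I - {i}. HL_maximal (g j) x) \<and>
        HL_maximal f x * (\<Prod>j\<in>?I - {i}. HL_maximal (g j) x) \<le> ennreal (2 * l)}. epowr (HL_maximal f x) (p i) \<partial>wmeasure (w i)) \<le> ennreal (C i * N powr p i)"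
    if "i \<in> ?I" "f \<in> borel_measurable lebesgue" "\<forall>j\<in>?I - {i}. g j \<in> borel_measurable lebesgue"
      "\<forall>j\<in>?I - {i}. \<forall>Q. 0 < snd Q \<longrightarrow> 0 < inf_maximal (g j) Q" "norm_Lq1 (p i) (w i) f \<le> ennreal N" "0 \<le> N" "0 < l" for i f g l N
    using bspec[OF Est that(1), unfolded Est_def, THEN conjunct2, rule_format, OF that(2) _ _ that(5-7), of g] that(3,4) by blast
  \<comment> \<open>The slice at height \<open>2^s y\<close> contributes \<open>a^s\<close> times the bound for the first one.\<close>
  define a where "a = 2 powr (- P)"
  have a: "0 < a" "a < 1" using P by (auto simp: a_def powr_less_one)
  define S where "S = 1 / (1 - a)"
  have S: "0 < S" using a by (simp add: S_def)
  define C' where "C' = S powr (1 / P) * (\<Prod>i=1..m. C i powr (1 / p i))"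
  have C': "0 < C'" unfolding C'_def using S C
    by (intro mult_pos_pos prod_pos) (auto simp: less_imp_neq[symmetric])
  have "norm_Lqinf (ereal P) \<nu> (HL_maximal_prod m f) \<le> ennreal C' * (\<Prod>i=1..m. norm_Lq1 (p i) (w i) (modulus (f i)))"
    if fm: "\<And>i. i \<in> ?I \<Longrightarrow> f i \<in> borel_measurable lebesgue" for f :: "nat \<Rightarrow> real ^ 'n \<Rightarrow> complex"
  proof -
    define g where "g i = modulus (f i)" for i
    have gm: "g i \<in> borel_measurable lebesgue" if "i \<in> ?I" for i unfolding g_def using fm[OF that] by measurable
    define F where "F i = HL_maximal (g i)" for i
    have Fm: "F i \<in> borel_measurable lebesgue" for i unfolding F_def by (rule HL_maximal_measurable)
    define H where "H x = (\<Prod>i=1..m. F i x)" for x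
    have H: "HL_maximal_prod m f = H" by (simp add: fun_eq_iff HL_maximal_prod_def H_def F_def g_def)
    have Hm [measurable]: "H \<in> borel_measurable lebesgue" unfolding H_def by (intro borel_measurable_prod_ennreal Fm)
    have norm_eq: "norm_Lqinf (ereal P) \<nu> H = (SUP y\<in>{0<..}. ennreal y * epowr (emeasure (wmeasure \<nu>) {x. ennreal y < H x}) (1 / P))"
      by (simp add: norm_Lqinf_def distr_fun_def)
    show ?thesis
    proof (cases "\<exists>i\<in>?I. \<forall>Q. 0 < snd Q \<longrightarrow> avg (g i) Q = 0")
      case True
      then obtain i where i: "i \<in> ?I" "\<And>Q. 0 < snd Q \<Longrightarrow> avg (g i) Q = 0" by auto
      have "F i x = 0" for x unfolding F_def using i(2) less_HL_iff[of 0 "g i" x] by (auto simp: zero_less_iff_neq_zero)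
      then have "H x = 0" for x unfolding H_def using i(1) by (intro prod_zero bexI[of _ i]) auto
      then show ?thesis unfolding H norm_eq using P by (simp add: epowr_def)
    next
      case False
      then have Q0: "\<exists>Q. 0 < snd Q \<and> 0 < avg (g i) Q" if "i \<in> ?I" for i using that by (auto simp: zero_less_iff_neq_zero)
      have ipos: "0 < inf_maximal (g i) Q" if "i \<in> ?I" "0 < snd Q" for i Q using Q0[OF that(1)] that(2) inf_maximal_pos by blast
      have npos: "0 < norm_Lq1 (p i) (w i) (g i)" if "i \<in> ?I" for i
        using Q0[OF that] restricted_weight.norm_pos[OF K[OF that] gm[OF that]] by blast
      show ?thesis
      proof (cases "\<exists>i\<in>?I. norm_Lq1 (p i) (w i) (g i) = \<infinity>")
        case True
        then obtain i where i: "i \<in> ?I" "norm_Lq1 (p i) (w i) (g i) = \<infinity>" by auto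
        have "(\<Prod>i=1..m. norm_Lq1 (p i) (w i) (g i)) = \<infinity>"
        proof (rule ccontr)
          assume "\<not> ?thesis"
          then show False using prod_ennreal_finite_factor[of ?I "\<lambda>i. norm_Lq1 (p i) (w i) (g i)" i] npos i by (simp add: less_top)
        qed
        then show ?thesis using C' by (simp add: g_def ennreal_mult_top)
      next
        case False
        define N where "N i = enn2real (norm_Lq1 (p i) (w i) (g i))" for i
        have N: "norm_Lq1 (p i) (w i) (g i) = ennreal (N i)" "0 < N i" if "i \<in> ?I" for i
          using False npos[OF that] that by (auto simp: N_def enn2real_positive_iff less_top)
        define Y where "Y i = C i * N i powr p i" for i
        have Y: "0 < Y i" if "i \<in> ?I" for i using C[OF that] N[OF that] by (simp add: Y_def)
        define Z where "Z = (\<Prod>i=1..m. Y i powr (P / p i))"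
        have Z: "0 < Z" unfolding Z_def using Y by (intro prod_pos) (simp add: less_imp_neq[symmetric])
        define E where "E l = {x. ennreal l < H x \<and> H x \<le> ennreal (2 * l)}" for l
        have Em: "E l \<in> sets lebesgue" for l
        proof -
          have "{x \<in> space lebesgue. ennreal l < H x \<and> H x \<le> ennreal (2 * l)} \<in> sets lebesgue" by measurable
          then show ?thesis by (simp add: E_def)
        qed
        have slice: "emeasure (wmeasure \<nu>) (E l) \<le> ennreal (Z / l powr P)" if l: "0 < l" for l
          unfolding assms(6) Z_def
        proof (rule product_weight_slice[where F = F])
          fix i assume i: "i \<in> ?I"
          have "H x = F i x * (\<Prod>j\<in>?I - {i}. F j x)" for x unfolding H_def using i by (intro prod.remove) auto
          then show "(\<integral>\<^sup>+x\<in>E l. epowr (F i x) (p i) \<partial>wmeasure (w i)) \<le> ennreal (Y i)"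
            using est[OF i gm[OF i], of g "N i" l] gm ipos N[OF i] l by (simp add: E_def F_def Y_def)
        next
          fix x assume "x \<in> E l"
          then show "ennreal l < (\<Prod>i=1..m. F i x)" "(\<Prod>i=1..m. F i x) < \<infinity>"
            by (auto simp: E_def H_def intro: order_le_less_trans)
        qed (use p0 P \<theta>sum assms(4) Fm Em l Y in auto)
        have inf0: "emeasure (wmeasure \<nu>) (\<Union>i\<in>?I. {x. F i x = \<infinity>}) = 0"
        proof -
          have s: "{x. F i x = \<infinity>} \<in> sets lebesgue" for i
            using measurable_sets[OF Fm[of i], of "{\<infinity>}"] by (simp add: vimage_def)
          have "{x. F i x = \<infinity>} \<in> null_sets lebesgue" if "i \<in> ?I" for i
            using restricted_weight.HL_maximal_finite_AE[OF K[OF that] gm[OF that], of "N i"] N[OF that] s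
            by (auto simp: F_def)
          then have n: "(\<Union>i\<in>?I. {x. F i x = \<infinity>}) \<in> null_sets lebesgue" by (intro null_sets.finite_UN) auto
          have "\<nu> \<in> borel_measurable lebesgue"
            unfolding assms(6) using assms(4) by (intro borel_measurable_prod powr_real_measurable) (auto simp: weight_def)
          then have "(\<Union>i\<in>?I. {x. F i x = \<infinity>}) \<in> null_sets (wmeasure \<nu>)"
            unfolding wmeasure_def using n AE_not_in[OF n]
            by (subst null_sets_density_iff) (auto elim!: eventually_mono simp del: UN_iff)
          then show ?thesis by auto
        qed
        have level: "emeasure (wmeasure \<nu>) {x. ennreal y < H x} \<le> ennreal (S * Z / y powr P)" if y: "0 < y" for y
        proof -
          have sub: "{x. ennreal y < H x} \<subseteq> (\<Union>s. E (y * 2 ^ s)) \<union> (\<Union>i\<in>?I. {x. F i x = \<infinity>})"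
          proof
            fix x assume "x \<in> {x. ennreal y < H x}"
            then have x: "ennreal y < H x" by simp
            show "x \<in> (\<Union>s. E (y * 2 ^ s)) \<union> (\<Union>i\<in>?I. {x. F i x = \<infinity>})"
            proof (cases "H x")
              case top
              have "\<exists>i\<in>?I. F i x = \<infinity>"
              proof (rule ccontr)
                assume "\<not> ?thesis"
                then have "F i x = ennreal (enn2real (F i x))" if "i \<in> ?I" for i using that by (simp add: less_top)
                then have "H x = (\<Prod>i=1..m. ennreal (enn2real (F i x)))" unfolding H_def by (intro prod.cong) auto
                then show False using top by (simp add: prod_ennreal)
              qed
              then show ?thesis by blast
            next
              case (real h)
              have yh: "y < h" using x real y by (simp add: ennreal_less_iff)
              define s where "s = (LEAST s. h \<le> 2 * (y * 2 ^ s))"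
              obtain s0 where "h / y < 2 ^ s0" using real_arch_pow[of 2 "h / y"] by auto
              then have "h < y * 2 ^ s0" using y by (simp add: field_simps)
              then have "h \<le> 2 * (y * 2 ^ s0)" using y yh by linarith
              then have s1: "h \<le> 2 * (y * 2 ^ s)" unfolding s_def by (rule LeastI)
              have s2: "y * 2 ^ s < h"
              proof (cases s)
                case 0
                then show ?thesis using yh by simp
              next
                case (Suc s')
                then have "\<not> h \<le> 2 * (y * 2 ^ s')" unfolding s_def by (metis lessI not_less_Least)
                then show ?thesis by (simp add: Suc)
              qed
              have "x \<in> E (y * 2 ^ s)" using s1 s2 real y by (auto simp: E_def ennreal_less_iff intro!: ennreal_leI)
              then show ?thesis by blast
            qed
          qed
          have infm: "(\<Union>i\<in>?I. {x. F i x = \<infinity>}) \<in> sets lebesgue"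
            using measurable_sets[OF Fm, of "{\<infinity>}"] by (intro sets.finite_UN) (auto simp: vimage_def)
          have "emeasure (wmeasure \<nu>) {x. ennreal y < H x} \<le> emeasure (wmeasure \<nu>) ((\<Union>s. E (y * 2 ^ s)) \<union> (\<Union>i\<in>?I. {x. F i x = \<infinity>}))"
            using Em infm by (intro emeasure_mono[OF sub]) auto
          also have "\<dots> \<le> emeasure (wmeasure \<nu>) (\<Union>s. E (y * 2 ^ s)) + emeasure (wmeasure \<nu>) (\<Union>i\<in>?I. {x. F i x = \<infinity>})"
            using Em infm by (intro emeasure_subadditive) auto
          also have "\<dots> \<le> (\<Sum>s. emeasure (wmeasure \<nu>) (E (y * 2 ^ s)))"
            unfolding inf0 using Em by (auto intro!: emeasure_subadditive_countably)
          also have "\<dots> \<le> (\<Sum>s. ennreal (Z / y powr P * a ^ s))"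
          proof (intro suminf_le)
            fix s :: nat
            have "emeasure (wmeasure \<nu>) (E (y * 2 ^ s)) \<le> ennreal (Z / (y * 2 ^ s) powr P)" using y by (intro slice) auto
            also have "Z / (y * 2 ^ s) powr P = Z / y powr P * a ^ s"
            proof -
              have "(2 ^ s) powr P = (2 powr P) ^ s" by (simp add: powr_power powr_realpow[symmetric] powr_powr mult.commute)
              then show ?thesis using y by (simp add: powr_mult a_def powr_minus power_inverse divide_inverse)
            qed
            finally show "emeasure (wmeasure \<nu>) (E (y * 2 ^ s)) \<le> ennreal (Z / y powr P * a ^ s)" .
          qed auto
          also have "\<dots> = ennreal (\<Sum>s. Z / y powr P * a ^ s)"
            using Z a by (intro suminf_ennreal2) (auto intro!: summable_mult summable_geometric)
          also have "(\<Sum>s. Z / y powr P * a ^ s) = S * Z / y powr P"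
            using a by (subst suminf_mult) (auto simp: suminf_geometric S_def intro!: summable_geometric)
          finally show ?thesis .
        qed
        have "norm_Lqinf (ereal P) \<nu> H \<le> ennreal ((S * Z) powr (1 / P))"
          unfolding norm_eq
        proof (rule SUP_least)
          fix y :: real assume "y \<in> {0<..}"
          then have y: "0 < y" by simp
          have "ennreal y * epowr (emeasure (wmeasure \<nu>) {x. ennreal y < H x}) (1 / P) \<le> ennreal y * epowr (ennreal (S * Z / y powr P)) (1 / P)"
            using P by (intro mult_left_mono epowr_mono level y) auto
          also have "\<dots> = ennreal (y * (S * Z / y powr P) powr (1 / P))"
            using S Z y by (simp add: epowr_ennreal ennreal_mult)
          also have "y * (S * Z / y powr P) powr (1 / P) = (S * Z) powr (1 / P)"
            using S Z y P by (simp add: powr_divide powr_powr)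
          finally show "ennreal y * epowr (emeasure (wmeasure \<nu>) {x. ennreal y < H x}) (1 / P) \<le> ennreal ((S * Z) powr (1 / P))" .
        qed
        also have "(S * Z) powr (1 / P) = C' * (\<Prod>i=1..m. N i)"
        proof -
          have "Z powr (1 / P) = (\<Prod>i=1..m. (Y i powr (P / p i)) powr (1 / P))"
            unfolding Z_def by (rule prod_powr_distrib)
          also have "\<dots> = (\<Prod>i=1..m. C i powr (1 / p i) * N i)"
          proof (rule prod.cong)
            fix i assume i: "i \<in> ?I"
            have "(Y i powr (P / p i)) powr (1 / P) = Y i powr (1 / p i)" using P by (simp add: powr_powr)
            also have "\<dots> = C i powr (1 / p i) * N i"
              using C[OF i] N[OF i] p0[OF i] by (simp add: Y_def powr_mult powr_powr)
            finally show "(Y i powr (P / p i)) powr (1 / P) = C i powr (1 / p i) * N i" .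
          qed simp
          finally show ?thesis using S Z by (simp add: C'_def powr_mult prod.distrib)
        qed
        also have "ennreal (C' * (\<Prod>i=1..m. N i)) = ennreal C' * (\<Prod>i=1..m. norm_Lq1 (p i) (w i) (modulus (f i)))"
        proof -
          have "(\<Prod>i=1..m. norm_Lq1 (p i) (w i) (g i)) = ennreal (\<Prod>i=1..m. N i)"
            using N by (subst prod_ennreal[symmetric]) (auto intro!: prod.cong less_imp_le)
          moreover have "0 \<le> (\<Prod>i=1..m. N i)" using N by (intro prod_nonneg) (auto intro: less_imp_le)
          ultimately show ?thesis using C' by (simp add: g_def ennreal_mult)
        qed
        finally show ?thesis unfolding H .
      qed
    qed
  qed
  then show ?thesis using C' by (intro exI[of _ C'] conjI allI impI) simp_all
qed

end
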